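(* Let $\gamma>0$ and assume Hypothesis $Z(\gamma)$. Fix a nonzero integer $a$, a real number $A>0$ and a real number $\alpha$ with $0<\alpha<\gamma$. Then for all $2\le y\le x$ we have \[ d_{TV}(\mathbf{W}_y,\mathbf{U}_{x,y}) \ll_{a,A,\alpha} e^{-\alpha u\log u} + \frac{1}{(\log x)^A}, \qquad u=\frac{\log x}{\log y}, \] where the implied constant depends only on $a$, $A$ and $\alpha$.
   Context: Notation: $p,q$ denote primes; $\pi(x)$ is the number of primes $\le x$; $\pi(x;m,b)$ is the number of primes $p\le x$ with $p\equiv b \pmod m$; $\phi$ is Euler's function; $P^+(n)$ is the largest prime factor of $n$ (with $P^+(1)=0$). Hypothesis $Z(\gamma)$: for every $\varepsilon>0$ there is $\delta>0$ such that for every $B\ge 1$ and every nonzero integer $a$, \[ \sum_{\substack{m\le x^{\gamma-\varepsilon}\\ P^+(m)\le x^{\delta}\\ (m,a)=1}} \Big|\pi(x;m,-a)-\frac{\pi(x)}{\phi(m)}\Big| \ll_{B,\varepsilon,a} \frac{x}{(\log x)^B}. \] Random model: for each prime $q$ let $W_q$ be a random variable on $\{0,1,2,\dots\}$, the $W_q$ mutually independent, with $W_q=0$ almost surely if $q\mid a$, and if $q\nmid a$, \[ \mathbb{P}(W_q=v)=\frac{1}{\phi(q^v)}-\frac{1}{\phi(q^{v+1})}=\begin{cases}1-\frac{1}{q-1}, & v=0,\\ q^{-v}, & v\ge 1.\end{cases} \] Let $\mathbf{W}_y=(W_q: q\le y)$. Actual factorization: choose a prime $p$ uniformly at random from the primes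 in $(|a|+1,x]$, write $p+a=\prod_q q^{u_q}$, and let $\mathbf{U}_{x,y}=(u_q:q\le y)$. The total variation distance between random variables $X,Y$ on the same countable space $\Omega$ is $d_{TV}(X,Y)=\sup_{U\subset\Omega}|\mathbb{P}(X\in U)-\mathbb{P}(Y\in U)|$. *)

theory Defs
  imports "HOL-Probability.Probability" "HOL-Number_Theory.Number_Theory"
begin

definition prime_count :: "real \<Rightarrow> nat" where
  "prime_count x = card {p::nat. prime p \<and> real p \<le> x}"

definition prime_count_cong :: "real \<Rightarrow> nat \<Rightarrow> int \<Rightarrow> nat" where
  "prime_count_cong x m b = card {p::nat. prime p \<and> real p \<le> x \<and> [int p = b] (mod int m)}"

definition largest_prime_factor :: "nat \<Rightarrow> nat" where
  "largest_prime_factor n = (if n \<le> 1 then 0 else Max (prime_factors n))"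

text \<open>The implied constant \<open>C\<close> is uniform in \<open>x \<ge> 2\<close>.\<close>

definition hypothesis_Z :: "real \<Rightarrow> bool" where
  "hypothesis_Z \<gamma> \<longleftrightarrow>
     (\<forall>\<epsilon>>0. \<exists>\<delta>>0. \<forall>B\<ge>1. \<forall>a::int. a \<noteq> 0 \<longrightarrow>
       (\<exists>C::real. \<forall>x\<ge>2.
         (\<Sum>m | 1 \<le> m \<and> real m \<le> x powr (\<gamma> - \<epsilon>) \<and>
                real (largest_prime_factor m) \<le> x powr \<delta> \<and> coprime (int m) a.
            \<bar>real (prime_count_cong x m (- a)) - real (prime_count x) / real (totient m)\<bar>)
         \<le> C * (x / ln x powr B)))"

definition W_law :: "int \<Rightarrow> nat \<Rightarrow> nat pmf" where
  "W_law a q =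
     (if int q dvd a then return_pmf 0
      else embed_pmf (\<lambda>v. 1 / real (totient (q ^ v)) - 1 / real (totient (q ^ Suc v))))"

text \<open>The mass function passed to \<^const>\<open>embed_pmf\<close> is a genuine probability
  mass function, so the construction has the intended point probabilities.\<close>

lemma real_totient_prime_power_Suc:
  fixes q n :: nat
  assumes "prime q"
  shows "real (totient (q ^ Suc n)) = real q ^ n * (real q - 1)"
  using prime_ge_2_nat[OF assms] totient_prime_power_Suc[OF assms, of n]
  by (simp del: power_Suc add: of_nat_diff)

lemma W_mass_eq:
  fixes q v :: nat
  assumes "prime q"
  shows "1 / real (totient (q ^ v)) - 1 / real (totient (q ^ Suc v)) =
           (if v = 0 then 1 - 1 / (real q - 1) else 1 / real q ^ v)"
proof (cases v)
  case 0
  then show ?thesis using real_totient_prime_power_Suc[OF assms, of 0] by simp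
next
  case (Suc n)
  have *: "1 / (b * (c - 1)) - 1 / (c * b * (c - 1)) = 1 / (c * b)"
    if "b \<noteq> 0" "c \<noteq> 0" "c - 1 \<noteq> 0" for b c :: real
  proof -
    have "1 / (b * (c - 1)) = c / (c * b * (c - 1))" using that by simp
    then have "1 / (b * (c - 1)) - 1 / (c * b * (c - 1)) = (c - 1) / (c * b * (c - 1))"
      by (simp only: diff_divide_distrib)
    then show ?thesis using that(3) by simp
  qed
  have "1 / (real q ^ n * (real q - 1)) - 1 / (real q ^ Suc n * (real q - 1)) = 1 / real q ^ Suc n"
    using *[of "real q ^ n" "real q"] prime_ge_2_nat[OF assms] by simp
  then show ?thesis unfolding Suc real_totient_prime_power_Suc[OF assms] by simp
qed

lemma W_mass_nonneg:
  fixes q v :: nat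
  assumes "prime q"
  shows "0 \<le> 1 / real (totient (q ^ v)) - 1 / real (totient (q ^ Suc v))"
  using prime_ge_2_nat[OF assms] by (subst W_mass_eq[OF assms]) (auto simp: field_simps)

lemma W_mass_sums:
  fixes q :: nat
  assumes "prime q"
  shows "(\<lambda>v. 1 / real (totient (q ^ v)) - 1 / real (totient (q ^ Suc v))) sums 1"
proof -
  have q: "q \<ge> 2" using assms prime_ge_2_nat by blast
  have "(\<lambda>n. (1 / real q) ^ n * (1 / (real q - 1))) \<longlonglongrightarrow> 0 * (1 / (real q - 1))"
    using q by (intro tendsto_mult LIMSEQ_power_zero tendsto_const) auto
  moreover have "1 / real (totient (q ^ Suc n)) = (1 / real q) ^ n * (1 / (real q - 1))" for n
    unfolding real_totient_prime_power_Suc[OF assms] by (simp add: power_one_over)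
  ultimately have "(\<lambda>n. 1 / real (totient (q ^ Suc n))) \<longlonglongrightarrow> 0"
    by simp
  then have "(\<lambda>n. 1 / real (totient (q ^ n))) \<longlonglongrightarrow> 0"
    by (rule LIMSEQ_imp_Suc)
  from telescope_sums'[OF this] show ?thesis by simp
qed

lemma pmf_W_law:
  assumes "prime q" "\<not> int q dvd a"
  shows "pmf (W_law a q) v = 1 / real (totient (q ^ v)) - 1 / real (totient (q ^ Suc v))"
proof -
  let ?f = "\<lambda>v. 1 / real (totient (q ^ v)) - 1 / real (totient (q ^ Suc v))"
  have "(\<integral>\<^sup>+ v. ennreal (?f v) \<partial>count_space UNIV) = (\<Sum>v. ennreal (?f v))"
    by (rule nn_integral_count_space_nat)
  also have "\<dots> = ennreal (\<Sum>v. ?f v)"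
    using W_mass_nonneg[OF assms(1)] W_mass_sums[OF assms(1)]
    by (intro suminf_ennreal2) (auto simp: sums_iff)
  also have "\<dots> = 1"
    using W_mass_sums[OF assms(1)] by (simp add: sums_iff)
  finally have "(\<integral>\<^sup>+ v. ennreal (?f v) \<partial>count_space UNIV) = 1" .
  then have "pmf (embed_pmf ?f) v = ?f v"
    by (intro pmf_embed_pmf W_mass_nonneg[OF assms(1)])
  then show ?thesis using assms(2) by (simp add: W_law_def)
qed

definition primes_upto :: "real \<Rightarrow> nat set" where
  "primes_upto y = {q::nat. prime q \<and> real q \<le> y}"

text \<open>A vector indexed by the primes \<open>q \<le> y\<close> is a function on \<^typ>\<open>nat\<close> that vanishes at
  all other indices.  Mutual independence of the \<open>W\<^sub>q\<close> is expressed by the product law.\<close>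

definition W_vec :: "int \<Rightarrow> real \<Rightarrow> (nat \<Rightarrow> nat) pmf" where
  "W_vec a y = Pi_pmf (primes_upto y) 0 (W_law a)"

text \<open>For bounded \<open>x\<close> there may be no prime in \<open>(|a|+1, x]\<close>, and then the law below is an
  unspecified one; any \<open>d_TV\<close> is at most 1, so this affects only the value of a constant that is
  allowed to depend on \<open>a\<close>.\<close>

definition U_vec :: "int \<Rightarrow> real \<Rightarrow> real \<Rightarrow> (nat \<Rightarrow> nat) pmf" where
  "U_vec a x y =
     map_pmf (\<lambda>p q. if q \<in> primes_upto y then multiplicity (int q) (int p + a) else 0)
       (pmf_of_set {p::nat. prime p \<and> \<bar>a\<bar> + 1 < int p \<and> real p \<le> x})"

definition d_TV :: "'a pmf \<Rightarrow> 'a pmf \<Rightarrow> real" where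
  "d_TV X Y = (SUP U. \<bar>measure_pmf.prob X U - measure_pmf.prob Y U\<bar>)"

end

theory Submission
  imports Defs "HOL-Real_Asymp.Real_Asymp"
begin

text \<open>
  Let \<open>g(q\<^sup>v) = P(W\<^sub>q \<ge> v) = 1 / \<phi>(q\<^sup>v)\<close>. The probability that a vector equals \<open>n\<close> is a sieve problem: it is an alternating
  sum over squarefree \<open>d\<close> of the probabilities that \<open>n d\<close> divides the number, and these are \<open>1 / \<phi>(n d)\<close>
  in the model and are controlled by Hypothesis Z for the shifted primes. Since the total variation
  distance is the sum of the positive parts of \<open>P(W = n) - P(U = n)\<close>, a lower bound sieve suffices.

  To reach every exponent below \<open>\<gamma>\<close>, the primes up to \<open>y\<close> are split into the blocks
  \<open>(y^(r^(2j+2)), y^(r^(2j))]\<close>, and block \<open>j\<close> is given the level \<open>D\<^sub>j = x^(\<beta> r^j)\<close> with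
  \<open>\<beta> / (1 - r) < \<gamma>\<close>. In each block the inclusion-exclusion is cut by Bonferroni at a number of prime
  factors that depends on the size of the block part \<open>n\<^sub>j\<close> of \<open>n\<close>, so that \<open>n\<^sub>j d\<^sub>j\<close> makes full use of the
  level. The sum of \<open>1/q\<close> over a block is bounded, hence Rankin's trick shows that the loss in block
  \<open>j\<close>, where \<open>log D\<^sub>j / log y\<^sub>j = \<beta> u r^(-j)\<close>, is at most \<open>exp (- \<alpha> u log u)\<close> times a geometric factor,
  up to a negligible term from the blocks of very small primes.
\<close>

text \<open>The obstacle is uniformity in \<open>y\<close>. The sum of 1/q over all primes up to
  \<open>y\<close> grows like log log y, and it stands in the exponent of a Rankin estimate; with a
  single block this would cost a power of log y when \<open>u\<close> stays bounded. Hence blocks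
  with bounded sum. The logarithms of block edges and of levels shrink at different speeds, r^2 and
  r per block: levels that shrink at all have a product of bounded exponent, and levels that shrink
  more slowly than the edges make later blocks cheaper. Joining blockwise Bonferroni sums to a lower
  bound is the device of the Brun-Hooley sieve. Hypothesis Z carries no divisor weights, whereas a
  modulus m = n d arises in 2^\<omega>(m) ways. The weights are removed by a trivial bound for
  single moduli, which costs only powers of log x but requires m \<le> x; this is why
  \<open>\<gamma> \<le> 1\<close> is derived first. Moduli must be x^\<delta>-smooth, that is,
  \<open>u\<close> must be at least 1/\<delta>. For smaller \<open>u\<close> the first term of the
  claimed bound is bounded below, so a large constant settles that range.\<close>

section \<open>Vectors of exponents and the block sieve\<close>

text \<open>An exponent vector with support in \<open>Q\<close> and entries at most \<open>V\<close>; the cut-off \<open>V\<close> keeps all sums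
  finite and is chosen large at the end.\<close>

definition vecs :: "'a set \<Rightarrow> nat \<Rightarrow> ('a \<Rightarrow> nat) set" where
  "vecs Q V = PiE_dflt Q 0 (\<lambda>_. {..V})"

definition restr :: "('a \<Rightarrow> nat) \<Rightarrow> 'a set \<Rightarrow> 'a \<Rightarrow> nat" where
  "restr f B = (\<lambda>q. if q \<in> B then f q else 0)"

lemma restr_apply [simp]: "q \<in> B \<Longrightarrow> restr f B q = f q"
  by (simp add: restr_def)

lemma finite_vecs [simp, intro]: "finite Q \<Longrightarrow> finite (vecs Q V)"
  unfolding vecs_def by (intro finite_PiE_dflt) auto

lemma mem_vecs: "f \<in> vecs Q V \<longleftrightarrow> (\<forall>q\<in>Q. f q \<le> V) \<and> (\<forall>q. q \<notin> Q \<longrightarrow> f q = 0)"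
  unfolding vecs_def PiE_dflt_def by auto

lemma vecs_empty [simp]: "vecs {} V = {\<lambda>_. 0}"
  by (auto simp: mem_vecs)

lemma sum_vecs_Un:
  fixes F :: "('a \<Rightarrow> nat) \<Rightarrow> ('a \<Rightarrow> nat) \<Rightarrow> 'b::comm_semiring_0"
  assumes "A \<inter> B = {}"
  shows "(\<Sum>f\<in>vecs (A \<union> B) V. F (restr f A) (restr f B)) = (\<Sum>f\<in>vecs A V. \<Sum>g\<in>vecs B V. F f g)"
proof -
  have disj: "\<And>q. q \<in> A \<Longrightarrow> q \<notin> B" "\<And>q. q \<in> B \<Longrightarrow> q \<notin> A"
    using assms by auto
  show ?thesis
  unfolding sum.cartesian_product
  by (rule sum.reindex_bij_witness[where i = "\<lambda>(f,g) q. f q + g q" and j = "\<lambda>f. (restr f A, restr f B)"])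
     (auto simp: mem_vecs restr_def fun_eq_iff disj)
qed

lemma restr_restr: "B \<subseteq> A \<Longrightarrow> restr (restr f A) B = restr f B"
  by (auto simp: restr_def fun_eq_iff)

text \<open>Restriction to disjoint blocks is a bijection, so this is distributivity: an Euler
  product grouped by blocks. It lets sums with blockwise factors be estimated one block at a
  time.\<close>

lemma sum_vecs_prod_blocks:
  fixes h :: "'i \<Rightarrow> ('a \<Rightarrow> nat) \<Rightarrow> 'b::comm_semiring_1"
  assumes "finite I" "disjoint_family_on B I"
  shows "(\<Sum>f\<in>vecs (\<Union>i\<in>I. B i) V. \<Prod>i\<in>I. h i (restr f (B i))) = (\<Prod>i\<in>I. \<Sum>f\<in>vecs (B i) V. h i f)"
  using assms
proof (induction I rule: finite_induct)
  case empty
  then show ?case by simp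
next
  case (insert k I)
  let ?U = "\<Union>i\<in>I. B i"
  have disj: "B k \<inter> ?U = {}" and df: "disjoint_family_on B I"
    using insert.prems insert.hyps(2) by (auto simp: disjoint_family_on_def)
  have "(\<Sum>f\<in>vecs (\<Union>i\<in>insert k I. B i) V. \<Prod>i\<in>insert k I. h i (restr f (B i)))
      = (\<Sum>f\<in>vecs (B k \<union> ?U) V. h k (restr f (B k)) * (\<Prod>i\<in>I. h i (restr (restr f ?U) (B i))))"
    using insert.hyps by (intro sum.cong) (auto simp: restr_restr UN_upper intro!: prod.cong)
  also have "\<dots> = (\<Sum>f\<in>vecs (B k) V. \<Sum>g\<in>vecs ?U V. h k f * (\<Prod>i\<in>I. h i (restr g (B i))))"
    by (rule sum_vecs_Un[OF disj])
  also have "\<dots> = (\<Prod>i\<in>insert k I. \<Sum>f\<in>vecs (B i) V. h i f)"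
    using insert df by (simp add: sum_distrib_left[symmetric] sum_distrib_right[symmetric])
  finally show ?case .
qed

lemma sum_vecs_prod:
  fixes h :: "'a \<Rightarrow> nat \<Rightarrow> 'b::comm_semiring_1"
  assumes "finite Q"
  shows "(\<Sum>f\<in>vecs Q V. \<Prod>q\<in>Q. h q (f q)) = (\<Prod>q\<in>Q. \<Sum>v\<le>V. h q v)"
proof -
  have "(\<Sum>f\<in>vecs (\<Union>q\<in>Q. {q}) V. \<Prod>q\<in>Q. h q (restr f {q} q)) = (\<Prod>q\<in>Q. \<Sum>f\<in>vecs {q} V. h q (f q))"
    by (rule sum_vecs_prod_blocks[where h = "\<lambda>q f. h q (f q)"]) (use assms in \<open>auto simp: disjoint_family_on_def\<close>)
  moreover have "(\<Sum>f\<in>vecs {q} V. h q (f q)) = (\<Sum>v\<le>V. h q v)" for q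
    by (rule sum.reindex_bij_witness[where i = "\<lambda>v p. if p = q then v else 0" and j = "\<lambda>f. f q"])
       (auto simp: mem_vecs fun_eq_iff)
  ultimately show ?thesis by simp
qed

definition indv :: "'a set \<Rightarrow> 'a \<Rightarrow> nat" where "indv S = (\<lambda>q. if q \<in> S then 1 else 0)"

lemma sum_vecs_1:
  fixes F :: "('a \<Rightarrow> nat) \<Rightarrow> 'b::comm_monoid_add"
  shows "(\<Sum>d\<in>vecs B 1. F d) = (\<Sum>S\<in>Pow B. F (indv S))"
proof -
  have eq: "indv {q. d q = 1} = d" if "d \<in> vecs B 1" for d :: "'a \<Rightarrow> nat"
  proof
    fix q show "indv {q. d q = 1} q = d q"
      using that by (cases "q \<in> B") (auto simp: mem_vecs indv_def dest!: bspec[of _ _ q])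
  qed
  show ?thesis
    by (rule sum.reindex_bij_witness[where i = "indv" and j = "\<lambda>d. {q. d q = 1}"])
       (simp_all only: eq, auto simp: indv_def mem_vecs)
qed

section \<open>Bonferroni inequalities for one block\<close>

lemma sum_Pow_card:
  fixes F :: "nat \<Rightarrow> real"
  assumes "finite E"
  shows "(\<Sum>S\<in>Pow E. F (card S)) = (\<Sum>k\<le>card E. real (card E choose k) * F k)"
proof -
  have "(\<Sum>S\<in>Pow E. F (card S)) = (\<Sum>k\<le>card E. \<Sum>S\<in>{S\<in>Pow E. card S = k}. F (card S))"
    by (rule sum.group[symmetric]) (use assms in \<open>auto intro: card_mono\<close>)
  also have "\<dots> = (\<Sum>k\<le>card E. real (card E choose k) * F k)"
    using n_subsets[OF assms] by (intro sum.cong) auto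
  finally show ?thesis .
qed

text \<open>The alternating sum collapses to (-1)^b times the binomial coefficient of N - 1 over b.
  Reading it as a generalised binomial coefficient covers N = 0, where it equals 1 because
  \<open>b\<close> is even. For N > 0, Pascal's rule bounds it by the coefficient of N over b + 1,
  the first omitted layer.\<close>

lemma bonferroni_choose:
  fixes N b :: nat
  assumes "even b"
  defines "T \<equiv> (\<Sum>k\<le>N. real (N choose k) * (if k \<le> b then (-1)^k else 0))"
  defines "R \<equiv> (\<Sum>k\<le>N. real (N choose k) * (if k = b + 1 then 1 else 0))"
  shows "of_bool (N = 0) \<le> T" "T \<le> of_bool (N = 0) + R"
proof -
  have "T = (\<Sum>k\<le>b. real (N choose k) * (-1)^k)"
    unfolding T_def by (rule sum.mono_neutral_cong) auto
  also have "\<dots> = (-1)^b * ((real N - 1) gchoose b)"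
    using gbinomial_sum_lower_neg[of "real N" b] by (simp add: binomial_gbinomial)
  finally have T: "T = ((real N - 1) gchoose b)" using assms(1) by simp
  have R: "R = real (N choose (b+1))"
    unfolding R_def by (subst sum.mono_neutral_cong_right[where S = "if b + 1 \<le> N then {b+1} else {}"]) auto
  have "of_bool (N = 0) \<le> T \<and> T \<le> of_bool (N = 0) + R"
  proof (cases N)
    case 0
    have "((-1::real) gchoose b) = 1" using assms(1) gbinomial_minus[of "1::real" b] binomial_gbinomial[of b b, where ?'a = real]
      by simp
    then show ?thesis using 0 T R by simp
  next
    case (Suc M)
    then have "T = real (M choose b)" using T by (simp add: binomial_gbinomial)
    then show ?thesis using Suc R by simp
  qed
  then show "of_bool (N = 0) \<le> T" "T \<le> of_bool (N = 0) + R" by auto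
qed

text \<open>Here \<open>d\<close> stands for a squarefree number with prime factors in the block \<open>B\<close>, encoded by its 0/1
  exponent vector: \<open>sieve_t\<close> is the Moebius function cut off after \<open>b\<close> prime factors, \<open>sieve_r\<close> the first
  omitted layer, which bounds the truncation error.\<close>

definition sieve_t :: "'a set \<Rightarrow> nat \<Rightarrow> ('a \<Rightarrow> nat) \<Rightarrow> real" where
  "sieve_t B b d = (if sum d B \<le> b then (-1) ^ sum d B else 0)"

definition sieve_r :: "'a set \<Rightarrow> nat \<Rightarrow> ('a \<Rightarrow> nat) \<Rightarrow> real" where
  "sieve_r B b d = (if sum d B = b + 1 then 1 else 0)"

text \<open>Unless \<open>n \<le> s\<close> on \<open>B\<close>, all three quantities vanish.
  Otherwise the \<open>d\<close> that fit are the subsets of the set where \<open>n q < s q\<close>,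
  and equality on \<open>B\<close> means that this set is empty; so only its cardinality matters,
  and \<open>bonferroni_choose\<close> applies.\<close>

lemma bonferroni_block:
  fixes n s :: "'a \<Rightarrow> nat"
  assumes "finite B" "even b"
  defines "x \<equiv> of_bool (\<forall>q\<in>B. s q = n q)"
  defines "T \<equiv> (\<Sum>d\<in>vecs B 1. sieve_t B b d * of_bool (\<forall>q\<in>B. n q + d q \<le> s q))"
  defines "R \<equiv> (\<Sum>d\<in>vecs B 1. sieve_r B b d * of_bool (\<forall>q\<in>B. n q + d q \<le> s q))"
  shows "x \<le> T" "T \<le> x + R"
proof -
  have eq: "(\<Sum>d\<in>vecs B 1. F (sum d B) * of_bool (\<forall>q\<in>B. n q + d q \<le> s q))
      = of_bool (\<forall>q\<in>B. n q \<le> s q) * (\<Sum>S\<in>Pow {q\<in>B. n q < s q}. F (card S))" for F :: "nat \<Rightarrow> real"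
  proof -
    have "(\<Sum>d\<in>vecs B 1. F (sum d B) * of_bool (\<forall>q\<in>B. n q + d q \<le> s q))
       = (\<Sum>S\<in>Pow B. F (card S) * of_bool (\<forall>q\<in>B. n q + indv S q \<le> s q))"
      unfolding sum_vecs_1
    proof (intro sum.cong refl)
      fix S assume "S \<in> Pow B"
      then have "B \<inter> S = S" by auto
      then have "sum (indv S) B = card S"
        using assms(1) by (simp add: indv_def sum.If_cases)
      then show "F (sum (indv S) B) * of_bool (\<forall>q\<in>B. n q + indv S q \<le> s q)
        = F (card S) * of_bool (\<forall>q\<in>B. n q + indv S q \<le> s q)" by simp
    qed
    also have "\<dots> = (\<Sum>S\<in>Pow B. if S \<in> Pow {q\<in>B. n q < s q} then
                         of_bool (\<forall>q\<in>B. n q \<le> s q) * F (card S) else 0)"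
    proof (intro sum.cong refl)
      fix S assume S: "S \<in> Pow B"
      have "(\<forall>q\<in>B. n q + indv S q \<le> s q) \<longleftrightarrow> (\<forall>q\<in>B. n q \<le> s q) \<and> S \<subseteq> {q\<in>B. n q < s q}"
      proof safe
        fix q assume "\<forall>q\<in>B. n q + indv S q \<le> s q" "q \<in> S"
        then show "n q < s q" using S by (auto simp: indv_def dest!: bspec[of _ _ q])
      qed (use S in \<open>force simp: indv_def\<close>)+
      then show "F (card S) * of_bool (\<forall>q\<in>B. n q + indv S q \<le> s q) =
        (if S \<in> Pow {q\<in>B. n q < s q} then of_bool (\<forall>q\<in>B. n q \<le> s q) * F (card S) else 0)"
        by auto
    qed
    also have "\<dots> = of_bool (\<forall>q\<in>B. n q \<le> s q) * (\<Sum>S\<in>Pow {q\<in>B. n q < s q}. F (card S))"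
      unfolding sum_distrib_left using assms(1) by (intro sum.mono_neutral_cong_right) auto
    finally show ?thesis .
  qed
  have fE: "finite {q\<in>B. n q < s q}" using assms(1) by simp
  note bc = bonferroni_choose[OF assms(2), of "card {q\<in>B. n q < s q}"]
  have T: "T = of_bool (\<forall>q\<in>B. n q \<le> s q) * (\<Sum>k\<le>card {q\<in>B. n q < s q}.
      real (card {q\<in>B. n q < s q} choose k) * (if k \<le> b then (-1)^k else 0))"
    unfolding T_def sieve_t_def
    by (subst eq[of "\<lambda>k. if k \<le> b then (-1)^k else 0"], subst sum_Pow_card[OF fE]) simp
  have R: "R = of_bool (\<forall>q\<in>B. n q \<le> s q) * (\<Sum>k\<le>card {q\<in>B. n q < s q}.
      real (card {q\<in>B. n q < s q} choose k) * (if k = b + 1 then 1 else 0))"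
    unfolding R_def sieve_r_def
    by (subst eq[of "\<lambda>k. if k = b + 1 then 1 else 0"], subst sum_Pow_card[OF fE]) simp
  have x: "x = of_bool (\<forall>q\<in>B. n q \<le> s q) * of_bool (card {q\<in>B. n q < s q} = 0)"
    unfolding x_def using assms(1) by (auto simp: le_less)
  show "x \<le> T" "T \<le> x + R"
    unfolding x T R using bc by (auto simp: algebra_simps simp del: sum_of_bool_mult_eq sum_mult_of_bool_eq)
qed

text \<open>A product of upper bounds is no lower bound, so it has to be corrected. Passing from
  \<open>T i\<close> to \<open>x i\<close> one factor at a time, each replacement costs at most
  \<open>R k\<close> times the remaining \<open>T i\<close>.\<close>

lemma prod_le_sum_replace:
  fixes x T R :: "'i \<Rightarrow> real"
  assumes "finite I" "\<And>i. i \<in> I \<Longrightarrow> 0 \<le> x i" "\<And>i. i \<in> I \<Longrightarrow> x i \<le> T i" "\<And>i. i \<in> I \<Longrightarrow> T i \<le> x i + R i"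
  shows "(\<Prod>i\<in>I. T i) - (\<Sum>k\<in>I. \<Prod>i\<in>I. if i = k then R i else T i) \<le> (\<Prod>i\<in>I. x i)"
  using assms
proof (induction I rule: finite_induct)
  case empty
  then show ?case by simp
next
  case (insert k I)
  let ?S = "\<Sum>j\<in>I. \<Prod>i\<in>I. if i = j then R i else T i"
  have 1: "(\<Sum>j\<in>insert k I. \<Prod>i\<in>insert k I. if i = j then R i else T i)
     = R k * (\<Prod>i\<in>I. T i) + T k * ?S"
  proof -
    have "(\<Prod>i\<in>I. if i = k then R i else T i) = (\<Prod>i\<in>I. T i)"
      using insert.hyps by (intro prod.cong) auto
    moreover have "(\<Sum>j\<in>I. \<Prod>i\<in>insert k I. if i = j then R i else T i) = T k * ?S"
      unfolding sum_distrib_left using insert.hyps by (intro sum.cong) auto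
    ultimately show ?thesis using insert.hyps by simp
  qed
  have nn: "0 \<le> T k" "0 \<le> R k" using insert.prems[of k] by force+
  have P: "0 \<le> (\<Prod>i\<in>I. x i)" "(\<Prod>i\<in>I. x i) \<le> (\<Prod>i\<in>I. T i)"
    using insert.prems by (auto intro!: prod_nonneg prod_mono)
  have IH: "(\<Prod>i\<in>I. T i) - ?S \<le> (\<Prod>i\<in>I. x i)" using insert by auto
  have "T k * (\<Prod>i\<in>I. T i) - T k * ?S \<le> T k * (\<Prod>i\<in>I. x i)"
    using mult_left_mono[OF IH nn(1)] by (simp add: algebra_simps)
  also have "\<dots> \<le> x k * (\<Prod>i\<in>I. x i) + R k * (\<Prod>i\<in>I. x i)"
    using mult_right_mono[OF insert.prems(3)[of k] P(1)] by (simp add: algebra_simps)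
  also have "\<dots> \<le> x k * (\<Prod>i\<in>I. x i) + R k * (\<Prod>i\<in>I. T i)"
    using mult_left_mono[OF P(2) nn(2)] by simp
  finally show ?case unfolding 1 using insert.hyps by simp
qed

section \<open>Total variation distance, and indicator inequalities integrated to
  probabilities\<close>

lemma d_TV_le_sum:
  assumes "finite G"
  shows "d_TV X Y \<le> (\<Sum>n\<in>G. max 0 (pmf X n - pmf Y n)) + (1 - (\<Sum>n\<in>G. pmf X n))"
proof -
  let ?K = "(\<Sum>n\<in>G. max 0 (pmf X n - pmf Y n)) + (1 - (\<Sum>n\<in>G. pmf X n))"
  have one_sided: "measure_pmf.prob X S - measure_pmf.prob Y S \<le> ?K" for S
  proof -
    have X: "measure_pmf.prob X S = measure_pmf.prob X (S \<inter> G) + measure_pmf.prob X (S - G)"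
      by (subst measure_pmf.finite_measure_Union[symmetric]) (auto intro!: arg_cong[where f = "measure_pmf.prob X"])
    have "measure_pmf.prob Y (S \<inter> G) \<le> measure_pmf.prob Y S"
      by (intro measure_pmf.finite_measure_mono) auto
    moreover have "measure_pmf.prob X (S \<inter> G) - measure_pmf.prob Y (S \<inter> G) \<le> (\<Sum>n\<in>G. max 0 (pmf X n - pmf Y n))"
    proof -
      have "measure_pmf.prob X (S \<inter> G) - measure_pmf.prob Y (S \<inter> G) = (\<Sum>n\<in>S \<inter> G. pmf X n - pmf Y n)"
        using assms by (simp add: measure_measure_pmf_finite sum_subtractf)
      also have "\<dots> \<le> (\<Sum>n\<in>S \<inter> G. max 0 (pmf X n - pmf Y n))" by (intro sum_mono) auto
      also have "\<dots> \<le> (\<Sum>n\<in>G. max 0 (pmf X n - pmf Y n))" using assms by (intro sum_mono2) auto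
      finally show ?thesis .
    qed
    moreover have "measure_pmf.prob X (S - G) \<le> 1 - (\<Sum>n\<in>G. pmf X n)"
    proof -
      have "measure_pmf.prob X (S - G) \<le> measure_pmf.prob X (UNIV - G)"
        by (intro measure_pmf.finite_measure_mono) auto
      also have "\<dots> = 1 - measure_pmf.prob X G"
        using measure_pmf.prob_compl[of G X] by simp
      finally show ?thesis using assms by (simp add: measure_measure_pmf_finite)
    qed
    ultimately show ?thesis using X by linarith
  qed
  \<comment> \<open>On a set and on its complement the two probabilities differ by opposite amounts,
    so the one-sided bound, applied to both, controls the absolute value.\<close>
  have "\<bar>measure_pmf.prob X S - measure_pmf.prob Y S\<bar> \<le> ?K" for S
    using one_sided[of S] one_sided[of "UNIV - S"] measure_pmf.prob_compl[of S X] measure_pmf.prob_compl[of S Y]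
    by simp
  then show ?thesis unfolding d_TV_def by (intro cSUP_least) auto
qed

lemma d_TV_le_1: "d_TV X Y \<le> 1"
proof -
  have "\<bar>measure_pmf.prob X S - measure_pmf.prob Y S\<bar> \<le> 1" for S
    using measure_pmf.prob_le_1[of X S] measure_pmf.prob_le_1[of Y S]
      measure_nonneg[of X S] measure_nonneg[of Y S] by linarith
  then show ?thesis unfolding d_TV_def by (intro cSUP_least) auto
qed

lemma
  fixes c :: "'d \<Rightarrow> real"
  shows expectation_lincomb: "measure_pmf.expectation \<mu> (\<lambda>s. \<Sum>d\<in>D. c d * of_bool (P d s)) = (\<Sum>d\<in>D. c d * measure_pmf.prob \<mu> {s. P d s})"
    and integrable_lincomb: "integrable (measure_pmf \<mu>) (\<lambda>s. \<Sum>d\<in>D. c d * of_bool (P d s))"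
proof -
  have eq: "(of_bool (P d s) :: real) = indicator {s. P d s} s" for d s
    by (auto simp: indicator_def)
  have i: "integrable (measure_pmf \<mu>) (\<lambda>s. c d * of_bool (P d s))" for d
    unfolding eq by (intro integrable_mult_right integrable_real_indicator) (auto simp: measure_pmf.emeasure_eq_measure)
  show "integrable (measure_pmf \<mu>) (\<lambda>s. \<Sum>d\<in>D. c d * of_bool (P d s))"
    using i by (rule Bochner_Integration.integrable_sum)
  show "measure_pmf.expectation \<mu> (\<lambda>s. \<Sum>d\<in>D. c d * of_bool (P d s)) = (\<Sum>d\<in>D. c d * measure_pmf.prob \<mu> {s. P d s})"
    using i by (subst Bochner_Integration.integral_sum) (auto simp: eq)
qed

text \<open>A pointwise inequality between combinations of indicators is integrated. A single event
  is such a combination over the one-point index set \<open>{()}\<close>.\<close>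

lemma prob_lincomb_mono:
  fixes c :: "'d \<Rightarrow> real" and c' :: "'e \<Rightarrow> real"
  assumes "\<And>s. (\<Sum>d\<in>D. c d * of_bool (P d s)) \<le> (\<Sum>d\<in>D'. c' d * of_bool (P' d s))"
  shows "(\<Sum>d\<in>D. c d * measure_pmf.prob \<mu> {s. P d s}) \<le> (\<Sum>d\<in>D'. c' d * measure_pmf.prob \<mu> {s. P' d s})"
  unfolding expectation_lincomb[symmetric]
  by (intro integral_mono integrable_lincomb assms)

lemma bonferroni_block_prob:
  fixes n :: "'a \<Rightarrow> nat" and \<mu> :: "('a \<Rightarrow> nat) pmf"
  assumes "finite B" "even b"
  defines "x \<equiv> measure_pmf.prob \<mu> {s. \<forall>q\<in>B. s q = n q}"
  defines "T \<equiv> (\<Sum>d\<in>vecs B 1. sieve_t B b d * measure_pmf.prob \<mu> {s. \<forall>q\<in>B. n q + d q \<le> s q})"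
  defines "R \<equiv> (\<Sum>d\<in>vecs B 1. sieve_r B b d * measure_pmf.prob \<mu> {s. \<forall>q\<in>B. n q + d q \<le> s q})"
  shows "x \<le> T" "T \<le> x + R"
proof -
  have "(\<Sum>d\<in>{()}. 1 * measure_pmf.prob \<mu> {s. \<forall>q\<in>B. s q = n q}) \<le> T"
    unfolding T_def by (rule prob_lincomb_mono) (use bonferroni_block(1)[OF assms(1,2)] in simp)
  then show "x \<le> T" by (simp add: x_def)
  have "(\<Sum>d\<in>vecs B 1. (sieve_t B b d - sieve_r B b d) * measure_pmf.prob \<mu> {s. \<forall>q\<in>B. n q + d q \<le> s q})
      \<le> (\<Sum>d\<in>{()}. 1 * measure_pmf.prob \<mu> {s. \<forall>q\<in>B. s q = n q})"
  proof (rule prob_lincomb_mono)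
    fix s :: "'a \<Rightarrow> nat"
    show "(\<Sum>d\<in>vecs B 1. (sieve_t B b d - sieve_r B b d) * of_bool (\<forall>q\<in>B. n q + d q \<le> s q))
         \<le> (\<Sum>d\<in>{()}. 1 * of_bool (\<forall>q\<in>B. s q = n q))"
      using bonferroni_block(2)[OF assms(1,2), where s = s and n = n]
      by (simp add: left_diff_distrib sum_subtractf del: of_bool_eq_iff split del: split_of_bool)
  qed
  then show "T \<le> x + R" by (simp add: x_def T_def R_def left_diff_distrib sum_subtractf)
qed

text \<open>This is \<open>bonferroni_block_prob\<close> for the independent law on the block, under
  which the probabilities of \<open>n + d \<le> s\<close> and of \<open>s = n\<close> factor over
  the primes.\<close>

lemma bonferroni_block_product:
  fixes n :: "'a \<Rightarrow> nat" and W :: "'a \<Rightarrow> nat pmf"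
  assumes "finite B" "even b"
  defines "g \<equiv> (\<lambda>q v. measure_pmf.prob (W q) {v..})"
  defines "x \<equiv> (\<Prod>q\<in>B. g q (n q) - g q (Suc (n q)))"
  defines "T \<equiv> (\<Sum>d\<in>vecs B 1. sieve_t B b d * (\<Prod>q\<in>B. g q (n q + d q)))"
  defines "R \<equiv> (\<Sum>d\<in>vecs B 1. sieve_r B b d * (\<Prod>q\<in>B. g q (n q + d q)))"
  shows "x \<le> T" "T \<le> x + R"
proof -
  have 1: "measure_pmf.prob (Pi_pmf B 0 W) {s. \<forall>q\<in>B. v q \<le> s q} = (\<Prod>q\<in>B. g q (v q))" for v
  proof -
    have "{s. \<forall>q\<in>B. v q \<le> s q} = Pi B (\<lambda>q. {v q..})" by (auto simp: Pi_def)
    then show ?thesis using measure_Pi_pmf_Pi[OF assms(1)] by (simp add: g_def)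
  qed
  have "{v} = {v..} - {Suc v..}" for v by auto
  then have "measure_pmf.prob (W q) {v} = g q v - g q (Suc v)" for q v
    unfolding g_def by (subst measure_pmf.finite_measure_Diff[symmetric]) auto
  moreover have "measure_pmf.prob (Pi_pmf B 0 W) {s. \<forall>q\<in>B. s q = n q} = (\<Prod>q\<in>B. measure_pmf.prob (W q) {n q})"
  proof -
    have "{s. \<forall>q\<in>B. s q = n q} = Pi B (\<lambda>q. {n q})" by (auto simp: Pi_def)
    then show ?thesis using measure_Pi_pmf_Pi[OF assms(1)] by simp
  qed
  ultimately have 2: "measure_pmf.prob (Pi_pmf B 0 W) {s. \<forall>q\<in>B. s q = n q} = x"
    by (simp add: x_def)
  show "x \<le> T" "T \<le> x + R"
    using bonferroni_block_prob[OF assms(1,2), where \<mu> = "Pi_pmf B 0 W" and n = n]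
    by (simp_all add: 1 2 T_def R_def)
qed

section \<open>The blocks combined into one lower bound sieve\<close>

definition sieve_c :: "'i set \<Rightarrow> ('i \<Rightarrow> 'a set) \<Rightarrow> ('i \<Rightarrow> nat) \<Rightarrow> ('a \<Rightarrow> nat) \<Rightarrow> real" where
  "sieve_c I B b d = (\<Prod>i\<in>I. sieve_t (B i) (b i) d) -
     (\<Sum>k\<in>I. \<Prod>i\<in>I. if i = k then sieve_r (B i) (b i) d else sieve_t (B i) (b i) d)"

lemma sum_restr [simp]: "sum (restr d B) B = sum d B"
  by (intro sum.cong) auto

lemma sieve_restr [simp]:
  "sieve_t B b (restr d B) = sieve_t B b d" "sieve_r B b (restr d B) = sieve_r B b d"
  by (simp_all add: sieve_t_def sieve_r_def)

text \<open>\<open>sieve_c\<close> collects the coefficient of each \<open>d\<close> when the lower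
  bound of \<open>prod_le_sum_replace\<close> is multiplied out. The factor \<open>\<phi>\<close> is
  arbitrary because the identity is used twice: for the indicators of \<open>n + d \<le> s\<close>
  and for the tail probabilities of the model.\<close>

lemma sum_sieve_c:
  fixes \<phi> :: "'i \<Rightarrow> ('a \<Rightarrow> nat) \<Rightarrow> real" and b :: "'i \<Rightarrow> nat"
  assumes "finite I" "disjoint_family_on B I"
  defines "T \<equiv> (\<lambda>i. \<Sum>d\<in>vecs (B i) 1. sieve_t (B i) (b i) d * \<phi> i d)"
  defines "R \<equiv> (\<lambda>i. \<Sum>d\<in>vecs (B i) 1. sieve_r (B i) (b i) d * \<phi> i d)"
  shows "(\<Sum>d\<in>vecs (\<Union>i\<in>I. B i) 1. sieve_c I B b d * (\<Prod>i\<in>I. \<phi> i (restr d (B i))))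
    = (\<Prod>i\<in>I. T i) - (\<Sum>k\<in>I. \<Prod>i\<in>I. if i = k then R i else T i)"
proof -
  note sp = sum_vecs_prod_blocks[OF assms(1,2), where V = 1]
  have 1: "(\<Sum>d\<in>vecs (\<Union>i\<in>I. B i) 1. (\<Prod>i\<in>I. sieve_t (B i) (b i) d) * (\<Prod>i\<in>I. \<phi> i (restr d (B i)))) = (\<Prod>i\<in>I. T i)"
    using sp[where h = "\<lambda>i d. sieve_t (B i) (b i) d * \<phi> i d"] by (simp add: T_def prod.distrib)
  have 2: "(\<Sum>d\<in>vecs (\<Union>i\<in>I. B i) 1. (\<Prod>i\<in>I. if i = k then sieve_r (B i) (b i) d else sieve_t (B i) (b i) d) * (\<Prod>i\<in>I. \<phi> i (restr d (B i))))
     = (\<Prod>i\<in>I. if i = k then R i else T i)" for k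
  proof -
    have "(\<Sum>d\<in>vecs (\<Union>i\<in>I. B i) 1. (\<Prod>i\<in>I. if i = k then sieve_r (B i) (b i) d else sieve_t (B i) (b i) d) * (\<Prod>i\<in>I. \<phi> i (restr d (B i))))
      = (\<Prod>i\<in>I. \<Sum>d\<in>vecs (B i) 1. (if i = k then sieve_r (B i) (b i) d else sieve_t (B i) (b i) d) * \<phi> i d)"
      using sp[where h = "\<lambda>i d. (if i = k then sieve_r (B i) (b i) d else sieve_t (B i) (b i) d) * \<phi> i d"]
      by (simp add: prod.distrib cong: if_cong)
    also have "\<dots> = (\<Prod>i\<in>I. if i = k then R i else T i)"
      by (intro prod.cong) (auto simp: R_def T_def)
    finally show ?thesis .
  qed
  have "(\<Sum>d\<in>vecs (\<Union>i\<in>I. B i) 1. sieve_c I B b d * (\<Prod>i\<in>I. \<phi> i (restr d (B i))))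
     = (\<Prod>i\<in>I. T i) - (\<Sum>d\<in>vecs (\<Union>i\<in>I. B i) 1. \<Sum>k\<in>I. (\<Prod>i\<in>I. if i = k then sieve_r (B i) (b i) d else sieve_t (B i) (b i) d) * (\<Prod>i\<in>I. \<phi> i (restr d (B i))))"
    unfolding sieve_c_def left_diff_distrib sum_subtractf 1 sum_distrib_right ..
  also have "\<dots> = (\<Prod>i\<in>I. T i) - (\<Sum>k\<in>I. \<Prod>i\<in>I. if i = k then R i else T i)"
    by (subst sum.swap) (simp only: 2)
  finally show ?thesis .
qed

text \<open>The main product and each of the \<open>card I\<close> corrections are at most 1 in
  absolute value. The bound \<open>b i + 1\<close> instead of \<open>b i\<close> is due to the
  corrections, in which one block uses the first omitted layer.\<close>

lemma abs_sieve_c_le: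
  assumes "finite I"
  shows "\<bar>sieve_c I B b d\<bar> \<le> (1 + real (card I)) * of_bool (\<forall>i\<in>I. sum d (B i) \<le> b i + 1)"
proof -
  have t: "\<bar>sieve_t (B i) (b i) d\<bar> \<le> of_bool (sum d (B i) \<le> b i + 1)"
      "\<bar>sieve_r (B i) (b i) d\<bar> \<le> of_bool (sum d (B i) \<le> b i + 1)" for i
    by (auto simp: sieve_t_def sieve_r_def)
  have P: "(\<Prod>i\<in>I. of_bool (sum d (B i) \<le> b i + 1)) = (of_bool (\<forall>i\<in>I. sum d (B i) \<le> b i + 1) :: real)"
    using assms by (induction I rule: finite_induct) auto
  have 1: "\<bar>\<Prod>i\<in>I. sieve_t (B i) (b i) d\<bar> \<le> of_bool (\<forall>i\<in>I. sum d (B i) \<le> b i + 1)"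
    unfolding abs_prod P[symmetric] by (intro prod_mono) (use t in auto)
  have 2: "\<bar>\<Prod>i\<in>I. if i = k then sieve_r (B i) (b i) d else sieve_t (B i) (b i) d\<bar> \<le> of_bool (\<forall>i\<in>I. sum d (B i) \<le> b i + 1)" for k
    unfolding abs_prod P[symmetric] by (intro prod_mono) (use t in auto)
  have "\<bar>\<Sum>k\<in>I. \<Prod>i\<in>I. if i = k then sieve_r (B i) (b i) d else sieve_t (B i) (b i) d\<bar>
      \<le> (\<Sum>k\<in>I. of_bool (\<forall>i\<in>I. sum d (B i) \<le> b i + 1))"
    by (intro order.trans[OF sum_abs] sum_mono 2)
  then show ?thesis unfolding sieve_c_def using 1 by (simp add: algebra_simps del: sum_of_bool_eq)
qed

lemma of_bool_ball_UN:
  "finite I \<Longrightarrow> of_bool (\<forall>q\<in>(\<Union>i\<in>I. B i). P q) = (\<Prod>i\<in>I. of_bool (\<forall>q\<in>B i. P q) :: real)"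
  by (induction I rule: finite_induct) (simp_all add: ball_Un of_bool_conj split del: split_of_bool)

lemma one_minus_prod_le:
  fixes s :: "'i \<Rightarrow> real"
  assumes "finite I" "\<And>i. i \<in> I \<Longrightarrow> 0 \<le> s i \<and> s i \<le> 1"
  shows "1 - (\<Prod>i\<in>I. s i) \<le> (\<Sum>i\<in>I. 1 - s i)"
  using assms
proof (induction I rule: finite_induct)
  case (insert k I)
  have P: "0 \<le> (\<Prod>i\<in>I. s i)" "(\<Prod>i\<in>I. s i) \<le> 1"
    using insert.prems by (auto intro!: prod_nonneg prod_le_1)
  have "(1 - s k) * (1 - (\<Prod>i\<in>I. s i)) \<ge> 0"
    using P insert.prems[of k] by (intro mult_nonneg_nonneg) auto
  then show ?case using insert by (simp add: algebra_simps)
qed simp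

text \<open>The same weights bound \<open>pmf \<mu> n\<close> from below and are evaluated exactly
  in the model, so the truncation loss \<open>\<rho>\<close> is measured in the model alone.
  \<open>\<tau>\<close> bounds the model mass of vectors left aside as not good, and the last sum
  compares \<open>\<mu>\<close> with the model modulus by modulus.\<close>

theorem d_TV_block_sieve:
  fixes W :: "'a \<Rightarrow> nat pmf" and \<mu> \<nu> :: "('a \<Rightarrow> nat) pmf" and B :: "'i \<Rightarrow> 'a set"
    and good :: "'i \<Rightarrow> ('a \<Rightarrow> nat) \<Rightarrow> bool" and b :: "'i \<Rightarrow> ('a \<Rightarrow> nat) \<Rightarrow> nat" and \<rho> \<tau> :: "'i \<Rightarrow> real"
  assumes I: "finite I" "disjoint_family_on B I" and fB: "\<And>i. i \<in> I \<Longrightarrow> finite (B i)"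
    and b: "\<And>i n. even (b i n)"
  defines "Q \<equiv> (\<Union>i\<in>I. B i)"
  defines "g \<equiv> (\<lambda>q v. measure_pmf.prob (W q) {v..})"
  defines "w \<equiv> (\<lambda>S n. \<Prod>q\<in>S. g q (n q) - g q (Suc (n q)))"
  assumes \<nu>: "\<And>n. n \<in> vecs Q V \<Longrightarrow> pmf \<nu> n = w Q n"
    and \<mu>: "\<And>s q. s \<in> set_pmf \<mu> \<Longrightarrow> q \<notin> Q \<Longrightarrow> s q = 0"
    and \<rho>: "\<And>i. i \<in> I \<Longrightarrow> (\<Sum>n | n \<in> vecs (B i) V \<and> good i n. \<Sum>d\<in>vecs (B i) 1.
          sieve_r (B i) (b i n) d * (\<Prod>q\<in>B i. g q (n q + d q))) \<le> \<rho> i"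
    and \<tau>: "\<And>i. i \<in> I \<Longrightarrow> 1 - (\<Sum>n | n \<in> vecs (B i) V \<and> good i n. w (B i) n) \<le> \<tau> i"
  shows "d_TV \<nu> \<mu> \<le> (\<Sum>i\<in>I. \<rho> i) * exp (\<Sum>i\<in>I. \<rho> i) + (\<Sum>i\<in>I. \<tau> i) +
     (1 + real (card I)) * (\<Sum>n\<in>vecs Q V. \<Sum>d\<in>vecs Q 1.
        of_bool (\<forall>i\<in>I. good i (restr n (B i)) \<and> sum d (B i) \<le> b i (restr n (B i)) + 1) *
        \<bar>measure_pmf.prob \<mu> {s. \<forall>q\<in>Q. n q + d q \<le> s q} - (\<Prod>q\<in>Q. g q (n q + d q))\<bar>)"
proof -
  define G where "G = {n \<in> vecs Q V. \<forall>i\<in>I. good i (restr n (B i))}"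
  have fQ: "finite Q" using I fB by (simp add: Q_def)
  have fG: "finite G" using fQ by (simp add: G_def)
  define bb where "bb n i = b i (restr n (B i))" for n i
  define T where "T i n = (\<Sum>d\<in>vecs (B i) 1. sieve_t (B i) (b i n) d * (\<Prod>q\<in>B i. g q (n q + d q)))" for i n
  define R where "R i n = (\<Sum>d\<in>vecs (B i) 1. sieve_r (B i) (b i n) d * (\<Prod>q\<in>B i. g q (n q + d q)))" for i n
  define e where "e n d = \<bar>measure_pmf.prob \<mu> {s. \<forall>q\<in>Q. n q + d q \<le> s q} - (\<Prod>q\<in>Q. g q (n q + d q))\<bar>" for n d
  have g_diff: "g q v - g q (Suc v) \<ge> 0" for q v
    unfolding g_def by (simp, intro measure_pmf.finite_measure_mono) auto
  have g_nonneg: "g q v \<ge> 0" for q v unfolding g_def by simp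
  have w_nonneg: "w S n \<ge> 0" for S n unfolding w_def by (intro prod_nonneg) (use g_diff in auto)
  have prod_Q: "(\<Prod>q\<in>Q. F q) = (\<Prod>i\<in>I. \<Prod>q\<in>B i. F q)" for F :: "'a \<Rightarrow> real"
    unfolding Q_def using I fB by (intro prod.UNION_disjoint) (auto simp: disjoint_family_on_def)
  have wTR: "w (B i) n \<le> T i n" "T i n \<le> w (B i) n + R i n" if "i \<in> I" for i n
    using bonferroni_block_product[OF fB[OF that] b, where W = W and n = n]
    unfolding w_def T_def R_def g_def by auto
  have R_nonneg: "R i n \<ge> 0" for i n
    unfolding R_def by (intro sum_nonneg mult_nonneg_nonneg prod_nonneg) (auto simp: sieve_r_def g_nonneg)
  have T_nonneg: "T i n \<ge> 0" if "i \<in> I" for i n using wTR(1)[OF that, of n] w_nonneg[of "B i" n] by linarith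
  have w_restr: "w (B i) (restr n (B i)) = w (B i) n" for n i
    unfolding w_def by (intro prod.cong) auto

  have pmf_mu: "pmf \<mu> n = measure_pmf.prob \<mu> {s. \<forall>q\<in>Q. s q = n q}" if "n \<in> vecs Q V" for n
  proof -
    have "s = n \<longleftrightarrow> (\<forall>q\<in>Q. s q = n q)" if "s \<in> set_pmf \<mu>" for s
      using \<open>n \<in> vecs Q V\<close> \<mu>[OF that] by (auto simp: fun_eq_iff mem_vecs)
    then have "measure_pmf.prob \<mu> {n} = measure_pmf.prob \<mu> {s. \<forall>q\<in>Q. s q = n q}"
      by (intro measure_pmf.finite_measure_eq_AE AE_pmfI) auto
    then show ?thesis by (simp add: measure_pmf_single)
  qed

  have main: "max 0 (pmf \<nu> n - pmf \<mu> n) \<le>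
       (\<Sum>k\<in>I. \<Prod>i\<in>I. if i = k then R i (restr n (B i)) else T i (restr n (B i))) +
       (1 + real (card I)) * (\<Sum>d\<in>vecs Q 1. of_bool (\<forall>i\<in>I. sum d (B i) \<le> bb n i + 1) * e n d)"
    if n: "n \<in> G" for n
  proof -
    let ?n = "\<lambda>i. restr n (B i)"
    have nV: "n \<in> vecs Q V" using n by (simp add: G_def)
    let ?L = "\<Sum>k\<in>I. \<Prod>i\<in>I. if i = k then R i (?n i) else T i (?n i)"
    \<comment> \<open>For each fixed \<open>s\<close> the weighted sum of indicators is at most the
      indicator of \<open>s = n\<close> on \<open>Q\<close>; this is then integrated over
      \<open>\<mu>\<close>.\<close>
    have "(\<Sum>d\<in>vecs Q 1. sieve_c I B (bb n) d * measure_pmf.prob \<mu> {s. \<forall>q\<in>Q. n q + d q \<le> s q})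
       \<le> (\<Sum>d\<in>{()}. 1 * measure_pmf.prob \<mu> {s. \<forall>q\<in>Q. s q = n q})"
    proof (rule prob_lincomb_mono)
      fix s :: "'a \<Rightarrow> nat"
      define x where "x i = (of_bool (\<forall>q\<in>B i. s q = n q) :: real)" for i
      define TT where "TT i = (\<Sum>d\<in>vecs (B i) 1. sieve_t (B i) (bb n i) d * of_bool (\<forall>q\<in>B i. n q + d q \<le> s q))" for i
      define RR where "RR i = (\<Sum>d\<in>vecs (B i) 1. sieve_r (B i) (bb n i) d * of_bool (\<forall>q\<in>B i. n q + d q \<le> s q))" for i
      have "(\<Sum>d\<in>vecs Q 1. sieve_c I B (bb n) d * of_bool (\<forall>q\<in>Q. n q + d q \<le> s q))
        = (\<Sum>d\<in>vecs Q 1. sieve_c I B (bb n) d * (\<Prod>i\<in>I. of_bool (\<forall>q\<in>B i. n q + restr d (B i) q \<le> s q)))"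
        unfolding Q_def of_bool_ball_UN[OF I(1)] by simp
      also have "\<dots> = (\<Prod>i\<in>I. TT i) - (\<Sum>k\<in>I. \<Prod>i\<in>I. if i = k then RR i else TT i)"
        unfolding Q_def TT_def RR_def
        by (rule sum_sieve_c[OF I, where \<phi> = "\<lambda>i d. of_bool (\<forall>q\<in>B i. n q + d q \<le> s q)"])
      also have "\<dots> \<le> (\<Prod>i\<in>I. x i)"
        by (rule prod_le_sum_replace[OF I(1)])
           (use bonferroni_block[OF fB b] in \<open>auto simp: x_def TT_def RR_def bb_def\<close>)
      also have "\<dots> = of_bool (\<forall>q\<in>Q. s q = n q)"
        unfolding x_def Q_def of_bool_ball_UN[OF I(1)] ..
      finally show "(\<Sum>d\<in>vecs Q 1. sieve_c I B (bb n) d * of_bool (\<forall>q\<in>Q. n q + d q \<le> s q))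
        \<le> (\<Sum>d\<in>{()}. 1 * of_bool (\<forall>q\<in>Q. s q = n q))" by simp
    qed
    then have 1: "(\<Sum>d\<in>vecs Q 1. sieve_c I B (bb n) d * measure_pmf.prob \<mu> {s. \<forall>q\<in>Q. n q + d q \<le> s q}) \<le> pmf \<mu> n"
      using pmf_mu[OF nV] by simp
    \<comment> \<open>With model probabilities the weighted sum is exactly the product of the
      \<open>T i\<close> minus the corrections \<open>?L\<close>. As that product dominates
      \<open>pmf \<nu> n\<close>, the loss is \<open>?L\<close> plus the weighted
      discrepancy.\<close>
    have "(\<Sum>d\<in>vecs Q 1. sieve_c I B (bb n) d * (\<Prod>q\<in>Q. g q (n q + d q)))
       = (\<Sum>d\<in>vecs Q 1. sieve_c I B (bb n) d * (\<Prod>i\<in>I. \<Prod>q\<in>B i. g q (?n i q + restr d (B i) q)))"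
      unfolding prod_Q by simp
    also have "\<dots> = (\<Prod>i\<in>I. T i (?n i)) - ?L"
      unfolding Q_def T_def R_def bb_def
      by (rule sum_sieve_c[OF I, where \<phi> = "\<lambda>i d. \<Prod>q\<in>B i. g q (?n i q + d q)"])
    finally have 2: "(\<Sum>d\<in>vecs Q 1. sieve_c I B (bb n) d * (\<Prod>q\<in>Q. g q (n q + d q))) = (\<Prod>i\<in>I. T i (?n i)) - ?L" .
    have "pmf \<nu> n = (\<Prod>i\<in>I. w (B i) (?n i))"
      unfolding \<nu>[OF nV] w_restr unfolding w_def prod_Q ..
    also have "\<dots> \<le> (\<Prod>i\<in>I. T i (?n i))"
      by (intro prod_mono) (use wTR w_nonneg in auto)
    finally have 3: "pmf \<nu> n \<le> (\<Prod>i\<in>I. T i (?n i))" .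
    have "(\<Sum>d\<in>vecs Q 1. sieve_c I B (bb n) d * (\<Prod>q\<in>Q. g q (n q + d q))) -
          (\<Sum>d\<in>vecs Q 1. sieve_c I B (bb n) d * measure_pmf.prob \<mu> {s. \<forall>q\<in>Q. n q + d q \<le> s q})
       = (\<Sum>d\<in>vecs Q 1. sieve_c I B (bb n) d * ((\<Prod>q\<in>Q. g q (n q + d q)) - measure_pmf.prob \<mu> {s. \<forall>q\<in>Q. n q + d q \<le> s q}))"
      by (simp add: sum_subtractf right_diff_distrib)
    also have "\<dots> \<le> (\<Sum>d\<in>vecs Q 1. (1 + real (card I)) * (of_bool (\<forall>i\<in>I. sum d (B i) \<le> bb n i + 1) * e n d))"
    proof (intro sum_mono)
      fix d
      have "sieve_c I B (bb n) d * ((\<Prod>q\<in>Q. g q (n q + d q)) - measure_pmf.prob \<mu> {s. \<forall>q\<in>Q. n q + d q \<le> s q})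
         \<le> \<bar>sieve_c I B (bb n) d\<bar> * e n d"
        unfolding e_def by (subst abs_minus_commute) (simp add: abs_mult[symmetric])
      also have "\<dots> \<le> (1 + real (card I)) * of_bool (\<forall>i\<in>I. sum d (B i) \<le> bb n i + 1) * e n d"
        by (intro mult_right_mono abs_sieve_c_le I) (simp add: e_def)
      finally show "sieve_c I B (bb n) d * ((\<Prod>q\<in>Q. g q (n q + d q)) - measure_pmf.prob \<mu> {s. \<forall>q\<in>Q. n q + d q \<le> s q})
         \<le> (1 + real (card I)) * (of_bool (\<forall>i\<in>I. sum d (B i) \<le> bb n i + 1) * e n d)"
        by (simp only: mult.assoc)
    qed
    also have "\<dots> = (1 + real (card I)) * (\<Sum>d\<in>vecs Q 1. of_bool (\<forall>i\<in>I. sum d (B i) \<le> bb n i + 1) * e n d)"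
      by (rule sum_distrib_left[symmetric])
    finally have 4: "pmf \<nu> n - pmf \<mu> n \<le> ?L + (1 + real (card I)) * (\<Sum>d\<in>vecs Q 1. of_bool (\<forall>i\<in>I. sum d (B i) \<le> bb n i + 1) * e n d)"
      using 1 2 3 by linarith
    moreover have "0 \<le> ?L" by (intro sum_nonneg prod_nonneg) (use R_nonneg T_nonneg in auto)
    moreover have "0 \<le> (1 + real (card I)) * (\<Sum>d\<in>vecs Q 1. of_bool (\<forall>i\<in>I. sum d (B i) \<le> bb n i + 1) * e n d)"
      by (intro mult_nonneg_nonneg sum_nonneg) (auto simp: e_def)
    ultimately show ?thesis by simp
  qed

  have sumG: "(\<Sum>n\<in>G. \<Prod>i\<in>I. h i (restr n (B i))) = (\<Prod>i\<in>I. \<Sum>n | n \<in> vecs (B i) V \<and> good i n. h i n)" for h :: "'i \<Rightarrow> ('a \<Rightarrow> nat) \<Rightarrow> real"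
  proof -
    have ob: "(\<Prod>i\<in>I. of_bool (good i (restr n (B i)))) = (of_bool (\<forall>i\<in>I. good i (restr n (B i))) :: real)" for n
      using I(1) by (induction I rule: finite_induct) auto
    have "(\<Sum>n\<in>G. \<Prod>i\<in>I. h i (restr n (B i))) = (\<Sum>n\<in>vecs Q V. \<Prod>i\<in>I. of_bool (good i (restr n (B i))) * h i (restr n (B i)))"
      unfolding prod.distrib ob G_def using fQ by (intro sum.mono_neutral_cong_left) auto
    also have "\<dots> = (\<Prod>i\<in>I. \<Sum>n\<in>vecs (B i) V. of_bool (good i n) * h i n)"
      unfolding Q_def by (rule sum_vecs_prod_blocks[OF I])
    also have "\<dots> = (\<Prod>i\<in>I. \<Sum>n | n \<in> vecs (B i) V \<and> good i n. h i n)"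
      using fB by (intro prod.cong refl sum.mono_neutral_cong_right) auto
    finally show ?thesis .
  qed
  have w_sum_le: "(\<Sum>n | n \<in> vecs (B i) V \<and> good i n. w (B i) n) \<le> 1" if "i \<in> I" for i
  proof -
    have "(\<Sum>n | n \<in> vecs (B i) V \<and> good i n. w (B i) n) \<le> (\<Sum>n\<in>vecs (B i) V. w (B i) n)"
      using fB[OF that] w_nonneg by (intro sum_mono2) auto
    also have "\<dots> = (\<Prod>q\<in>B i. \<Sum>v\<le>V. g q v - g q (Suc v))"
      unfolding w_def by (rule sum_vecs_prod[OF fB[OF that]])
    also have "\<dots> \<le> 1"
    proof (intro prod_le_1)
      fix q
      have "(\<Sum>v\<le>V. g q v - g q (Suc v)) = g q 0 - g q (Suc V)" by (rule sum_telescope)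
      also have "\<dots> \<le> 1" using g_nonneg[of q "Suc V"] unfolding g_def by simp
      finally show "0 \<le> (\<Sum>v\<le>V. g q v - g q (Suc v)) \<and> (\<Sum>v\<le>V. g q v - g q (Suc v)) \<le> 1"
        using g_diff by (auto intro: sum_nonneg)
    qed
    finally show ?thesis .
  qed
  have \<rho>0: "0 \<le> \<rho> i" if "i \<in> I" for i
    using \<rho>[OF that] sum_nonneg[of "{n \<in> vecs (B i) V. good i n}" "R i"] R_nonneg unfolding R_def by fastforce
  have "(\<Sum>n\<in>G. \<Sum>k\<in>I. \<Prod>i\<in>I. if i = k then R i (restr n (B i)) else T i (restr n (B i)))
    = (\<Sum>k\<in>I. \<Prod>i\<in>I. \<Sum>n | n \<in> vecs (B i) V \<and> good i n. if i = k then R i n else T i n)"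
    by (subst sum.swap, intro sum.cong refl, rule sumG)
  also have "\<dots> \<le> (\<Sum>k\<in>I. \<rho> k * exp (\<Sum>i\<in>I. \<rho> i))"
  proof (intro sum_mono)
    fix k assume k: "k \<in> I"
    \<comment> \<open>In a block other than \<open>k\<close> the sum of \<open>T i\<close> is at
      most the model mass, itself at most 1, plus \<open>\<rho> i\<close>, hence at most
      \<open>exp (\<rho> i)\<close>.\<close>
    have "(\<Prod>i\<in>I. \<Sum>n | n \<in> vecs (B i) V \<and> good i n. if i = k then R i n else T i n) \<le> (\<Prod>i\<in>I. if i = k then \<rho> i else exp (\<rho> i))"
    proof (intro prod_mono conjI)
      fix i assume i: "i \<in> I"
      show "0 \<le> (\<Sum>n | n \<in> vecs (B i) V \<and> good i n. if i = k then R i n else T i n)"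
        using R_nonneg T_nonneg[OF i] by (intro sum_nonneg) auto
      have "(\<Sum>n | n \<in> vecs (B i) V \<and> good i n. T i n) \<le> (\<Sum>n | n \<in> vecs (B i) V \<and> good i n. w (B i) n + R i n)"
        by (intro sum_mono wTR i)
      also have "\<dots> \<le> 1 + \<rho> i" using w_sum_le[OF i] \<rho>[OF i] unfolding sum.distrib R_def by linarith
      also have "\<dots> \<le> exp (\<rho> i)" by simp
      finally show "(\<Sum>n | n \<in> vecs (B i) V \<and> good i n. if i = k then R i n else T i n) \<le> (if i = k then \<rho> i else exp (\<rho> i))"
        using \<rho>[OF i] by (auto simp: R_def)
    qed
    also have "\<dots> = \<rho> k * (\<Prod>i\<in>I - {k}. exp (\<rho> i))"
      using I(1) k by (subst prod.remove[of I k]) (auto intro!: prod.cong)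
    also have "\<dots> = \<rho> k * exp (\<Sum>i\<in>I - {k}. \<rho> i)" using I(1) by (simp add: exp_sum)
    also have "\<dots> \<le> \<rho> k * exp (\<Sum>i\<in>I. \<rho> i)"
      using I(1) k \<rho>0 by (intro mult_left_mono) (auto intro!: sum_mono2)
    finally show "(\<Prod>i\<in>I. \<Sum>n | n \<in> vecs (B i) V \<and> good i n. if i = k then R i n else T i n) \<le> \<rho> k * exp (\<Sum>i\<in>I. \<rho> i)" .
  qed
  finally have A: "(\<Sum>n\<in>G. \<Sum>k\<in>I. \<Prod>i\<in>I. if i = k then R i (restr n (B i)) else T i (restr n (B i)))
     \<le> (\<Sum>i\<in>I. \<rho> i) * exp (\<Sum>i\<in>I. \<rho> i)" by (simp add: sum_distrib_right)
  have "(\<Sum>n\<in>G. pmf \<nu> n) = (\<Sum>n\<in>G. \<Prod>i\<in>I. w (B i) (restr n (B i)))"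
    by (intro sum.cong refl) (simp only: w_restr, simp add: \<nu> G_def w_def prod_Q)
  also have "\<dots> = (\<Prod>i\<in>I. \<Sum>n | n \<in> vecs (B i) V \<and> good i n. w (B i) n)" by (rule sumG)
  finally have "1 - (\<Sum>n\<in>G. pmf \<nu> n) \<le> (\<Sum>i\<in>I. 1 - (\<Sum>n | n \<in> vecs (B i) V \<and> good i n. w (B i) n))"
    using one_minus_prod_le[OF I(1), of "\<lambda>i. \<Sum>n | n \<in> vecs (B i) V \<and> good i n. w (B i) n"]
      w_sum_le w_nonneg by (simp add: sum_nonneg)
  also have "\<dots> \<le> (\<Sum>i\<in>I. \<tau> i)" by (intro sum_mono \<tau>)
  finally have Bd: "1 - (\<Sum>n\<in>G. pmf \<nu> n) \<le> (\<Sum>i\<in>I. \<tau> i)" .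
  have "(\<Sum>n\<in>G. (1 + real (card I)) * (\<Sum>d\<in>vecs Q 1. of_bool (\<forall>i\<in>I. sum d (B i) \<le> bb n i + 1) * e n d))
     = (1 + real (card I)) * (\<Sum>n\<in>G. (\<Sum>d\<in>vecs Q 1. of_bool (\<forall>i\<in>I. sum d (B i) \<le> bb n i + 1) * e n d))"
    by (rule sum_distrib_left[symmetric])
  also have "(\<Sum>n\<in>G. (\<Sum>d\<in>vecs Q 1. of_bool (\<forall>i\<in>I. sum d (B i) \<le> bb n i + 1) * e n d))
     = (\<Sum>n\<in>vecs Q V. (\<Sum>d\<in>vecs Q 1. of_bool (\<forall>i\<in>I. good i (restr n (B i)) \<and> sum d (B i) \<le> bb n i + 1) * e n d))"
    using fQ by (intro sum.mono_neutral_cong_left) (auto simp: G_def intro!: sum.neutral sum.cong)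
  finally have C: "(\<Sum>n\<in>G. (1 + real (card I)) * (\<Sum>d\<in>vecs Q 1. of_bool (\<forall>i\<in>I. sum d (B i) \<le> bb n i + 1) * e n d))
     = (1 + real (card I)) * (\<Sum>n\<in>vecs Q V. (\<Sum>d\<in>vecs Q 1. of_bool (\<forall>i\<in>I. good i (restr n (B i)) \<and> sum d (B i) \<le> bb n i + 1) * e n d))" .
  have "d_TV \<nu> \<mu> \<le> (\<Sum>n\<in>G. max 0 (pmf \<nu> n - pmf \<mu> n)) + (1 - (\<Sum>n\<in>G. pmf \<nu> n))"
    by (rule d_TV_le_sum[OF fG])
  also have "\<dots> \<le> ((\<Sum>n\<in>G. \<Sum>k\<in>I. \<Prod>i\<in>I. if i = k then R i (restr n (B i)) else T i (restr n (B i))) +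
       (\<Sum>n\<in>G. (1 + real (card I)) * (\<Sum>d\<in>vecs Q 1. of_bool (\<forall>i\<in>I. sum d (B i) \<le> bb n i + 1) * e n d))) + (\<Sum>i\<in>I. \<tau> i)"
    unfolding sum.distrib[symmetric] by (intro add_mono Bd sum_mono main)
  also have "\<dots> \<le> (\<Sum>i\<in>I. \<rho> i) * exp (\<Sum>i\<in>I. \<rho> i) + (\<Sum>i\<in>I. \<tau> i) +
     (1 + real (card I)) * (\<Sum>n\<in>vecs Q V. (\<Sum>d\<in>vecs Q 1. of_bool (\<forall>i\<in>I. good i (restr n (B i)) \<and> sum d (B i) \<le> bb n i + 1) * e n d))"
    unfolding C using A by simp
  finally show ?thesis unfolding e_def bb_def .
qed

section \<open>Chebyshev bounds and the exponent in Hypothesis Z\<close>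

lemma prod_coprime_dvd_iff:
  fixes f :: "'i \<Rightarrow> 'b::semiring_gcd"
  assumes "finite Q" "\<And>i j. i \<in> Q \<Longrightarrow> j \<in> Q \<Longrightarrow> i \<noteq> j \<Longrightarrow> coprime (f i) (f j)"
  shows "prod f Q dvd k \<longleftrightarrow> (\<forall>i\<in>Q. f i dvd k)"
  using assms
proof (induction Q rule: finite_induct)
  case (insert i Q)
  have "coprime (f i) (prod f Q)"
    using insert by (intro prod_coprime_right) auto
  then have "f i * prod f Q dvd k \<longleftrightarrow> f i dvd k \<and> prod f Q dvd k"
    by (metis divides_mult dvd_mult_left dvd_mult_right)
  then show ?case using insert by auto
qed auto

lemma finite_primes_le: "finite {p::nat. prime p \<and> real p \<le> x}"
  by (rule finite_subset[of _ "{..nat \<lfloor>x\<rfloor>}"]) (auto simp: le_nat_floor)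

section \<open>Chebyshev's lower bound through common multiples\<close>

lemma common_multiple_le:
  assumes "n \<ge> (1::nat)"
  obtains \<Lambda> :: nat where "\<Lambda> > 0" "\<And>m. 1 \<le> m \<Longrightarrow> m \<le> n \<Longrightarrow> m dvd \<Lambda>" "\<Lambda> \<le> n ^ card {p. prime p \<and> p \<le> n}"
proof -
  let ?P = "{p::nat. prime p \<and> p \<le> n}"
  have fP: "finite ?P" by (rule finite_subset[of _ "{..n}"]) auto
  have "\<exists>k. p ^ k \<le> n \<and> (\<forall>j. p ^ j \<le> n \<longrightarrow> j \<le> k)" if "prime p" for p
  proof -
    have "j \<le> n" if "p ^ j \<le> n" for j
      using that prime_gt_1_nat[OF \<open>prime p\<close>] power_gt_expt[of p j] by linarith
    then have "\<exists>k. p ^ k \<le> n \<and> (\<forall>j. p ^ j \<le> n \<longrightarrow> j \<le> k)"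
      using assms by (intro ex_has_greatest_nat[where k = 0 and b = "Suc n"]) (auto simp: less_Suc_eq_le)
    then show ?thesis .
  qed
  then obtain k where k: "\<And>p. prime p \<Longrightarrow> p ^ k p \<le> n" "\<And>p j. prime p \<Longrightarrow> p ^ j \<le> n \<Longrightarrow> j \<le> k p"
    by metis
  \<comment> \<open>This is the least common multiple of 1, ..., n, assembled from the largest prime
    powers not exceeding \<open>n\<close>. Each factor is at most \<open>n\<close>, which gives the
    size bound.\<close>
  define \<Lambda> where "\<Lambda> = (\<Prod>p\<in>?P. p ^ k p)"
  have pos: "\<Lambda> > 0" unfolding \<Lambda>_def by (intro prod_pos) (auto simp: prime_gt_0_nat)
  have "m dvd \<Lambda>" if m: "1 \<le> m" "m \<le> n" for m
  proof (rule multiplicity_le_imp_dvd)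
    show "m \<noteq> 0" using m by simp
    fix p :: nat assume p: "prime p"
    have "p ^ multiplicity p m \<le> m" using m by (intro dvd_imp_le multiplicity_dvd) auto
    then have le: "multiplicity p m \<le> k p" using m k(2)[OF p] by auto
    show "multiplicity p m \<le> multiplicity p \<Lambda>"
    proof (cases "p \<le> n")
      case True
      then have "p ^ k p dvd \<Lambda>" unfolding \<Lambda>_def using fP p by (intro dvd_prodI) auto
      then have "k p \<le> multiplicity p \<Lambda>" using pos p by (intro multiplicity_geI) (auto simp: prime_gt_1_nat)
      then show ?thesis using le by simp
    next
      case False
      then have "\<not> p dvd m" using m by (auto dest: dvd_imp_le)
      then show ?thesis by (simp add: not_dvd_imp_multiplicity_0)
    qed
  qed
  moreover have "\<Lambda> \<le> n ^ card ?P"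
  proof -
    have "\<Lambda> \<le> (\<Prod>p\<in>?P. n)" unfolding \<Lambda>_def using k(1) by (intro prod_mono) auto
    then show ?thesis by simp
  qed
  ultimately show ?thesis using that pos by blast
qed

text \<open>The recurrence of the Leibniz harmonic triangle, whose entries are the numbers
  \<open>1 / (k * (n choose k))\<close>.\<close>

lemma leibniz_triangle:
  assumes "1 \<le> k" "k < n"
  shows "1 / (real k * real ((n-1) choose k)) = 1 / (real k * real (n choose k)) + 1 / (real (Suc k) * real (n choose Suc k))"
proof -
  obtain m where n: "n = Suc m" using assms by (cases n) auto
  obtain l where l: "k = Suc l" using assms by (cases k) auto
  have e1: "real (Suc k) * real (n choose Suc k) = real n * real (m choose k)"
    unfolding n of_nat_mult[symmetric] using Suc_times_binomial_eq[of m k] by (simp only: of_nat_eq_iff mult.commute)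
  have e2: "real k * real (n choose k) = real n * real (m choose l)"
    unfolding n l of_nat_mult[symmetric] using Suc_times_binomial_eq[of m l] by (simp only: of_nat_eq_iff mult.commute)
  have e3: "real (n choose k) = real (m choose l) + real (m choose k)"
    unfolding n l by simp
  have pos: "real (m choose k) > 0" "real (m choose l) > 0" "real n > 0" "real k > 0"
    using assms n l by auto
  have "real k * (real (m choose l) + real (m choose k)) = real n * real (m choose l)"
    using e2 e3 by simp
  then have "1 / (real k * real (m choose k)) = (real (m choose l) + real (m choose k)) / (real n * real (m choose l) * real (m choose k))"
    using pos by (simp add: field_simps)
  also have "\<dots> = 1 / (real n * real (m choose l)) + 1 / (real n * real (m choose k))"
    using pos by (simp add: field_simps)
  finally show ?thesis unfolding e1 e2 using n by simp
qed

text \<open>Multiplied by \<open>\<Lambda>\<close>, the entries of the Leibniz triangle are integers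
  for k = 1, and the recurrence writes each further one as a difference of two integers.\<close>

lemma mult_choose_dvd:
  fixes \<Lambda> :: nat
  assumes \<Lambda>: "\<Lambda> > 0" "\<And>m. 1 \<le> m \<Longrightarrow> m \<le> N \<Longrightarrow> m dvd \<Lambda>"
  shows "1 \<le> k \<Longrightarrow> k \<le> n \<Longrightarrow> n \<le> N \<Longrightarrow> k * (n choose k) dvd \<Lambda>"
proof (induction k arbitrary: n rule: nat_induct_at_least[of 1])
  case base
  then show ?case using \<Lambda> by simp
next
  case (Suc k)
  have kn: "1 \<le> k" "k < n" using Suc by auto
  have "k * ((n-1) choose k) dvd \<Lambda>" "k * (n choose k) dvd \<Lambda>" using Suc by auto
  then obtain x y where x: "\<Lambda> = k * ((n-1) choose k) * x" and y: "\<Lambda> = k * (n choose k) * y"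
    by (elim dvdE)
  let ?M = "Suc k * (n choose Suc k)"
  have pos: "real k * real ((n-1) choose k) > 0" "real k * real (n choose k) > 0" "real (Suc k) * real (n choose Suc k) > 0"
    using kn by (intro mult_pos_pos; simp)+
  have cancel: "x = a * x * (1 / a)" if "a > 0" for a x :: real using that by simp
  have "real \<Lambda> = real k * real ((n-1) choose k) * real x" "real \<Lambda> = real k * real (n choose k) * real y"
    by (subst x, simp, subst y, simp)
  then have "real x = real \<Lambda> * (1 / (real k * real ((n-1) choose k)))"
    "real y = real \<Lambda> * (1 / (real k * real (n choose k)))"
    using cancel[OF pos(1)] cancel[OF pos(2)] by metis+
  then have "real x - real y = real \<Lambda> * (1 / (real (Suc k) * real (n choose Suc k)))"
    unfolding leibniz_triangle[OF kn] distrib_left by linarith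
  then have "real \<Lambda> = real (Suc k) * real (n choose Suc k) * (real x - real y)"
    using cancel[OF pos(3), of "real \<Lambda>"] by (simp only: ac_simps)
  also have "\<dots> = real_of_int (int ?M * (int x - int y))" by (simp add: algebra_simps)
  finally have "int \<Lambda> = int ?M * (int x - int y)" by (metis of_int_eq_iff of_int_of_nat_eq)
  then have "int ?M dvd int \<Lambda>" by (rule dvdI)
  then show ?case by (simp only: int_dvd_int_iff)
qed

text \<open>The central binomial coefficient divides the common multiple of 1, ..., 2n and so is at
  most (2n)^\<pi>(2n), but it is at least 4^n / (2n). The summand 1 comes from this last factor
  2n.\<close>

lemma prime_count_lower_aux:
  assumes "n \<ge> (1::nat)"
  shows "real n * ln 4 \<le> ln (2 * real n) * (1 + real (prime_count (2 * real n)))"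
proof -
  obtain \<Lambda> :: nat where \<Lambda>: "\<Lambda> > 0" "\<And>m. 1 \<le> m \<Longrightarrow> m \<le> 2 * n \<Longrightarrow> m dvd \<Lambda>"
    "\<Lambda> \<le> (2 * n) ^ card {p. prime p \<and> p \<le> 2 * n}"
    using common_multiple_le[of "2 * n"] assms by auto
  have "n * (2 * n choose n) dvd \<Lambda>"
    using assms by (intro mult_choose_dvd[where N = "2 * n"] \<Lambda>) auto
  then have "2 * n choose n \<le> \<Lambda>" using \<Lambda>(1) by (meson dvd_imp_le dvd_mult_right)
  have "{p::nat. prime p \<and> p \<le> 2 * n} = {p. prime p \<and> real p \<le> 2 * real n}"
    by auto
  then have card: "card {p::nat. prime p \<and> p \<le> 2 * n} = prime_count (2 * real n)"
    by (simp add: prime_count_def)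
  have "4 ^ n \<le> 2 * real n * real (2 * n choose n)"
    using central_binomial_lower_bound[of n] assms by (simp add: field_simps)
  also have "real (2 * n choose n) \<le> real ((2 * n) ^ prime_count (2 * real n))"
    using \<open>2 * n choose n \<le> \<Lambda>\<close> \<Lambda>(3) unfolding card of_nat_le_iff by linarith
  finally have "4 ^ n \<le> (2 * real n) ^ Suc (prime_count (2 * real n))"
    using assms by simp
  then have "ln (4 ^ n) \<le> ln ((2 * real n) ^ Suc (prime_count (2 * real n)))"
    using assms by (subst ln_le_cancel_iff) auto
  also have "\<dots> = real (Suc (prime_count (2 * real n))) * ln (2 * real n)"
    by (rule ln_realpow)
  finally show ?thesis using assms by (simp add: ln_realpow algebra_simps)
qed

lemma prime_count_mono: "x \<le> y \<Longrightarrow> prime_count x \<le> prime_count y"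
  unfolding prime_count_def by (intro card_mono finite_primes_le) auto

lemma prime_count_lower: "eventually (\<lambda>x. prime_count x \<ge> x / (2 * ln x)) at_top"
proof -
  \<comment> \<open>With n about x/2 and ln 4 \<ge> 4/3 the main term is 2x/3; its excess over x/2
    absorbs the rounding of \<open>n\<close> and the extra logarithm.\<close>
  have "eventually (\<lambda>x::real. x / 2 \<le> (x / 2 - 1) * (4 / 3) - ln x) at_top" by real_asymp
  moreover have "eventually (\<lambda>x::real. x \<ge> 2) at_top" by (rule eventually_ge_at_top)
  ultimately show ?thesis
  proof eventually_elim
    case (elim x)
    define n where "n = nat \<lfloor>x / 2\<rfloor>"
    have n: "n \<ge> 1" "real n \<le> x / 2" "real n \<ge> x / 2 - 1"
      using elim(2) unfolding n_def by (linarith | simp add: le_nat_iff le_floor_iff)+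
    have "(2::real) * (2 / 3) \<le> 2 * ln 2" using ln2_ge_two_thirds by simp
    also have "2 * ln 2 = ln (4::real)" using ln_realpow[of 2 2] by simp
    finally have l4: "4 / 3 \<le> ln (4::real)" by simp
    have "(x / 2 - 1) * (4 / 3) \<le> real n * ln 4"
      using n(3) elim(2) l4 by (intro mult_mono) auto
    also have "\<dots> \<le> ln (2 * real n) * (1 + real (prime_count (2 * real n)))"
      by (rule prime_count_lower_aux[OF n(1)])
    also have "\<dots> \<le> ln x * (1 + real (prime_count x))"
      using n elim(2) prime_count_mono[of "2 * real n" x] by (intro mult_mono) auto
    finally have "x / 2 \<le> ln x * real (prime_count x)" using elim(1) by (simp add: algebra_simps)
    moreover have "ln x > 0" using elim(2) by simp
    ultimately show ?case by (simp add: field_simps)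
  qed
qed

section \<open>Upper bounds of Mertens type from dyadic intervals\<close>

lemma dyadic_prime_count_le:
  fixes k :: nat
  shows "k * card {p::nat. prime p \<and> 2 ^ k < p \<and> p \<le> 2 ^ (k + 1)} \<le> 2 * 2 ^ k"
proof -
  let ?P = "{p::nat. prime p \<and> 2 ^ k < p \<and> p \<le> 2 ^ (k + 1)}"
  let ?n = "2 ^ k :: nat"
  have fP: "finite ?P" by (rule finite_subset[of _ "{..2 ^ (k+1)}"]) auto
  \<comment> \<open>With N = 2^k, a prime in (N, 2N] divides (2N)! but not N!, hence divides the
    binomial coefficient, which is at most 4^N. As each such prime exceeds 2^k, there cannot be
    many.\<close>
  have "prod (\<lambda>p. p) ?P dvd (2 * ?n choose ?n)"
  proof (subst prod_coprime_dvd_iff[OF fP])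
    show "\<forall>p\<in>?P. p dvd (2 * ?n choose ?n)"
    proof
      fix p assume p: "p \<in> ?P"
      have "fact ?n * fact (2 * ?n - ?n) * (2 * ?n choose ?n) = (fact (2 * ?n) :: nat)"
        by (rule binomial_fact_lemma) simp
      moreover have "p dvd fact (2 * ?n)" using p by (simp add: prime_dvd_fact_iff)
      ultimately have "p dvd fact ?n * fact ?n * (2 * ?n choose ?n)" by simp
      moreover have "\<not> p dvd fact ?n" using p by (simp add: prime_dvd_fact_iff)
      ultimately show "p dvd (2 * ?n choose ?n)" using p by (auto simp: prime_dvd_mult_iff)
    qed
  qed (auto intro: primes_coprime)
  then have "prod (\<lambda>p. p) ?P \<le> (2 * ?n choose ?n)" by (rule dvd_imp_le) simp
  also have "\<dots> \<le> 2 ^ (2 * ?n)" by (rule binomial_le_pow2)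
  finally have "prod (\<lambda>p. p) ?P \<le> 2 ^ (2 * ?n)" .
  moreover have "(\<Prod>p\<in>?P. ?n) \<le> prod (\<lambda>p. p) ?P" by (intro prod_mono) auto
  ultimately have "(2::nat) ^ (k * card ?P) \<le> 2 ^ (2 * ?n)" by (simp add: power_mult)
  then show ?thesis by (subst (asm) power_increasing_iff) auto
qed

text \<open>The prime 2 lies in no interval with k \<ge> 1 and accounts for the 1. By
  \<open>dyadic_prime_count_le\<close> the interval of index \<open>k\<close> holds at most 2 * 2^k
  / k primes, each contributing at most 1 / 2^k.\<close>

lemma sum_primes_dyadic_le:
  assumes "finite S" "\<And>q. q \<in> S \<Longrightarrow> prime (q::nat)" "finite K" "0 \<notin> K"
    and cover: "\<And>q. q \<in> S \<Longrightarrow> q \<noteq> 2 \<Longrightarrow> \<exists>k\<in>K. 2 ^ k < q \<and> q \<le> 2 ^ (k + 1)"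
  shows "(\<Sum>q\<in>S. 1 / (real q - 1)) \<le> 1 + (\<Sum>k\<in>K. 2 / real k)"
proof -
  let ?D = "\<lambda>k q. 2 ^ k < q \<and> q \<le> 2 ^ (k + 1)"
  have nonneg: "0 \<le> 1 / (real q - 1)" if "q \<in> S" for q
    using assms(2)[OF that] prime_ge_2_nat[of q] by simp
  have "(\<Sum>q\<in>S. 1 / (real q - 1)) \<le> (\<Sum>q\<in>S. (if q = 2 then 1 else 0) + (\<Sum>k\<in>K. if ?D k q then 1 / (real q - 1) else 0))"
  proof (intro sum_mono)
    fix q assume q: "q \<in> S"
    show "1 / (real q - 1) \<le> (if q = 2 then 1 else 0) + (\<Sum>k\<in>K. if ?D k q then 1 / (real q - 1) else 0)"
    proof (cases "q = 2")
      case True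
      then show ?thesis by (simp add: sum_nonneg)
    next
      case False
      then obtain k where k: "k \<in> K" "?D k q" using cover[OF q] by auto
      have "(if ?D k q then 1 / (real q - 1) else 0) \<le> (\<Sum>k\<in>K. if ?D k q then 1 / (real q - 1) else 0)"
        using k(1) assms(3) nonneg[OF q] by (intro member_le_sum) auto
      then show ?thesis using k False by simp
    qed
  qed
  also have "\<dots> = (\<Sum>q\<in>S. if q = 2 then 1 else 0) + (\<Sum>k\<in>K. \<Sum>q\<in>S. if ?D k q then 1 / (real q - 1) else 0)"
    unfolding sum.distrib by (subst (2) sum.swap) simp
  also have "(\<Sum>q\<in>S. if q = 2 then 1 else 0) \<le> (1::real)" using assms(1) by (simp add: sum.delta)
  also have "(\<Sum>k\<in>K. \<Sum>q\<in>S. if ?D k q then 1 / (real q - 1) else 0) \<le> (\<Sum>k\<in>K. 2 / real k)"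
  proof (intro sum_mono)
    fix k assume k: "k \<in> K"
    let ?P = "{p::nat. prime p \<and> 2 ^ k < p \<and> p \<le> 2 ^ (k + 1)}"
    have fP: "finite ?P" by (rule finite_subset[of _ "{..2 ^ (k+1)}"]) auto
    have k0: "k > 0" using k assms(4) by (cases k) auto
    have "(\<Sum>q\<in>S. if ?D k q then 1 / (real q - 1) else 0) = (\<Sum>q\<in>{q\<in>S. ?D k q}. 1 / (real q - 1))"
      using assms(1) by (simp add: sum.inter_filter)
    also have "\<dots> \<le> (\<Sum>q\<in>{q\<in>S. ?D k q}. 1 / 2 ^ k)"
    proof (intro sum_mono divide_left_mono)
      fix q assume "q \<in> {q\<in>S. ?D k q}"
      then have "2 ^ k + 1 \<le> q" by auto
      then have le: "2 ^ k + 1 \<le> real q" using of_nat_mono[of "2 ^ k + 1" q, where ?'a = real] by simp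
      then show "2 ^ k \<le> real q - 1" by linarith
      moreover have "(0::real) < 2 ^ k" by simp
      ultimately show "0 < (real q - 1) * 2 ^ k" by (intro mult_pos_pos) linarith+
    qed auto
    also have "\<dots> = real (card {q\<in>S. ?D k q}) / 2 ^ k" by simp
    also have "\<dots> \<le> real (card ?P) / 2 ^ k"
      using fP assms(2) by (intro divide_right_mono) (auto intro!: card_mono)
    also have "\<dots> \<le> 2 / real k"
    proof -
      have "real (k * card ?P) \<le> real (2 * 2 ^ k)"
        using dyadic_prime_count_le[of k] unfolding of_nat_le_iff .
      then show ?thesis using k0 by (simp add: field_simps)
    qed
    finally show "(\<Sum>q\<in>S. if ?D k q then 1 / (real q - 1) else 0) \<le> 2 / real k" .
  qed
  finally show ?thesis by simp
qed

lemma prime_dyadic: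
  assumes "prime (q::nat)" "q \<noteq> 2"
  obtains k where "k \<ge> 1" "2 ^ k < q" "q \<le> 2 ^ (k + 1)"
proof -
  have "q > 2" using assms prime_ge_2_nat[of q] by auto
  then obtain k where k: "2 ^ k < q" "q \<le> 2 ^ (k + 1)" using ex_power_ivl2[of 2 q] by auto
  moreover have "k \<ge> 1" using k \<open>q > 2\<close> by (cases k) auto
  ultimately show ?thesis using that by blast
qed

text \<open>About log z dyadic intervals meet the range, each contributing a constant over \<kappa>
  log z. The bound does not depend on \<open>z\<close>, so one constant serves all blocks.\<close>

lemma sum_primes_block_le:
  fixes z \<kappa> :: real
  assumes "z \<ge> 2" "\<kappa> > 0" and S: "\<And>q. q \<in> S \<Longrightarrow> prime q \<and> z powr \<kappa> < real q \<and> real q \<le> z"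
  shows "(\<Sum>q\<in>S. 1 / (real q - 1)) \<le> 1 + 4 / \<kappa>"
proof -
  define l where "l = log 2 z"
  have l: "l \<ge> 1" unfolding l_def using assms(1) by (simp add: le_log_iff)
  let ?K = "{k. 1 \<le> k \<and> \<kappa> * l \<le> real k + 1 \<and> real k \<le> l}"
  have sub: "?K \<subseteq> {1..nat \<lfloor>l\<rfloor>}" by (auto simp: le_nat_floor)
  have fK: "finite ?K" by (rule finite_subset[OF sub]) auto
  have fS: "finite S"
    by (rule finite_subset[OF _ finite_primes_le[of z]]) (use S in auto)
  have "(\<Sum>q\<in>S. 1 / (real q - 1)) \<le> 1 + (\<Sum>k\<in>?K. 2 / real k)"
  proof (rule sum_primes_dyadic_le[OF fS _ fK])
    fix q assume q: "q \<in> S"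
    then show "prime q" using S by auto
    assume "q \<noteq> 2"
    then obtain k where k: "k \<ge> 1" "2 ^ k < q" "q \<le> 2 ^ (k + 1)" using prime_dyadic \<open>prime q\<close> by blast
    have "real k \<le> l"
    proof -
      have le: "real (2 ^ k) \<le> real q" using k(2) by (simp only: of_nat_le_iff)
      have "2 powr real k \<le> z" using order.trans[OF le] S[OF q] by (simp add: powr_realpow)
      then show ?thesis using assms(1) by (simp add: l_def le_log_iff)
    qed
    moreover have "\<kappa> * l \<le> real k + 1"
    proof -
      have "real q \<le> real (2 ^ (k + 1))" using k(3) by (simp only: of_nat_le_iff)
      then have "z powr \<kappa> \<le> real (2 ^ (k + 1))" using S[OF q] by linarith
      also have "\<dots> = 2 powr (real k + 1)" by (simp add: powr_add powr_realpow)
      finally have "log 2 (z powr \<kappa>) \<le> real k + 1" using assms(1) by (subst log_le_iff) auto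
      then show ?thesis using assms(1) by (simp add: l_def log_powr)
    qed
    ultimately show "\<exists>k\<in>?K. 2 ^ k < q \<and> q \<le> 2 ^ (k + 1)" using k by auto
  qed auto
  also have "(\<Sum>k\<in>?K. 2 / real k) \<le> (\<Sum>k\<in>?K. 4 / (\<kappa> * l))"
  proof (intro sum_mono)
    fix k assume k: "k \<in> ?K"
    have "2 / real k \<le> 4 / (real k + 1)" using k by (simp add: field_simps)
    also have "\<dots> \<le> 4 / (\<kappa> * l)" using k assms l by (intro divide_left_mono) auto
    finally show "2 / real k \<le> 4 / (\<kappa> * l)" .
  qed
  also have "\<dots> = real (card ?K) * (4 / (\<kappa> * l))" by simp
  also have "\<dots> \<le> l * (4 / (\<kappa> * l))"
  proof (intro mult_right_mono)
    have "card ?K \<le> nat \<lfloor>l\<rfloor>" using card_mono[OF _ sub] by simp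
    then show "real (card ?K) \<le> l" using l by linarith
  qed (use assms l in auto)
  also have "\<dots> = 4 / \<kappa>" using l by simp
  finally show ?thesis by simp
qed

lemma harm_le: "n \<ge> 1 \<Longrightarrow> harm n \<le> 1 + ln (real n)"
  using decseqD[OF decseq_harm_diff_ln, of 0 "n - 1"] by (cases n) (auto simp: harm_expand)

text \<open>The true size is log log x. The constant 2 in front only changes the power of log x that
  arises when this bound is exponentiated.\<close>

lemma sum_primes_le:
  fixes x :: real
  assumes "x \<ge> 2" and S: "\<And>q. q \<in> S \<Longrightarrow> prime q \<and> real q \<le> x"
  shows "(\<Sum>q\<in>S. 1 / (real q - 1)) \<le> 3 + 2 * ln (2 * ln x)"
proof -
  define l where "l = log 2 x"
  have l: "l \<ge> 1" unfolding l_def using assms(1) by (simp add: le_log_iff)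
  let ?n = "nat \<lfloor>l\<rfloor>"
  have fS: "finite S"
    by (rule finite_subset[OF _ finite_primes_le[of x]]) (use S in auto)
  have "(\<Sum>q\<in>S. 1 / (real q - 1)) \<le> 1 + (\<Sum>k\<in>{1..?n}. 2 / real k)"
  proof (rule sum_primes_dyadic_le[OF fS])
    fix q assume q: "q \<in> S"
    then show "prime q" using S by auto
    assume "q \<noteq> 2"
    then obtain k where k: "k \<ge> 1" "2 ^ k < q" "q \<le> 2 ^ (k + 1)" using prime_dyadic \<open>prime q\<close> by blast
    have le: "real (2 ^ k) \<le> real q" using k(2) by (simp only: of_nat_le_iff)
    have "2 powr real k \<le> x" using order.trans[OF le] S[OF q] by (simp add: powr_realpow)
    then have "real k \<le> l" using assms(1) by (simp add: l_def le_log_iff)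
    then show "\<exists>k\<in>{1..?n}. 2 ^ k < q \<and> q \<le> 2 ^ (k + 1)" using k by (auto simp: le_nat_floor)
  qed auto
  also have "(\<Sum>k\<in>{1..?n}. 2 / real k) = 2 * harm ?n"
    by (simp add: harm_def sum_distrib_left divide_inverse)
  also have "harm ?n \<le> 1 + ln (real ?n)" using l by (intro harm_le) (simp add: le_nat_iff le_floor_iff)
  also have "ln (real ?n) \<le> ln (2 * ln x)"
  proof -
    have "real ?n \<le> l" using l by linarith
    also have "l = ln x / ln 2" by (simp add: l_def log_def)
    also have "\<dots> \<le> ln x / (1/2)" using assms(1) ln2_ge_two_thirds by (intro divide_left_mono) auto
    finally have "real ?n \<le> 2 * ln x" by simp
    moreover have "real ?n > 0" using l by simp
    ultimately show ?thesis by (intro ln_mono)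
  qed
  finally show ?thesis by simp
qed

section \<open>The range of \<open>\<gamma>\<close> for which Hypothesis Z is possible\<close>

lemma prime_factors_prod_primes:
  assumes "finite T" "\<And>p. p \<in> T \<Longrightarrow> prime (p::nat)"
  shows "prime_factors (\<Prod>T) = T"
proof -
  have "\<Prod>T \<noteq> 0" using assms(1) assms(2)[of 0] by auto
  then show ?thesis
    using assms by (auto simp: prime_factors_dvd prime_dvd_prod_iff) (metis primes_dvd_imp_eq)
qed

lemma totient_prod_primes_ge:
  assumes "finite T" "\<And>p. p \<in> T \<Longrightarrow> prime (p::nat)"
  shows "real (\<Prod>T) \<le> 2 ^ card T * real (totient (\<Prod>T))"
  using assms
proof (induction T rule: finite_induct)
  case (insert p T)
  have p: "prime p" using insert by auto
  have "coprime p (\<Prod>T)" using insert by (intro prod_coprime_right) (auto intro!: primes_coprime)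
  then have tot: "real (totient (\<Prod>(insert p T))) = (real p - 1) * real (totient (\<Prod>T))"
    using insert.hyps p prime_ge_2_nat[OF p] by (simp add: totient_mult_coprime totient_prime of_nat_diff)
  have "real p \<le> 2 * (real p - 1)" using prime_ge_2_nat[OF p] by simp
  then have "real p * real (\<Prod>T) \<le> 2 * (real p - 1) * (2 ^ card T * real (totient (\<Prod>T)))"
    using insert by (intro mult_mono) (auto intro: prod_nonneg)
  then show ?case unfolding tot using insert.hyps by (simp add: algebra_simps)
qed auto

text \<open>For \<open>a = -2\<close> the prime 2 lies in the residue class \<open>-a\<close> modulo every odd \<open>m\<close>, so beyond the
  range \<open>m \<le> x\<close> every smooth \<open>m\<close> contributes about 1 to the sum.\<close>

lemma hypothesis_Z_imp_le_1:
  assumes "hypothesis_Z \<gamma>"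
  shows "\<gamma> \<le> 1"
proof (rule ccontr)
  assume "\<not> \<gamma> \<le> 1"
  define \<epsilon> where "\<epsilon> = (\<gamma> - 1) / 2"
  have \<epsilon>: "\<epsilon> > 0" "\<gamma> - \<epsilon> = 1 + \<epsilon>" using \<open>\<not> \<gamma> \<le> 1\<close> by (auto simp: \<epsilon>_def field_simps)
  define idx where "idx \<delta> x = {m. 1 \<le> m \<and> real m \<le> x powr (1 + \<epsilon>) \<and>
                real (largest_prime_factor m) \<le> x powr \<delta> \<and> coprime (int m) (-2)}" for \<delta> x
  define tm where "tm x m = \<bar>real (prime_count_cong x m 2) - real (prime_count x) / real (totient m)\<bar>" for x m
  obtain \<delta> where "\<delta> > 0" and "\<forall>B\<ge>1. \<forall>a::int. a \<noteq> 0 \<longrightarrow> (\<exists>C::real. \<forall>x\<ge>2.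
         (\<Sum>m | 1 \<le> m \<and> real m \<le> x powr (\<gamma> - \<epsilon>) \<and>
                real (largest_prime_factor m) \<le> x powr \<delta> \<and> coprime (int m) a.
            \<bar>real (prime_count_cong x m (- a)) - real (prime_count x) / real (totient m)\<bar>)
         \<le> C * (x / ln x powr B))"
    using assms \<epsilon>(1) unfolding hypothesis_Z_def by meson
  from this(2)[rule_format, of 1 "-2"] obtain C where
    C: "\<And>x. x \<ge> 2 \<Longrightarrow> (\<Sum>m\<in>idx \<delta> x. tm x m) \<le> C * (x / ln x)"
    unfolding idx_def tm_def \<epsilon>(2) by (auto simp: powr_one')
  \<comment> \<open>Then \<open>\<theta> \<le> \<delta>\<close>, so a product of \<open>k\<close>
    distinct primes up to x^\<theta> is smooth enough, and it is at most x^(1+\<epsilon>).\<close>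
  define k where "k = Suc (nat \<lceil>(1 + \<epsilon>) / \<delta>\<rceil>)"
  define \<theta> where "\<theta> = (1 + \<epsilon>) / real k"
  have k: "k \<ge> 1" "real k > 0" by (auto simp: k_def)
  have \<theta>: "\<theta> > 0" "\<theta> * real k = 1 + \<epsilon>" using \<epsilon>(1) k by (auto simp: \<theta>_def)
  have \<theta>\<delta>: "\<theta> \<le> \<delta>"
  proof -
    have "(1 + \<epsilon>) / \<delta> \<le> real k" unfolding k_def by linarith
    then show ?thesis using \<open>\<delta> > 0\<close> k by (simp add: \<theta>_def field_simps)
  qed
  have ztop: "filterlim (\<lambda>x::real. x powr \<theta>) at_top at_top" using \<theta>(1) by real_asymp
  have "eventually (\<lambda>z::real. z / (4 * ln z) \<ge> 1 \<and> z / (4 * ln z) \<ge> real k) at_top"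
    by (intro eventually_conj; real_asymp)
  then have "eventually (\<lambda>x. x powr \<theta> / (4 * ln (x powr \<theta>)) \<ge> 1 \<and> x powr \<theta> / (4 * ln (x powr \<theta>)) \<ge> real k) at_top"
    by (rule eventually_compose_filterlim[OF _ ztop])
  moreover have "eventually (\<lambda>x. prime_count (x powr \<theta>) \<ge> x powr \<theta> / (2 * ln (x powr \<theta>))) at_top"
    by (rule eventually_compose_filterlim[OF prime_count_lower ztop])
  moreover have "eventually (\<lambda>x::real. x \<ge> 2) at_top" by (rule eventually_ge_at_top)
  moreover define c where "c = (4 * real k * \<theta>) ^ k"
  have "c > 0" using k \<theta> by (simp add: c_def)
  \<comment> \<open>The left side will be a lower bound for the number of such products of odd
    primes. The first term on the right discards the small ones; the second is twice the bound of
    the hypothesis, because every remaining modulus contributes at least 1/2.\<close>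
  then have "eventually (\<lambda>x::real. x powr (1 + \<epsilon>) / (c * ln x ^ k) > 2 ^ (k+1) * x + 2 * (C * (x / ln x))) at_top"
    using \<epsilon>(1) by real_asymp
  ultimately have "eventually (\<lambda>x::real. False) at_top"
  proof eventually_elim
    case (elim x)
    define z where "z = x powr \<theta>"
    define P where "P = {p::nat. prime p \<and> real p \<le> z} - {2}"
    define S where "S = {T. T \<subseteq> P \<and> card T = k}"
    \<comment> \<open>Such a product satisfies \<open>m \<le> 2 ^ k * totient m\<close>. Above this
      threshold \<open>totient m\<close> therefore exceeds 2x, so the expected count is at most 1/2,
      while the prime 2 makes the actual count at least 1.\<close>
    define M where "M = {m \<in> Prod ` S. real m > 2 ^ (k+1) * x}"
    have fP: "finite P" unfolding P_def using finite_primes_le by auto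
    have fS: "finite S" using fP by (simp add: S_def)
    have z1: "z \<ge> 1" using elim(3) \<theta>(1) by (simp add: z_def ge_one_powr_ge_zero)
    have P: "prime p" "odd p" "real p \<le> z" if "p \<in> P" for p
      using that primes_dvd_imp_eq[of 2 p] by (auto simp: P_def)
    have T: "finite T" "\<And>p. p \<in> T \<Longrightarrow> prime p" "T \<subseteq> P" "card T = k" if "T \<in> S" for T
      using that fP P by (auto simp: S_def intro: finite_subset)
    have inj: "inj_on Prod S"
      by (rule inj_on_inverseI[where g = prime_factors]) (use prime_factors_prod_primes T in auto)
    have cP: "real (card P) \<ge> z / (4 * ln z)"
    proof -
      have "prime_count z \<le> card P + 1"
        unfolding P_def prime_count_def using finite_primes_le[of z] by (simp add: card_Diff_singleton_if, arith)
      moreover have "z / (2 * ln z) = 2 * (z / (4 * ln z))" by simp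
      ultimately show ?thesis using elim(1,2) unfolding z_def[symmetric] by linarith
    qed
    have kP: "k \<le> card P" using cP elim(1) unfolding z_def[symmetric] by linarith
    have "x powr (1 + \<epsilon>) / (c * ln x ^ k) = (z / (4 * ln z) / real k) ^ k"
    proof -
      have "z ^ k = x powr (1 + \<epsilon>)" unfolding z_def \<theta>(2)[symmetric] powr_powr[symmetric]
        using elim(3) by (simp add: powr_realpow)
      moreover have "ln z = \<theta> * ln x" using elim(3) by (simp add: z_def ln_powr)
      ultimately show ?thesis by (simp add: c_def power_divide power_mult_distrib mult_ac)
    qed
    also have "\<dots> \<le> (real (card P) / real k) ^ k"
      using cP elim(1) unfolding z_def[symmetric] by (intro power_mono divide_right_mono divide_nonneg_nonneg[OF _ of_nat_0_le_iff]) linarith+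
    also have "\<dots> \<le> real (card P choose k)" by (rule binomial_ge_n_over_k_pow_k[OF kP])
    also have "\<dots> = real (card (Prod ` S))" using n_subsets[OF fP, of k] inj by (simp add: S_def card_image)
    finally have cS: "x powr (1 + \<epsilon>) / (c * ln x ^ k) \<le> real (card (Prod ` S))" .
    have "card (Prod ` S) \<le> card (M \<union> {1..nat \<lfloor>2 ^ (k+1) * x\<rfloor>})"
    proof (intro card_mono)
      show "Prod ` S \<subseteq> M \<union> {1..nat \<lfloor>2 ^ (k+1) * x\<rfloor>}"
      proof safe
        fix T assume TS: "T \<in> S" "\<Prod>T \<notin> {1..nat \<lfloor>2 ^ (k+1) * x\<rfloor>}"
        have "\<Prod>T \<ge> 1" using T[OF TS(1)] prime_gt_0_nat by (simp add: Suc_le_eq prod_pos)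
        then have "\<not> real (\<Prod>T) \<le> 2 ^ (k+1) * x" using TS(2) by (auto simp: le_nat_floor)
        then show "\<Prod>T \<in> M" using TS(1) by (auto simp: M_def)
      qed
    qed (use fS in \<open>auto simp: M_def\<close>)
    also have "\<dots> \<le> card M + nat \<lfloor>2 ^ (k+1) * x\<rfloor>" using card_Un_le[of M "{1..nat \<lfloor>2 ^ (k+1) * x\<rfloor>}"] by simp
    finally have "real (card (Prod ` S)) \<le> real (card M) + real (nat \<lfloor>2 ^ (k+1) * x\<rfloor>)" by linarith
    moreover have "real (nat \<lfloor>2 ^ (k+1) * x\<rfloor>) \<le> 2 ^ (k+1) * x" using elim(3) by simp
    ultimately have cM: "real (card M) > 2 * (C * (x / ln x))" using cS elim(4) by linarith
    have fidx: "finite (idx \<delta> x)"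
      by (rule finite_subset[of _ "{..nat \<lfloor>x powr (1 + \<epsilon>)\<rfloor>}"]) (auto simp: idx_def le_nat_floor)
    have M: "m \<in> idx \<delta> x \<and> 1 / 2 \<le> tm x m" if mM: "m \<in> M" for m
    proof -
      obtain TT where TT: "TT \<in> S" "m = \<Prod>TT" "real m > 2 ^ (k+1) * x" using mM unfolding M_def by blast
      note T = T[OF TT(1)]
      have pf: "prime_factors m = TT" unfolding TT(2) by (rule prime_factors_prod_primes[OF T(1,2)])
      have m1: "m \<ge> 1" using T prime_gt_0_nat unfolding TT(2) by (simp add: Suc_le_eq prod_pos)
      have "real m \<le> (\<Prod>p\<in>TT. z)" unfolding TT(2) of_nat_prod using P T by (intro prod_mono) auto
      also have "\<dots> = z ^ k" using T by simp
      also have "\<dots> = x powr (1 + \<epsilon>)" unfolding z_def \<theta>(2)[symmetric] powr_powr[symmetric]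
        using elim(3) by (simp add: powr_realpow)
      finally have le: "real m \<le> x powr (1 + \<epsilon>)" .
      have "real (largest_prime_factor m) \<le> z"
      proof (cases "m \<le> 1")
        case False
        have "TT \<noteq> {}" using T(4) k by auto
        then have "Max TT \<in> TT" using T(1) by (intro Max_in)
        then show ?thesis using P T(3) False by (auto simp: largest_prime_factor_def pf)
      qed (use z1 in \<open>auto simp: largest_prime_factor_def\<close>)
      also have "z \<le> x powr \<delta>" unfolding z_def using elim(3) \<theta>\<delta> by (intro powr_mono) auto
      finally have sm: "real (largest_prime_factor m) \<le> x powr \<delta>" .
      have "2 \<notin> prime_factors m" using pf P(2)[of 2] T(3) by auto
      then have "odd m" using m1 by (auto simp: prime_factors_dvd)
      then have "m \<in> idx \<delta> x" using m1 le sm by (auto simp: idx_def coprime_right_2_iff_odd)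
      moreover have "1 / 2 \<le> tm x m"
      proof -
        have "2 ^ (k+1) * x < 2 ^ k * real (totient m)"
        proof -
          have "real m \<le> 2 ^ k * real (totient m)"
            using totient_prod_primes_ge[OF T(1,2)] unfolding TT(2) T(4) .
          then show ?thesis using TT(3) by linarith
        qed
        then have tot: "2 * x < real (totient m)" by simp
        have "prime_count x \<le> card {1..nat \<lfloor>x\<rfloor>}" unfolding prime_count_def
          by (intro card_mono) (auto simp: le_nat_floor Suc_le_eq prime_gt_0_nat)
        then have "real (prime_count x) \<le> x" using elim(3) by simp linarith
        then have "real (prime_count x) / real (totient m) \<le> x / (2 * x)"
          using tot elim(3) by (intro frac_le) auto
        also have "\<dots> = 1 / 2" using elim(3) by simp
        finally have "real (prime_count x) / real (totient m) \<le> 1 / 2" .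
        moreover have "card {2::nat} \<le> prime_count_cong x m 2" unfolding prime_count_cong_def
          using elim(3) by (intro card_mono finite_subset[OF _ finite_primes_le[of x]]) auto
        then have "real (prime_count_cong x m 2) \<ge> 1" by simp
        ultimately show ?thesis unfolding tm_def by linarith
      qed
      ultimately show ?thesis ..
    qed
    have "real (card M) / 2 = (\<Sum>m\<in>M. 1 / 2)" by simp
    also have "\<dots> \<le> (\<Sum>m\<in>M. tm x m)" using M by (intro sum_mono) auto
    also have "\<dots> \<le> (\<Sum>m\<in>idx \<delta> x. tm x m)" using M fidx by (intro sum_mono2) (auto simp: tm_def)
    also have "\<dots> \<le> C * (x / ln x)" by (rule C[OF elim(3)])
    finally show False using cM by linarith
  qed
  then show False by simp
qed

section \<open>Rankin bounds for the random model\<close>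

definition vec_prod :: "nat set \<Rightarrow> (nat \<Rightarrow> nat) \<Rightarrow> nat" where
  "vec_prod Q v = (\<Prod>q\<in>Q. q ^ v q)"

definition inv_tot :: "nat \<Rightarrow> nat \<Rightarrow> real" where
  "inv_tot q v = 1 / real (totient (q ^ v))"

lemma inv_tot_0 [simp]: "inv_tot q 0 = 1" by (simp add: inv_tot_def)

lemma inv_tot_nonneg [simp]: "0 \<le> inv_tot q v" by (simp add: inv_tot_def)

lemma inv_tot_Suc: "prime q \<Longrightarrow> inv_tot q (Suc n) = 1 / (real q ^ n * (real q - 1))"
  by (simp only: inv_tot_def real_totient_prime_power_Suc)

lemma prob_W_law_atLeast:
  assumes "prime q" "\<not> int q dvd a"
  shows "measure_pmf.prob (W_law a q) {v..} = inv_tot q v"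
proof -
  have "{v..} = UNIV - {..<v}" by auto
  then have "measure_pmf.prob (W_law a q) {v..} = 1 - measure_pmf.prob (W_law a q) {..<v}"
    using measure_pmf.prob_compl[of "{..<v}" "W_law a q"] by simp
  also have "measure_pmf.prob (W_law a q) {..<v} = (\<Sum>i<v. inv_tot q i - inv_tot q (Suc i))"
    by (simp add: measure_measure_pmf_finite pmf_W_law[OF assms] inv_tot_def del: power_Suc)
  also have "\<dots> = 1 - inv_tot q v" by (subst sum_lessThan_telescope') simp
  finally show ?thesis by simp
qed

lemma vec_prod_restr: "vec_prod B (restr v B) = vec_prod B v"
  unfolding vec_prod_def by (intro prod.cong) auto

lemma real_vec_prod: "real (vec_prod Q v) = (\<Prod>q\<in>Q. real q ^ v q)"
  by (simp add: vec_prod_def)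

text \<open>For \<sigma> \<le> 1/2 the ratio q^(\<sigma>-1) is at most 3/4 even at q = 2, so the
  terms from v = 1 on are dominated by a geometric series with sum 4 times the first term, uniformly
  in \<open>V\<close>.\<close>

lemma sum_inv_tot_powr_le:
  assumes q: "prime q" and \<sigma>: "0 \<le> \<sigma>" "\<sigma> \<le> 1/2"
  shows "(\<Sum>v\<le>V. inv_tot q v * (real q powr \<sigma>) ^ v) \<le> 1 + 4 * real q powr \<sigma> / (real q - 1)"
proof -
  have q2: "real q \<ge> 2" using prime_ge_2_nat[OF q] by simp
  define s where "s = real q powr \<sigma>"
  have s0: "s > 0" using q2 by (simp add: s_def)
  have "s / real q = real q powr (\<sigma> - 1)" using q2 by (simp add: s_def powr_diff)
  also have "\<dots> \<le> real q powr (- (1/2))" using \<sigma> q2 by (intro powr_mono) auto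
  also have "\<dots> \<le> 2 powr (- (1/2))" using q2 by (intro powr_mono2') auto
  also have "\<dots> = 1 / sqrt 2" using powr_minus[of 2 "1/2::real"] powr_half_sqrt[of 2] by (simp add: inverse_eq_divide)
  also have "\<dots> \<le> 3 / 4"
  proof -
    have "4 / 3 \<le> sqrt (2::real)" by (rule real_le_rsqrt) (simp add: power2_eq_square)
    then have "1 / sqrt 2 \<le> 1 / (4/3 :: real)" by (intro divide_left_mono) auto
    then show ?thesis by simp
  qed
  finally have sq: "s / real q \<le> 3 / 4" .
  have term_le: "inv_tot q (Suc i) * s ^ Suc i \<le> s / (real q - 1) * (3/4) ^ i" for i
  proof -
    have "inv_tot q (Suc i) * s ^ Suc i = s / (real q - 1) * (s / real q) ^ i"
      using q2 by (simp add: inv_tot_Suc[OF q] power_divide)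
    also have "\<dots> \<le> s / (real q - 1) * (3/4) ^ i"
      using sq s0 q2 by (intro mult_left_mono power_mono) auto
    finally show ?thesis .
  qed
  have "(\<Sum>v\<le>V. inv_tot q v * s ^ v) \<le> (\<Sum>v\<le>Suc V. inv_tot q v * s ^ v)"
    using s0 by (intro sum_mono2) auto
  also have "\<dots> = 1 + (\<Sum>i\<le>V. inv_tot q (Suc i) * s ^ Suc i)"
    by (subst sum.atMost_Suc_shift) simp
  also have "(\<Sum>i\<le>V. inv_tot q (Suc i) * s ^ Suc i) \<le> (\<Sum>i\<le>V. s / (real q - 1) * (3/4) ^ i)"
    by (intro sum_mono term_le)
  also have "\<dots> = s / (real q - 1) * (\<Sum>i\<le>V. (3/4) ^ i)" by (rule sum_distrib_left[symmetric])
  also have "\<dots> \<le> s / (real q - 1) * 4"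
    using sum_gp0[of "3/4::real" V] s0 q2 by (intro mult_left_mono) auto
  finally show ?thesis by (simp add: s_def mult_ac)
qed

lemma prod_one_plus_le_exp:
  fixes f :: "nat \<Rightarrow> real"
  assumes fQ: "finite Q" and "\<And>q. q \<in> Q \<Longrightarrow> 0 \<le> f q \<and> f q \<le> 1 + c * (1 / (real q - 1))" "(\<Sum>q\<in>Q. 1 / (real q - 1)) \<le> L" "0 \<le> c"
  shows "(\<Prod>q\<in>Q. f q) \<le> exp (c * L)"
proof -
  have "(\<Prod>q\<in>Q. f q) \<le> (\<Prod>q\<in>Q. exp (c * (1 / (real q - 1))))"
    using assms(2) exp_ge_add_one_self by (intro prod_mono) (meson order.trans)
  also have "\<dots> = exp (c * (\<Sum>q\<in>Q. 1 / (real q - 1)))" using fQ by (simp add: exp_sum sum_distrib_left)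
  also have "\<dots> \<le> exp (c * L)" using assms by (simp add: mult_left_mono)
  finally show ?thesis .
qed

context
  fixes Q :: "nat set"
  assumes fQ: "finite Q" and pQ: "\<And>q. q \<in> Q \<Longrightarrow> prime q"
begin

lemma vec_prod_pos: "vec_prod Q v > 0"
  unfolding vec_prod_def using pQ by (intro prod_pos) (auto simp: prime_gt_0_nat)

lemma totient_vec_prod: "1 / real (totient (vec_prod Q v)) = (\<Prod>q\<in>Q. inv_tot q (v q))"
  using fQ pQ
proof (induction Q rule: finite_induct)
  case (insert q Q)
  have "coprime (q ^ v q) (vec_prod Q v)" unfolding vec_prod_def
    using insert by (intro prod_coprime_right) (auto intro!: primes_coprime)
  then have "1 / real (totient (q ^ v q * vec_prod Q v)) = inv_tot q (v q) * (1 / real (totient (vec_prod Q v)))"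
    by (simp add: totient_mult_coprime inv_tot_def)
  moreover have "vec_prod (insert q Q) v = q ^ v q * vec_prod Q v" using insert.hyps by (simp add: vec_prod_def)
  moreover have "1 / real (totient (vec_prod Q v)) = (\<Prod>q\<in>Q. inv_tot q (v q))" using insert by auto
  ultimately show ?case using insert.hyps by (simp only: prod.insert not_False_eq_True)
qed (simp add: vec_prod_def)

lemma vec_prod_dvd_iff: "int (vec_prod Q v) dvd k \<longleftrightarrow> (\<forall>q\<in>Q. int q ^ v q dvd k)"
proof -
  have "int (vec_prod Q v) = (\<Prod>q\<in>Q. int q ^ v q)" by (simp add: vec_prod_def)
  moreover have "coprime (int p ^ v p) (int q ^ v q)" if "p \<in> Q" "q \<in> Q" "p \<noteq> q" for p q
    using primes_coprime[OF pQ[OF that(1)] pQ[OF that(2)] that(3)] by simp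
  ultimately show ?thesis using prod_coprime_dvd_iff[OF fQ, of "\<lambda>q. int q ^ v q"] by simp
qed

lemma multiplicity_vec_prod: "q \<in> Q \<Longrightarrow> multiplicity q (vec_prod Q v) = v q"
  unfolding vec_prod_def using fQ pQ by (subst multiplicity_prod_prime_powers) auto

lemma inj_on_vec_prod: "inj_on (vec_prod Q) (vecs Q V)"
proof (rule inj_onI, rule ext)
  fix v w q assume *: "v \<in> vecs Q V" "w \<in> vecs Q V" "vec_prod Q v = vec_prod Q w"
  show "v q = w q"
    using * multiplicity_vec_prod[of q v] multiplicity_vec_prod[of q w]
    by (cases "q \<in> Q") (auto simp: mem_vecs)
qed

lemma prime_factors_vec_prod: "prime_factors (vec_prod Q v) \<subseteq> Q"
proof
  fix p assume "p \<in> prime_factors (vec_prod Q v)"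
  then have p: "prime p" "p dvd vec_prod Q v" by auto
  then obtain q where "q \<in> Q" "p dvd q ^ v q"
    using fQ by (auto simp: vec_prod_def prime_dvd_prod_iff)
  then show "p \<in> Q" using p(1) pQ primes_dvd_imp_eq[of p q] by (auto dest: prime_dvd_power)
qed

lemma largest_prime_factor_vec_prod:
  assumes "\<And>q. q \<in> Q \<Longrightarrow> real q \<le> y" "0 \<le> y"
  shows "real (largest_prime_factor (vec_prod Q v)) \<le> y"
proof (cases "vec_prod Q v \<le> 1")
  case False
  then have "prime_factors (vec_prod Q v) \<noteq> {}"
    using vec_prod_pos[of v] by (auto simp: prime_factorization_empty_iff)
  then have "Max (prime_factors (vec_prod Q v)) \<in> prime_factors (vec_prod Q v)"
    by (intro Max_in) auto
  then show ?thesis using False assms prime_factors_vec_prod by (auto simp: largest_prime_factor_def)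
qed (use assms in \<open>auto simp: largest_prime_factor_def\<close>)

text \<open>The weight is the square of 2^\<omega>(m), the number of ways in which m arises as n d
  with d squarefree. The 16 comes from 4 (1 + 4/(q-1)) - 3 in each Euler factor.\<close>

lemma sum_vecs_weight4_le:
  assumes "(\<Sum>q\<in>Q. 1 / (real q - 1)) \<le> L"
  shows "(\<Sum>v\<in>vecs Q V. (\<Prod>q\<in>Q. if v q = 0 then 1 else 4) * (\<Prod>q\<in>Q. inv_tot q (v q))) \<le> exp (16 * L)"
proof -
  have "(\<Sum>v\<in>vecs Q V. (\<Prod>q\<in>Q. if v q = 0 then 1 else 4) * (\<Prod>q\<in>Q. inv_tot q (v q)))
     = (\<Prod>q\<in>Q. \<Sum>v\<le>V. (if v = 0 then 1 else 4) * inv_tot q v)"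
    unfolding prod.distrib[symmetric] by (rule sum_vecs_prod[OF fQ])
  also have "\<dots> \<le> exp (16 * L)"
  proof (rule prod_one_plus_le_exp[OF fQ _ assms])
    fix q assume "q \<in> Q"
    then have q: "prime q" "real q \<ge> 2" using pQ prime_ge_2_nat[of q] by auto
    have "(\<Sum>v\<le>V. (if v = 0 then 1 else 4) * inv_tot q v) = (\<Sum>v\<le>V. 4 * inv_tot q v - (if v = 0 then 3 else 0))"
      by (intro sum.cong) auto
    also have "\<dots> = 4 * (\<Sum>v\<le>V. inv_tot q v) - 3" by (simp add: sum_subtractf sum_distrib_left)
    also have "(\<Sum>v\<le>V. inv_tot q v) \<le> 1 + 4 / (real q - 1)"
      using sum_inv_tot_powr_le[OF q(1), of 0 V] q(2) by simp
    finally show "0 \<le> (\<Sum>v\<le>V. (if v = 0 then 1 else 4) * inv_tot q v) \<and>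
       (\<Sum>v\<le>V. (if v = 0 then 1 else 4) * inv_tot q v) \<le> 1 + 16 * (1 / (real q - 1))"
      by (auto intro!: sum_nonneg)
  qed auto
  finally show ?thesis .
qed

end

definition rankin_bound :: "real \<Rightarrow> real \<Rightarrow> real \<Rightarrow> real \<Rightarrow> real" where
  "rankin_bound D Y \<sigma> L = D powr (- \<sigma>) * Y powr (2 * \<sigma>) * exp (5 * L * Y powr \<sigma>)"

context
  fixes B :: "nat set" and D Y \<sigma> L :: real
  assumes fB: "finite B" and pB: "\<And>q. q \<in> B \<Longrightarrow> prime q"
    and Y: "\<And>q. q \<in> B \<Longrightarrow> real q \<le> Y" "1 \<le> Y" and D: "D > 0"
    and \<sigma>: "0 \<le> \<sigma>" "\<sigma> \<le> 1/2" and L: "(\<Sum>q\<in>B. 1 / (real q - 1)) \<le> L"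
begin

lemma B_minus_1: "q \<in> B \<Longrightarrow> 1 \<le> real q - 1"
  using prime_ge_2_nat[OF pB, of q] by simp

lemma rankin_sum_n:
  "(\<Sum>n\<in>vecs B V. (\<Prod>q\<in>B. inv_tot q (n q)) * real (vec_prod B n) powr \<sigma>) \<le> exp (4 * Y powr \<sigma> * L)"
proof -
  have "(\<Sum>n\<in>vecs B V. (\<Prod>q\<in>B. inv_tot q (n q)) * real (vec_prod B n) powr \<sigma>)
     = (\<Sum>n\<in>vecs B V. \<Prod>q\<in>B. inv_tot q (n q) * (real q powr \<sigma>) ^ n q)"
  proof (intro sum.cong refl)
    fix n
    have "real (vec_prod B n) powr \<sigma> = (\<Prod>q\<in>B. (real q ^ n q) powr \<sigma>)"
      unfolding real_vec_prod by (rule prod_powr_distrib)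
    also have "\<dots> = (\<Prod>q\<in>B. (real q powr \<sigma>) ^ n q)"
      using pB prime_gt_0_nat
      by (intro prod.cong refl) (simp add: powr_realpow[symmetric] powr_powr mult.commute)
    finally show "(\<Prod>q\<in>B. inv_tot q (n q)) * real (vec_prod B n) powr \<sigma> = (\<Prod>q\<in>B. inv_tot q (n q) * (real q powr \<sigma>) ^ n q)"
      by (simp add: prod.distrib)
  qed
  also have "\<dots> = (\<Prod>q\<in>B. \<Sum>v\<le>V. inv_tot q v * (real q powr \<sigma>) ^ v)" by (rule sum_vecs_prod[OF fB])
  also have "\<dots> \<le> exp (4 * Y powr \<sigma> * L)"
  proof (rule prod_one_plus_le_exp[OF fB _ L])
    show "0 \<le> 4 * Y powr \<sigma>" by simp
    fix q assume q: "q \<in> B"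
    then have q2: "real q \<ge> 2" using B_minus_1 by force
    have "4 * real q powr \<sigma> / (real q - 1) \<le> 4 * Y powr \<sigma> / (real q - 1)"
      using q2 Y(1)[OF q] \<sigma> by (intro divide_right_mono mult_left_mono powr_mono2) auto
    then show "0 \<le> (\<Sum>v\<le>V. inv_tot q v * (real q powr \<sigma>) ^ v) \<and>
       (\<Sum>v\<le>V. inv_tot q v * (real q powr \<sigma>) ^ v) \<le> 1 + 4 * Y powr \<sigma> * (1 / (real q - 1))"
      using sum_inv_tot_powr_le[OF pB[OF q] \<sigma>, of V] by (auto intro!: sum_nonneg)
  qed
  finally show ?thesis .
qed

lemma rankin_sum_d:
  "(\<Sum>d\<in>vecs B 1. \<Prod>q\<in>B. (Y powr \<sigma> / (real q - 1)) ^ d q) \<le> exp (Y powr \<sigma> * L)"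
proof -
  have "(\<Sum>d\<in>vecs B 1. \<Prod>q\<in>B. (Y powr \<sigma> / (real q - 1)) ^ d q) = (\<Prod>q\<in>B. \<Sum>v\<le>1. (Y powr \<sigma> / (real q - 1)) ^ v)"
    by (rule sum_vecs_prod[OF fB])
  also have "\<dots> \<le> exp (Y powr \<sigma> * L)"
  proof (rule prod_one_plus_le_exp[OF fB _ L])
    fix q assume q: "q \<in> B"
    then have q2: "real q \<ge> 2" using B_minus_1 by force
    then have "0 \<le> Y powr \<sigma> / (real q - 1)" by simp
    then show "0 \<le> (\<Sum>v\<le>1. (Y powr \<sigma> / (real q - 1)) ^ v) \<and> (\<Sum>v\<le>1. (Y powr \<sigma> / (real q - 1)) ^ v) \<le> 1 + Y powr \<sigma> * (1 / (real q - 1))"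
      by simp
  qed auto
  finally show ?thesis .
qed

lemma L_nonneg: "0 \<le> L"
proof -
  have "0 \<le> (\<Sum>q\<in>B. 1 / (real q - 1))"
    using B_minus_1 by (intro sum_nonneg) force
  then show ?thesis using L by linarith
qed

text \<open>A further factor q multiplies 1/\<phi> by exactly 1/(q-1) if q is new and by 1/q
  otherwise. This decouples \<open>d\<close> from \<open>n\<close>.\<close>

lemma inv_tot_add_le:
  assumes "d \<in> vecs B 1"
  shows "(\<Prod>q\<in>B. inv_tot q (n q + d q)) \<le> (\<Prod>q\<in>B. inv_tot q (n q)) * (\<Prod>q\<in>B. (1 / (real q - 1)) ^ d q)"
  unfolding prod.distrib[symmetric]
proof (intro prod_mono conjI)
  fix q assume q: "q \<in> B"
  have p: "prime q" "real q \<ge> 2" using pB[OF q] prime_ge_2_nat[OF pB[OF q]] by auto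
  have "d q \<le> 1" using assms q by (auto simp: mem_vecs)
  then consider "d q = 0" | "d q = 1" by linarith
  then show "inv_tot q (n q + d q) \<le> inv_tot q (n q) * (1 / (real q - 1)) ^ d q"
  proof cases
    case 2
    show ?thesis
    proof (cases "n q")
      case 0
      then show ?thesis using 2 inv_tot_Suc[OF p(1), of 0] by simp
    next
      case (Suc i)
      have "inv_tot q (Suc (Suc i)) = 1 / (real q ^ i * (real q - 1)) * (1 / real q)"
        by (simp add: inv_tot_Suc[OF p(1)])
      also have "\<dots> \<le> 1 / (real q ^ i * (real q - 1)) * (1 / (real q - 1))"
        using p(2) by (intro mult_left_mono divide_left_mono) auto
      finally show ?thesis using 2 Suc by (simp add: inv_tot_Suc[OF p(1)])
    qed
  qed simp
qed simp

text \<open>The assumption on \<open>b\<close> expresses that the cut-off is maximal: an omitted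
  \<open>d\<close> has \<open>sum d B = b n + 1\<close>, so N Y^(sum d + 2) exceeds
  \<open>D\<close>, where N is the product for \<open>n\<close>. Each term may then be multiplied by
  the \<sigma>-th power of the quotient, after which the sums over \<open>n\<close> and
  \<open>d\<close> separate into Euler products.\<close>

lemma rankin_rho:
  assumes b: "\<And>n. n \<in> vecs B V \<Longrightarrow> good n \<Longrightarrow> D < real (vec_prod B n) * Y ^ (b n + 3)"
  shows "(\<Sum>n | n \<in> vecs B V \<and> good n. \<Sum>d\<in>vecs B 1.
          sieve_r B (b n) d * (\<Prod>q\<in>B. inv_tot q (n q + d q))) \<le> rankin_bound D Y \<sigma> L"
proof -
  define K where "K = D powr (- \<sigma>) * Y powr (2 * \<sigma>)"
  have K0: "K \<ge> 0" by (simp add: K_def)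
  have "sieve_r B (b n) d * (\<Prod>q\<in>B. inv_tot q (n q + d q)) \<le>
      K * (((\<Prod>q\<in>B. inv_tot q (n q)) * real (vec_prod B n) powr \<sigma>) * (\<Prod>q\<in>B. (Y powr \<sigma> / (real q - 1)) ^ d q))"
    if n: "n \<in> vecs B V" "good n" and d: "d \<in> vecs B 1" for n d
  proof (cases "sum d B = b n + 1")
    case True
    let ?N = "real (vec_prod B n)"
    have N: "?N > 0" using vec_prod_pos[OF fB pB] by simp
    have "1 \<le> ?N * Y ^ (sum d B + 2) / D" using b[OF n] True D by (simp add: eval_nat_numeral)
    then have "1 \<le> (?N * Y ^ (sum d B + 2) / D) powr \<sigma>" using \<sigma> by (intro ge_one_powr_ge_zero)
    also have "\<dots> = K * (?N powr \<sigma> * (Y powr \<sigma>) ^ sum d B)"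
    proof -
      have "Y ^ (sum d B + 2) = Y powr (real (sum d B) + 2)" using Y(2) by (simp add: powr_add powr_realpow power2_eq_square del: of_nat_sum)
      then have "(?N * Y ^ (sum d B + 2) / D) powr \<sigma> = ?N powr \<sigma> * Y powr ((real (sum d B) + 2) * \<sigma>) / D powr \<sigma>"
        using N D Y(2) by (simp add: powr_mult powr_divide powr_powr del: of_nat_sum)
      also have "Y powr ((real (sum d B) + 2) * \<sigma>) = (Y powr \<sigma>) ^ sum d B * Y powr (2 * \<sigma>)"
      proof -
        have "(real (sum d B) + 2) * \<sigma> = \<sigma> * real (sum d B) + 2 * \<sigma>" by (simp add: algebra_simps)
        then show ?thesis using Y(2) by (simp add: powr_add powr_realpow[symmetric] powr_powr del: of_nat_sum)
      qed
      finally show ?thesis by (simp add: K_def powr_minus divide_inverse mult_ac)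
    qed
    finally have one: "1 \<le> K * (?N powr \<sigma> * (Y powr \<sigma>) ^ sum d B)" .
    have P0: "0 \<le> (\<Prod>q\<in>B. inv_tot q (n q)) * (\<Prod>q\<in>B. (1 / (real q - 1)) ^ d q)"
      using B_minus_1 by (intro mult_nonneg_nonneg prod_nonneg zero_le_power ballI) force+
    have "sieve_r B (b n) d * (\<Prod>q\<in>B. inv_tot q (n q + d q)) \<le> (\<Prod>q\<in>B. inv_tot q (n q)) * (\<Prod>q\<in>B. (1 / (real q - 1)) ^ d q)"
      using inv_tot_add_le[OF d, of n] True by (simp add: sieve_r_def)
    also have "\<dots> \<le> ((\<Prod>q\<in>B. inv_tot q (n q)) * (\<Prod>q\<in>B. (1 / (real q - 1)) ^ d q)) * (K * (?N powr \<sigma> * (Y powr \<sigma>) ^ sum d B))"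
      using mult_left_mono[OF one P0] by simp
    also have "\<dots> = K * (((\<Prod>q\<in>B. inv_tot q (n q)) * ?N powr \<sigma>) * (\<Prod>q\<in>B. (Y powr \<sigma> / (real q - 1)) ^ d q))"
      by (simp add: power_divide prod_dividef power_sum mult_ac prod.distrib)
    finally show ?thesis .
  next
    case False
    have "0 \<le> (\<Prod>q\<in>B. (Y powr \<sigma> / (real q - 1)) ^ d q)"
      using B_minus_1 by (intro prod_nonneg zero_le_power divide_nonneg_nonneg ballI) force+
    then show ?thesis using False K0 by (auto simp: sieve_r_def intro!: mult_nonneg_nonneg prod_nonneg)
  qed
  then have "(\<Sum>n | n \<in> vecs B V \<and> good n. \<Sum>d\<in>vecs B 1. sieve_r B (b n) d * (\<Prod>q\<in>B. inv_tot q (n q + d q)))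
     \<le> (\<Sum>n | n \<in> vecs B V \<and> good n. \<Sum>d\<in>vecs B 1. K * (((\<Prod>q\<in>B. inv_tot q (n q)) * real (vec_prod B n) powr \<sigma>) * (\<Prod>q\<in>B. (Y powr \<sigma> / (real q - 1)) ^ d q)))"
    by (intro sum_mono) auto
  also have "\<dots> = K * ((\<Sum>n | n \<in> vecs B V \<and> good n. (\<Prod>q\<in>B. inv_tot q (n q)) * real (vec_prod B n) powr \<sigma>) * (\<Sum>d\<in>vecs B 1. \<Prod>q\<in>B. (Y powr \<sigma> / (real q - 1)) ^ d q))"
    by (simp only: sum_distrib_left[symmetric] sum_distrib_right[symmetric])
  also have "\<dots> \<le> K * (exp (4 * Y powr \<sigma> * L) * exp (Y powr \<sigma> * L))"
  proof (intro mult_left_mono mult_mono rankin_sum_d)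
    have "(\<Sum>n | n \<in> vecs B V \<and> good n. (\<Prod>q\<in>B. inv_tot q (n q)) * real (vec_prod B n) powr \<sigma>)
      \<le> (\<Sum>n\<in>vecs B V. (\<Prod>q\<in>B. inv_tot q (n q)) * real (vec_prod B n) powr \<sigma>)"
      using fB by (intro sum_mono2) (auto intro!: mult_nonneg_nonneg prod_nonneg)
    then show "(\<Sum>n | n \<in> vecs B V \<and> good n. (\<Prod>q\<in>B. inv_tot q (n q)) * real (vec_prod B n) powr \<sigma>) \<le> exp (4 * Y powr \<sigma> * L)"
      using rankin_sum_n[of V] by linarith
    show "0 \<le> (\<Sum>d\<in>vecs B 1. \<Prod>q\<in>B. (Y powr \<sigma> / (real q - 1)) ^ d q)"
      using B_minus_1 by (intro sum_nonneg prod_nonneg zero_le_power divide_nonneg_nonneg ballI) force+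
  qed (use K0 in auto)
  also have "\<dots> = rankin_bound D Y \<sigma> L"
    by (simp add: K_def rankin_bound_def exp_add[symmetric] algebra_simps)
  finally show ?thesis .
qed

text \<open>The missing mass comes from exponents above \<open>V\<close>, a union bound over the
  primes of the block, and from vectors whose product times \<open>Y\<close> exceeds
  \<open>D\<close>, to which Rankin's trick applies.\<close>

lemma rankin_tau:
  defines "w \<equiv> (\<lambda>n. \<Prod>q\<in>B. inv_tot q (n q) - inv_tot q (Suc (n q)))"
  shows "1 - (\<Sum>n | n \<in> vecs B V \<and> real (vec_prod B n) * Y \<le> D. w n) \<le> rankin_bound D Y \<sigma> L + real (card B) / 2 ^ V"
proof -
  have diff: "0 \<le> inv_tot q v - inv_tot q (Suc v)" if "q \<in> B" for q v
    using W_mass_nonneg[OF pB[OF that], of v] by (simp only: inv_tot_def)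
  have w0: "0 \<le> w n" for n unfolding w_def using diff by (intro prod_nonneg) auto
  have split: "(\<Sum>n\<in>vecs B V. w n) = (\<Sum>n | n \<in> vecs B V \<and> real (vec_prod B n) * Y \<le> D. w n) + (\<Sum>n | n \<in> vecs B V \<and> \<not> real (vec_prod B n) * Y \<le> D. w n)"
    using fB by (subst sum.union_disjoint[symmetric]) (auto intro!: sum.cong)
  have "(\<Sum>n\<in>vecs B V. w n) = (\<Prod>q\<in>B. \<Sum>v\<le>V. inv_tot q v - inv_tot q (Suc v))"
    unfolding w_def by (rule sum_vecs_prod[OF fB])
  also have "\<dots> = (\<Prod>q\<in>B. 1 - inv_tot q (Suc V))"
    by (intro prod.cong refl) (subst sum_telescope, simp)
  finally have "1 - (\<Sum>n\<in>vecs B V. w n) \<le> (\<Sum>q\<in>B. inv_tot q (Suc V))"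
  proof -
    assume eq: "(\<Sum>n\<in>vecs B V. w n) = (\<Prod>q\<in>B. 1 - inv_tot q (Suc V))"
    have "inv_tot q (Suc V) \<le> 1" for q by (cases "totient (q ^ Suc V)") (auto simp: inv_tot_def)
    then show ?thesis unfolding eq
      using one_minus_prod_le[OF fB, of "\<lambda>q. 1 - inv_tot q (Suc V)"] by simp
  qed
  also have "\<dots> \<le> (\<Sum>q\<in>B. 1 / 2 ^ V)"
  proof (intro sum_mono)
    fix q assume "q \<in> B"
    then have p: "prime q" "real q \<ge> 2" using pB prime_ge_2_nat[of q] by auto
    have "(2::real) ^ V * 1 \<le> real q ^ V * (real q - 1)" using p(2) by (intro mult_mono power_mono) auto
    then show "inv_tot q (Suc V) \<le> 1 / 2 ^ V" unfolding inv_tot_Suc[OF p(1)] using p(2)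
      by (intro divide_left_mono) auto
  qed
  also have "\<dots> = real (card B) / 2 ^ V" by simp
  finally have 1: "1 - (\<Sum>n\<in>vecs B V. w n) \<le> real (card B) / 2 ^ V" .
  have "(\<Sum>n | n \<in> vecs B V \<and> \<not> real (vec_prod B n) * Y \<le> D. w n)
     \<le> (\<Sum>n | n \<in> vecs B V \<and> \<not> real (vec_prod B n) * Y \<le> D. D powr (- \<sigma>) * Y powr \<sigma> * ((\<Prod>q\<in>B. inv_tot q (n q)) * real (vec_prod B n) powr \<sigma>))"
  proof (intro sum_mono)
    fix n assume n: "n \<in> {n \<in> vecs B V. \<not> real (vec_prod B n) * Y \<le> D}"
    let ?N = "real (vec_prod B n)"
    have N: "?N > 0" using vec_prod_pos[OF fB pB] by simp
    have "1 \<le> ?N * Y / D" using n D by simp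
    then have "1 \<le> (?N * Y / D) powr \<sigma>" using \<sigma> by (intro ge_one_powr_ge_zero)
    also have "\<dots> = D powr (- \<sigma>) * Y powr \<sigma> * ?N powr \<sigma>"
      using N D Y(2) by (simp add: powr_mult powr_divide powr_minus) (simp add: divide_inverse)
    finally have one: "1 \<le> D powr (- \<sigma>) * Y powr \<sigma> * ?N powr \<sigma>" .
    have "w n \<le> (\<Prod>q\<in>B. inv_tot q (n q))" unfolding w_def using diff by (intro prod_mono) auto
    also have "\<dots> \<le> (\<Prod>q\<in>B. inv_tot q (n q)) * (D powr (- \<sigma>) * Y powr \<sigma> * ?N powr \<sigma>)"
      using mult_left_mono[OF one, of "\<Prod>q\<in>B. inv_tot q (n q)"] by (simp add: prod_nonneg)
    finally show "w n \<le> D powr (- \<sigma>) * Y powr \<sigma> * ((\<Prod>q\<in>B. inv_tot q (n q)) * ?N powr \<sigma>)"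
      by (simp only: ac_simps)
  qed
  also have "\<dots> \<le> (\<Sum>n\<in>vecs B V. D powr (- \<sigma>) * Y powr \<sigma> * ((\<Prod>q\<in>B. inv_tot q (n q)) * real (vec_prod B n) powr \<sigma>))"
    using fB by (intro sum_mono2) (auto intro!: mult_nonneg_nonneg prod_nonneg)
  also have "\<dots> \<le> D powr (- \<sigma>) * Y powr \<sigma> * exp (4 * Y powr \<sigma> * L)"
    unfolding sum_distrib_left[symmetric] by (intro mult_left_mono rankin_sum_n) auto
  also have "\<dots> \<le> rankin_bound D Y \<sigma> L"
    unfolding rankin_bound_def using Y(2) \<sigma> L_nonneg
    by (intro mult_mono mult_left_mono powr_mono) (auto intro!: mult_mono simp: mult_ac)
  finally show ?thesis using 1 split by linarith
qed

end

section \<open>Level of distribution\<close>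

definition model_primes :: "int \<Rightarrow> real \<Rightarrow> nat set" where
  "model_primes a y = {q \<in> primes_upto y. \<not> int q dvd a}"

definition large_primes :: "int \<Rightarrow> real \<Rightarrow> nat set" where
  "large_primes a x = {p. prime p \<and> \<bar>a\<bar> + 1 < int p \<and> real p \<le> x}"

lemma finite_model_primes: "finite (model_primes a y)"
  by (rule finite_subset[OF _ finite_primes_le[of y]]) (auto simp: model_primes_def primes_upto_def)

lemma finite_large_primes: "finite (large_primes a x)"
  by (rule finite_subset[OF _ finite_primes_le[of x]]) (auto simp: large_primes_def)

lemma model_primesD: "q \<in> model_primes a y \<Longrightarrow> prime q \<and> real q \<le> y \<and> \<not> int q dvd a"
  by (auto simp: model_primes_def primes_upto_def)

lemma pmf_W_vec:
  assumes "n \<in> vecs (model_primes a y) V"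
  shows "pmf (W_vec a y) n = (\<Prod>q\<in>model_primes a y. inv_tot q (n q) - inv_tot q (Suc (n q)))"
proof -
  have fin: "finite (primes_upto y)" using finite_primes_le[of y] by (simp add: primes_upto_def)
  have 0: "n q = 0" if "q \<notin> model_primes a y" for q using assms that by (auto simp: mem_vecs)
  then have "pmf (W_vec a y) n = (\<Prod>q\<in>primes_upto y. pmf (W_law a q) (n q))"
    unfolding W_vec_def by (intro pmf_Pi' fin) (auto simp: model_primes_def)
  also have "\<dots> = (\<Prod>q\<in>model_primes a y. pmf (W_law a q) (n q))"
    by (rule prod.mono_neutral_right[OF fin]) (auto simp: model_primes_def W_law_def 0)
  also have "\<dots> = (\<Prod>q\<in>model_primes a y. inv_tot q (n q) - inv_tot q (Suc (n q)))"
    by (intro prod.cong refl) (use pmf_W_law model_primesD in \<open>simp add: inv_tot_def del: power_Suc\<close>)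
  finally show ?thesis .
qed

lemma U_vec_support:
  assumes "a \<noteq> 0" "large_primes a x \<noteq> {}" "s \<in> set_pmf (U_vec a x y)" "q \<notin> model_primes a y"
  shows "s q = 0"
proof -
  obtain p where p: "p \<in> large_primes a x" and s: "s = (\<lambda>q. if q \<in> primes_upto y then multiplicity (int q) (int p + a) else 0)"
    using assms(2,3) finite_large_primes[of a x] by (auto simp: U_vec_def large_primes_def[symmetric])
  show ?thesis
  proof (cases "q \<in> primes_upto y")
    case True
    then have q: "prime q" "int q dvd a" using assms(4) by (auto simp: model_primes_def primes_upto_def)
    have "\<not> int q dvd int p + a"
    proof
      assume "int q dvd int p + a"
      then have "int q dvd int p" using q(2) by (simp add: dvd_add_left_iff)
      then have "q = p" using q(1) p by (auto simp: large_primes_def primes_dvd_imp_eq)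
      moreover have "\<bar>int q\<bar> \<le> \<bar>a\<bar>" using q(2) assms(1) dvd_imp_le_int by blast
      ultimately show False using p by (auto simp: large_primes_def)
    qed
    then show ?thesis by (simp add: s not_dvd_imp_multiplicity_0)
  qed (simp add: s)
qed

lemma prob_U_vec:
  assumes "a \<noteq> 0" "large_primes a x \<noteq> {}"
  shows "measure_pmf.prob (U_vec a x y) {s. \<forall>q\<in>model_primes a y. v q \<le> s q}
     = real (card {p \<in> large_primes a x. int (vec_prod (model_primes a y) v) dvd int p + a}) / real (card (large_primes a x))"
proof -
  let ?f = "\<lambda>p q. if q \<in> primes_upto y then multiplicity (int q) (int p + a) else 0"
  have "measure_pmf.prob (U_vec a x y) {s. \<forall>q\<in>model_primes a y. v q \<le> s q}
    = real (card (large_primes a x \<inter> ?f -` {s. \<forall>q\<in>model_primes a y. v q \<le> s q})) / real (card (large_primes a x))"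
    unfolding U_vec_def large_primes_def[symmetric] measure_map_pmf
    using assms(2) finite_large_primes by (subst measure_pmf_of_set) auto
  also have "large_primes a x \<inter> ?f -` {s. \<forall>q\<in>model_primes a y. v q \<le> s q}
     = {p \<in> large_primes a x. int (vec_prod (model_primes a y) v) dvd int p + a}"
  proof -
    have "(\<forall>q\<in>model_primes a y. v q \<le> ?f p q) \<longleftrightarrow> int (vec_prod (model_primes a y) v) dvd int p + a"
      if p: "p \<in> large_primes a x" for p
    proof -
      have nz: "int p + a \<noteq> 0" using p by (auto simp: large_primes_def)
      have "v q \<le> ?f p q \<longleftrightarrow> int q ^ v q dvd int p + a" if q: "q \<in> model_primes a y" for q
      proof -
        have "prime (int q)" using model_primesD[OF q] by simp
        then have "\<not> is_unit (int q)" using not_prime_unit by blast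
        then show ?thesis using q nz by (simp add: model_primes_def power_dvd_iff_le_multiplicity)
      qed
      then show ?thesis
        using vec_prod_dvd_iff[OF finite_model_primes, of a y v "int p + a"] model_primesD by auto
    qed
    then have "{p \<in> large_primes a x. \<forall>q\<in>model_primes a y. v q \<le> ?f p q} = {p \<in> large_primes a x. int (vec_prod (model_primes a y) v) dvd int p + a}"
      by (intro Collect_cong conj_cong refl)
    then show ?thesis by (simp only: vimage_def mem_Collect_eq Int_def)
  qed
  finally show ?thesis .
qed

section \<open>Errors for single moduli and their weighted sum\<close>

lemma card_cong_le:
  fixes m :: nat and x :: real
  assumes "m \<ge> 1" "x \<ge> 0"
  shows "real (card {p::nat. 1 \<le> p \<and> real p \<le> x \<and> int m dvd int p + a}) \<le> x / real m + 1"
proof -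
  let ?S = "{p::nat. 1 \<le> p \<and> real p \<le> x \<and> int m dvd int p + a}"
  define k where "k = nat \<lfloor>x / real m\<rfloor>"
  have sub: "(\<lambda>p. (p - 1) div m) ` ?S \<subseteq> {..k}"
  proof safe
    fix p :: nat assume p: "1 \<le> p" "real p \<le> x"
    have "real ((p - 1) div m) \<le> real (p - 1) / real m" by (rule of_nat_div_le_of_nat)
    also have "\<dots> \<le> x / real m" using p by (intro divide_right_mono) auto
    finally show "(p - 1) div m \<le> k" unfolding k_def by (simp add: le_nat_floor)
  qed
  \<comment> \<open>A residue class meets each run of \<open>m\<close> consecutive integers once.
    The shift by 1 makes the runs start at 1, so the quotients go from 0 to at most x/m.\<close>
  have "inj_on (\<lambda>p. (p - 1) div m) ?S"
  proof (rule inj_onI)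
    fix p p' assume *: "p \<in> ?S" "p' \<in> ?S" "(p - 1) div m = (p' - 1) div m"
    have "int m dvd (int p + a) - (int p' + a)" using * by (intro dvd_diff) auto
    then have "[int (p - 1) = int (p' - 1)] (mod int m)"
      using * by (simp add: cong_iff_dvd_diff of_nat_diff)
    then have "[p - 1 = p' - 1] (mod m)" by (simp only: cong_int_iff)
    then have "(p - 1) mod m = (p' - 1) mod m" by (simp only: cong_def)
    then have "p - 1 = p' - 1" using *(3) by (metis div_mult_mod_eq)
    then show "p = p'" using * by auto
  qed
  then have "card ?S \<le> card {..k}" using sub by (intro card_inj_on_le[OF _ sub]) auto
  then have "real (card ?S) \<le> real k + 1" by simp
  also have "real k \<le> x / real m" unfolding k_def using assms by simp
  finally show ?thesis by simp
qed

definition level_error :: "int \<Rightarrow> real \<Rightarrow> real \<Rightarrow> (nat \<Rightarrow> nat) \<Rightarrow> real" where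
  "level_error a x y v = \<bar>measure_pmf.prob (U_vec a x y) {s. \<forall>q\<in>model_primes a y. v q \<le> s q} - (\<Prod>q\<in>model_primes a y. inv_tot q (v q))\<bar>"

context
  fixes a :: int and x y :: real
  assumes a: "a \<noteq> 0" and ne: "large_primes a x \<noteq> {}" and xy: "2 \<le> y" "y \<le> x"
begin

lemma card_large_pos: "real (card (large_primes a x)) > 0"
  using ne finite_large_primes[of a x] by (simp add: card_gt_0_iff)

lemma card_large_le: "real (card (large_primes a x)) \<le> x"
proof -
  have "card (large_primes a x) \<le> card {1..nat \<lfloor>x\<rfloor>}"
    by (intro card_mono) (auto simp: large_primes_def le_nat_floor Suc_le_eq prime_gt_0_nat)
  then show ?thesis using xy by simp linarith
qed

text \<open>All integers of the residue class are counted. Since the modulus is at most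
  \<open>x\<close>, the count x/m + 1 is at most 2x/m; the third multiple of x covers the model
  term. Compared with the truth this loses about one logarithm.\<close>

lemma level_error_crude:
  assumes "real (vec_prod (model_primes a y) v) \<le> x"
  shows "level_error a x y v \<le> 3 * x / real (card (large_primes a x)) * (\<Prod>q\<in>model_primes a y. inv_tot q (v q))"
proof -
  let ?N = "real (card (large_primes a x))" and ?m = "vec_prod (model_primes a y) v"
  let ?c = "real (card {p \<in> large_primes a x. int ?m dvd int p + a})"
  have m: "?m \<ge> 1" using vec_prod_pos[OF finite_model_primes] model_primesD by (simp add: Suc_le_eq)
  have tot: "real (totient ?m) > 0" "real (totient ?m) \<le> real ?m" using m totient_le by auto
  have g: "(\<Prod>q\<in>model_primes a y. inv_tot q (v q)) = 1 / real (totient ?m)"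
    using totient_vec_prod[OF finite_model_primes] model_primesD by simp
  have "?c \<le> real (card {p::nat. 1 \<le> p \<and> real p \<le> x \<and> int ?m dvd int p + a})"
    unfolding of_nat_le_iff
  proof (rule card_mono)
    show "finite {p. 1 \<le> p \<and> real p \<le> x \<and> int ?m dvd int p + a}"
      by (rule finite_subset[of _ "{..nat \<lfloor>x\<rfloor>}"]) (auto simp: le_nat_floor)
  qed (auto simp: large_primes_def Suc_le_eq prime_gt_0_nat)
  also have "\<dots> \<le> x / real ?m + 1" using m xy by (intro card_cong_le) auto
  also have "\<dots> \<le> 2 * (x / real ?m)" using assms m by (simp add: field_simps)
  also have "\<dots> \<le> 2 * (x / real (totient ?m))" using tot xy by (intro mult_left_mono divide_left_mono) auto
  finally have "?c / ?N \<le> 2 * (x / real (totient ?m)) / ?N" by (intro divide_right_mono) auto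
  moreover have "1 / real (totient ?m) \<le> x / ?N * (1 / real (totient ?m))"
    using mult_right_mono[of 1 "x / ?N" "1 / real (totient ?m)"] card_large_pos card_large_le tot by simp
  moreover have "level_error a x y v \<le> ?c / ?N + 1 / real (totient ?m)"
    unfolding level_error_def prob_U_vec[OF a ne] g using tot by (intro order.trans[OF abs_triangle_ineq4]) auto
  moreover have "2 * (x / real (totient ?m)) / ?N = 2 * (x / (?N * real (totient ?m)))"
    "x / ?N * (1 / real (totient ?m)) = x / (?N * real (totient ?m))"
    "3 * x / ?N * (1 / real (totient ?m)) = 3 * (x / (?N * real (totient ?m)))"
    by (simp_all add: mult.commute)
  moreover have gen: "l \<le> C" if "c \<le> A" "f \<le> B" "l \<le> c + f" "A = 2 * R" "B = R" "C = 3 * R" for l c f A B C R :: real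
    using that by linarith
  ultimately show ?thesis unfolding g by blast
qed

text \<open>At most |a| + 1 primes are lost by restricting to p > |a| + 1. This affects the count in
  the residue class and the total count once each, hence the factor 2.\<close>

lemma level_error_le:
  defines "m \<equiv> (\<lambda>v. vec_prod (model_primes a y) v)"
  shows "level_error a x y v \<le> (\<bar>real (prime_count_cong x (m v) (- a)) - real (prime_count x) / real (totient (m v))\<bar> + 2 * (real_of_int \<bar>a\<bar> + 1))
     / real (card (large_primes a x))"
proof -
  let ?N = "real (card (large_primes a x))" and ?m = "m v"
  let ?C = "{p \<in> large_primes a x. int ?m dvd int p + a}"
  let ?S = "{p::nat. 1 \<le> p \<and> int p \<le> \<bar>a\<bar> + 1}"
  have m1: "?m \<ge> 1" unfolding m_def using vec_prod_pos[OF finite_model_primes] model_primesD by (simp add: Suc_le_eq)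
  then have tot: "real (totient ?m) \<ge> 1" by (simp add: Suc_le_eq)
  have S: "?S = {1..nat (\<bar>a\<bar> + 1)}" by auto
  have cS: "real (card ?S) = real_of_int \<bar>a\<bar> + 1" unfolding S by simp
  have "prime_count_cong x ?m (- a) \<le> card (?C \<union> ?S)"
    unfolding prime_count_cong_def
  proof (rule card_mono)
    show "finite (?C \<union> ?S)" using finite_large_primes S by auto
    show "{p. prime p \<and> real p \<le> x \<and> [int p = - a] (mod int ?m)} \<subseteq> ?C \<union> ?S"
      by (auto simp: large_primes_def cong_iff_dvd_diff Suc_le_eq prime_gt_0_nat)
  qed
  also have "\<dots> \<le> card ?C + card ?S" by (rule card_Un_le)
  finally have 1: "real (prime_count_cong x ?m (- a)) \<le> real (card ?C) + (real_of_int \<bar>a\<bar> + 1)" unfolding cS[symmetric] by linarith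
  have "card ?C \<le> prime_count_cong x ?m (- a)"
    unfolding prime_count_cong_def
    by (intro card_mono finite_subset[OF _ finite_primes_le[of x]]) (auto simp: large_primes_def cong_iff_dvd_diff)
  then have 2: "real (card ?C) \<le> real (prime_count_cong x ?m (- a))" by simp
  have "prime_count x \<le> card (large_primes a x \<union> ?S)"
    unfolding prime_count_def
  proof (rule card_mono)
    show "finite (large_primes a x \<union> ?S)" using finite_large_primes S by auto
  qed (auto simp: large_primes_def Suc_le_eq prime_gt_0_nat)
  also have "\<dots> \<le> card (large_primes a x) + card ?S" by (rule card_Un_le)
  finally have 3: "real (prime_count x) \<le> ?N + (real_of_int \<bar>a\<bar> + 1)" unfolding cS[symmetric] by linarith
  have "card (large_primes a x) \<le> prime_count x"
    unfolding prime_count_def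
    by (intro card_mono finite_primes_le) (auto simp: large_primes_def)
  then have 4: "?N \<le> real (prime_count x)" by simp
  have g: "(\<Prod>q\<in>model_primes a y. inv_tot q (v q)) = 1 / real (totient ?m)"
    unfolding m_def using totient_vec_prod[OF finite_model_primes] model_primesD by simp
  have 5: "\<bar>real (prime_count x) / real (totient ?m) - ?N / real (totient ?m)\<bar> \<le> real_of_int \<bar>a\<bar> + 1"
  proof -
    have "real (prime_count x) / real (totient ?m) - ?N / real (totient ?m) = (real (prime_count x) - ?N) / real (totient ?m)"
      by (simp add: diff_divide_distrib)
    moreover have "\<dots> \<le> (real (prime_count x) - ?N) / 1" using 4 tot m1 by (intro divide_left_mono) auto
    moreover have "0 \<le> (real (prime_count x) - ?N) / real (totient ?m)" using 4 by simp
    ultimately show ?thesis using 3 by simp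
  qed
  have gen: "\<bar>c - n\<bar> \<le> \<bar>P - q\<bar> + 2 * A" if "P \<le> c + A" "c \<le> P" "\<bar>q - n\<bar> \<le> A" for c n P q A :: real
    using that by linarith
  have "\<bar>real (card ?C) - ?N / real (totient ?m)\<bar> \<le> \<bar>real (prime_count_cong x ?m (- a)) - real (prime_count x) / real (totient ?m)\<bar> + 2 * (real_of_int \<bar>a\<bar> + 1)"
    by (rule gen[OF 1 2 5])
  moreover have "level_error a x y v = \<bar>real (card ?C) - ?N / real (totient ?m)\<bar> / ?N"
  proof -
    have "real (card ?C) / ?N - 1 / real (totient ?m) = (real (card ?C) - ?N / real (totient ?m)) / ?N"
      using card_large_pos by (simp add: field_simps)
    then show ?thesis unfolding level_error_def prob_U_vec[OF a ne] g m_def[symmetric] by (simp add: m_def abs_divide)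
  qed
  ultimately show ?thesis by (simp add: divide_right_mono)
qed

text \<open>Distinct vectors give distinct moduli, so the unweighted sum is part of the sum in
  Hypothesis Z, and \<open>level_error_crude\<close> bounds the sum with squared weights. The free
  parameter \<open>t\<close> balances the two and later becomes a power of log x.\<close>

lemma sum_level_error_le:
  fixes X t Z L \<delta> :: real
  assumes X: "0 \<le> X" "X \<le> x" and t: "t > 0" and y\<delta>: "y \<le> x powr \<delta>"
    and Z: "(\<Sum>m | 1 \<le> m \<and> real m \<le> X \<and> real (largest_prime_factor m) \<le> x powr \<delta> \<and> coprime (int m) a.
            \<bar>real (prime_count_cong x m (- a)) - real (prime_count x) / real (totient m)\<bar>) \<le> Z"
    and L: "(\<Sum>q\<in>model_primes a y. 1 / (real q - 1)) \<le> L"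
  shows "(\<Sum>v | v \<in> vecs (model_primes a y) V \<and> real (vec_prod (model_primes a y) v) \<le> X.
            (\<Prod>q\<in>model_primes a y. if v q = (0::nat) then 1 else 2) * level_error a x y v)
     \<le> (t * (Z + 2 * (real_of_int \<bar>a\<bar> + 1) * X) + 3 * x * exp (16 * L) / t) / real (card (large_primes a x))"
proof -
  let ?Q = "model_primes a y" and ?N = "real (card (large_primes a x))"
  let ?VV = "{v \<in> vecs ?Q V. real (vec_prod ?Q v) \<le> X}"
  let ?w2 = "\<lambda>v. \<Prod>q\<in>?Q. (if v q = (0::nat) then 1 else 2 :: real)"
  let ?w4 = "\<lambda>v. \<Prod>q\<in>?Q. (if v q = (0::nat) then 1 else 4 :: real)"
  let ?E = "\<lambda>m. \<bar>real (prime_count_cong x m (- a)) - real (prime_count x) / real (totient m)\<bar>"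
  let ?idx = "{m. 1 \<le> m \<and> real m \<le> X \<and> real (largest_prime_factor m) \<le> x powr \<delta> \<and> coprime (int m) a}"
  have fV: "finite ?VV" using finite_model_primes by auto
  have pos: "vec_prod ?Q v > 0" for v using vec_prod_pos[OF finite_model_primes] model_primesD by simp
  have sub: "vec_prod ?Q ` ?VV \<subseteq> ?idx"
  proof safe
    fix v assume v: "v \<in> vecs ?Q V" "real (vec_prod ?Q v) \<le> X"
    show "1 \<le> vec_prod ?Q v" using pos[of v] by simp
    have "real (largest_prime_factor (vec_prod ?Q v)) \<le> y"
      using xy model_primesD by (intro largest_prime_factor_vec_prod finite_model_primes) auto
    then show "real (largest_prime_factor (vec_prod ?Q v)) \<le> x powr \<delta>" using y\<delta> by simp
    have "int (vec_prod ?Q v) = (\<Prod>q\<in>?Q. int q ^ v q)" by (simp add: vec_prod_def)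
    moreover have "coprime (int q ^ v q) a" if "q \<in> ?Q" for q
      using model_primesD[OF that] by (auto intro: prime_imp_coprime)
    ultimately show "coprime (int (vec_prod ?Q v)) a" by (auto intro: prod_coprime_left)
  qed
  have fidx: "finite ?idx"
    by (rule finite_subset[of _ "{..nat \<lfloor>X\<rfloor>}"]) (auto simp: le_nat_floor)
  have inj: "inj_on (vec_prod ?Q) ?VV"
    using inj_on_vec_prod[OF finite_model_primes, of a y V] model_primesD by (auto intro: inj_on_subset)
  have "card ?VV = card (vec_prod ?Q ` ?VV)" using inj by (simp add: card_image)
  also have "\<dots> \<le> card {1..nat \<lfloor>X\<rfloor>}" using sub by (intro card_mono) (auto simp: le_nat_floor)
  finally have cV: "real (card ?VV) \<le> X" using X(1) by simp linarith
  have "(\<Sum>v\<in>?VV. level_error a x y v) \<le> (\<Sum>v\<in>?VV. (?E (vec_prod ?Q v) + 2 * (real_of_int \<bar>a\<bar> + 1)) / ?N)"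
    by (intro sum_mono level_error_le)
  also have "\<dots> = ((\<Sum>v\<in>?VV. ?E (vec_prod ?Q v)) + real (card ?VV) * (2 * (real_of_int \<bar>a\<bar> + 1))) / ?N"
    by (simp add: sum_divide_distrib[symmetric] sum.distrib)
  also have "\<dots> \<le> (Z + X * (2 * (real_of_int \<bar>a\<bar> + 1))) / ?N"
  proof (intro divide_right_mono add_mono mult_right_mono cV)
    have "(\<Sum>v\<in>?VV. ?E (vec_prod ?Q v)) = (\<Sum>m\<in>vec_prod ?Q ` ?VV. ?E m)"
      by (subst sum.reindex[OF inj]) simp
    also have "\<dots> \<le> (\<Sum>m\<in>?idx. ?E m)" using sub fidx by (intro sum_mono2) auto
    also have "\<dots> \<le> Z" by (rule Z)
    finally show "(\<Sum>v\<in>?VV. ?E (vec_prod ?Q v)) \<le> Z" .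
  qed auto
  finally have A: "(\<Sum>v\<in>?VV. level_error a x y v) \<le> (Z + 2 * (real_of_int \<bar>a\<bar> + 1) * X) / ?N" by (simp add: mult_ac)
  have "(\<Sum>v\<in>?VV. ?w4 v * level_error a x y v) \<le> (\<Sum>v\<in>?VV. 3 * x / ?N * (?w4 v * (\<Prod>q\<in>?Q. inv_tot q (v q))))"
  proof (intro sum_mono)
    fix v assume "v \<in> ?VV"
    then have "?w4 v * level_error a x y v \<le> ?w4 v * (3 * x / ?N * (\<Prod>q\<in>?Q. inv_tot q (v q)))"
      using X by (intro mult_left_mono level_error_crude prod_nonneg) auto
    then show "?w4 v * level_error a x y v \<le> 3 * x / ?N * (?w4 v * (\<Prod>q\<in>?Q. inv_tot q (v q)))"
      by (simp only: ac_simps)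
  qed
  also have "\<dots> = 3 * x / ?N * (\<Sum>v\<in>?VV. ?w4 v * (\<Prod>q\<in>?Q. inv_tot q (v q)))" by (simp only: sum_distrib_left)
  also have "\<dots> \<le> 3 * x / ?N * exp (16 * L)"
  proof (intro mult_left_mono)
    have "(\<Sum>v\<in>?VV. ?w4 v * (\<Prod>q\<in>?Q. inv_tot q (v q))) \<le> (\<Sum>v\<in>vecs ?Q V. ?w4 v * (\<Prod>q\<in>?Q. inv_tot q (v q)))"
      using finite_model_primes by (intro sum_mono2) (auto intro!: mult_nonneg_nonneg prod_nonneg)
    also have "\<dots> \<le> exp (16 * L)"
      using sum_vecs_weight4_le[OF finite_model_primes _ L, of V] model_primesD by simp
    finally show "(\<Sum>v\<in>?VV. ?w4 v * (\<Prod>q\<in>?Q. inv_tot q (v q))) \<le> exp (16 * L)" .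
  qed (use xy in auto)
  finally have Bb: "(\<Sum>v\<in>?VV. ?w4 v * level_error a x y v) \<le> 3 * x / ?N * exp (16 * L)" .
  have "(\<Sum>v\<in>?VV. ?w2 v * level_error a x y v) \<le> (\<Sum>v\<in>?VV. t * level_error a x y v + 1 / t * (?w4 v * level_error a x y v))"
  proof (intro sum_mono)
    fix v
    have sq: "?w4 v = ?w2 v * ?w2 v" unfolding prod.distrib[symmetric] by (intro prod.cong) auto
    have w0: "0 \<le> ?w2 v" by (intro prod_nonneg) auto
    \<comment> \<open>A weight above \<open>t\<close> is at most its square over \<open>t\<close>: this trades the divisor weights for a power of \<open>log x\<close>.\<close>
    have "?w2 v \<le> t + 1 / t * ?w4 v"
    proof (cases "?w2 v \<le> t")
      case True
      then show ?thesis using w0 t sq by (simp add: add_increasing2)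
    next
      case False
      then have "?w2 v * t \<le> ?w2 v * ?w2 v" using w0 by (intro mult_left_mono) auto
      then have "?w2 v \<le> 1 / t * ?w4 v" unfolding sq using t by (simp add: field_simps)
      then show ?thesis using t by linarith
    qed
    then have "?w2 v * level_error a x y v \<le> (t + 1 / t * ?w4 v) * level_error a x y v"
      by (intro mult_right_mono) (auto simp: level_error_def)
    then show "?w2 v * level_error a x y v \<le> t * level_error a x y v + 1 / t * (?w4 v * level_error a x y v)"
      by (simp only: distrib_right mult.assoc)
  qed
  also have "\<dots> = t * (\<Sum>v\<in>?VV. level_error a x y v) + 1 / t * (\<Sum>v\<in>?VV. ?w4 v * level_error a x y v)"
    by (simp only: sum.distrib sum_distrib_left)
  also have "\<dots> \<le> t * ((Z + 2 * (real_of_int \<bar>a\<bar> + 1) * X) / ?N) + 1 / t * (3 * x / ?N * exp (16 * L))"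
    using t by (intro add_mono mult_left_mono A Bb) auto
  also have "\<dots> = (t * (Z + 2 * (real_of_int \<bar>a\<bar> + 1) * X) + 3 * x * exp (16 * L) / t) / ?N"
  proof -
    have "t * (K / ?N) + 1 / t * (3 * x / ?N * exp (16 * L)) = (t * K + 3 * x * exp (16 * L) / t) / ?N" for K
      by (simp add: add_divide_distrib)
    then show ?thesis .
  qed
  finally show ?thesis .
qed

end

section \<open>The main estimate\<close>

text \<open>The pair (n, d) is recovered from n + d and d, so each v is counted at most once for
  every 0/1 vector below it; the number of these is the product on the right. Adding
  \<open>d\<close> raises exponents by at most 1, hence \<open>Suc V\<close>.\<close>

lemma sum_add_vecs_le:
  fixes F :: "('a \<Rightarrow> nat) \<Rightarrow> real"
  assumes fQ: "finite Q" and F: "\<And>v. 0 \<le> F v"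
    and C: "\<And>n d. n \<in> vecs Q V \<Longrightarrow> d \<in> vecs Q 1 \<Longrightarrow> C n d \<Longrightarrow> P (\<lambda>q. n q + d q)"
  shows "(\<Sum>n\<in>vecs Q V. \<Sum>d\<in>vecs Q 1. of_bool (C n d) * F (\<lambda>q. n q + d q))
     \<le> (\<Sum>v | v \<in> vecs Q (Suc V) \<and> P v. (\<Prod>q\<in>Q. if v q = 0 then 1 else 2) * F v)"
proof -
  let ?VV = "{v. v \<in> vecs Q (Suc V) \<and> P v}"
  let ?S = "{(n, d). n \<in> vecs Q V \<and> d \<in> vecs Q 1 \<and> C n d}"
  let ?T = "SIGMA v:?VV. {d \<in> vecs Q 1. \<forall>q\<in>Q. d q \<le> v q}"
  let ?m = "\<lambda>(n, d). ((\<lambda>q. n q + d q), d) :: ('a \<Rightarrow> nat) \<times> ('a \<Rightarrow> nat)"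
  have fT: "finite ?T" using fQ by (intro finite_SigmaI) auto
  have inj: "inj_on ?m ?S" by (auto simp: inj_on_def fun_eq_iff)
  have sub: "?m ` ?S \<subseteq> ?T"
  proof safe
    fix n d assume "n \<in> vecs Q V" "d \<in> vecs Q 1" "C n d"
    then show "(\<lambda>q. n q + d q) \<in> vecs Q (Suc V)" "P (\<lambda>q. n q + d q)"
      using C by (auto simp: mem_vecs) (metis One_nat_def Suc_eq_plus1 add_mono)
  qed auto
  have "(\<Sum>n\<in>vecs Q V. \<Sum>d\<in>vecs Q 1. of_bool (C n d) * F (\<lambda>q. n q + d q)) = (\<Sum>p\<in>?S. F (fst (?m p)))"
    unfolding sum.cartesian_product using fQ by (intro sum.mono_neutral_cong_right) auto
  also have "\<dots> = (\<Sum>p\<in>?m ` ?S. F (fst p))" by (subst sum.reindex[OF inj]) simp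
  also have "\<dots> \<le> (\<Sum>p\<in>?T. F (fst p))" using F by (intro sum_mono2 fT sub) auto
  also have "\<dots> = (\<Sum>v\<in>?VV. \<Sum>d\<in>{d \<in> vecs Q 1. \<forall>q\<in>Q. d q \<le> v q}. F v)"
    using fQ by (subst sum.Sigma) (auto intro!: sum.cong)
  also have "\<dots> = (\<Sum>v\<in>?VV. (\<Prod>q\<in>Q. if v q = 0 then 1 else 2) * F v)"
  proof (intro sum.cong refl)
    fix v :: "'a \<Rightarrow> nat"
    have ob: "(\<Prod>q\<in>Q. of_bool (d q \<le> v q)) = (of_bool (\<forall>q\<in>Q. d q \<le> v q) :: real)" for d
      using fQ by (induction Q rule: finite_induct) auto
    have "real (card {d \<in> vecs Q 1. \<forall>q\<in>Q. d q \<le> v q}) = (\<Sum>d\<in>vecs Q 1. \<Prod>q\<in>Q. of_bool (d q \<le> v q))"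
      unfolding ob using fQ by (simp add: Int_def)
    also have "\<dots> = (\<Prod>q\<in>Q. \<Sum>i\<le>1. of_bool (i \<le> v q))" by (rule sum_vecs_prod[OF fQ])
    also have "\<dots> = (\<Prod>q\<in>Q. if v q = 0 then 1 else 2)" by (intro prod.cong) auto
    finally show "(\<Sum>d\<in>{d \<in> vecs Q 1. \<forall>q\<in>Q. d q \<le> v q}. F v) = (\<Prod>q\<in>Q. if v q = 0 then 1 else 2) * F v" by simp
  qed
  finally show ?thesis .
qed

text \<open>This takes the largest even \<open>b\<close> for which the level still has room for b +
  1 primes, since the first omitted layer occurs in the sieve weights too. Parity is forced by
  Bonferroni, so the next candidate is b + 2, which needs b + 3. The premise says that b = 0
  fits.\<close>

lemma exists_even_exponent:
  fixes N y D :: real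
  assumes "N > 0" "y \<ge> 2"
  shows "\<exists>b. even b \<and> (N * y \<le> D \<longrightarrow> N * y ^ (b + 1) \<le> D \<and> D < N * y ^ (b + 3))"
proof (cases "N * y \<le> D")
  case True
  obtain K where K: "D / N < y ^ K" using real_arch_pow[of y "D / N"] assms by auto
  let ?P = "\<lambda>k. N * y ^ (2 * k + 1) \<le> D"
  have "k \<le> K" if "?P k" for k
  proof (rule ccontr)
    assume "\<not> k \<le> K"
    then have "y ^ K \<le> y ^ (2 * k + 1)" using assms by (intro power_increasing) auto
    then have "N * y ^ K \<le> D" using that assms mult_left_mono[of "y ^ K" "y ^ (2 * k + 1)" N] by linarith
    then show False using K assms by (simp add: field_simps)
  qed
  then obtain k where k: "?P k" "\<And>j. ?P j \<Longrightarrow> j \<le> k"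
    using True ex_has_greatest_nat[of ?P 0 id "Suc K"] by (auto simp: less_Suc_eq_le)
  have "\<not> ?P (Suc k)" using k(2)[of "Suc k"] by auto
  moreover have "2 * Suc k + 1 = 2 * k + 3" by simp
  ultimately have "D < N * y ^ (2 * k + 3)" by (metis not_le)
  moreover have "even (2 * k)" by simp
  ultimately show ?thesis using k(1) by blast
qed auto

text \<open>A vector is good on a block if the cut-off 0 fits the level there. Then every modulus n
  d that occurs has block parts at most \<open>D i\<close>, and so is at most \<open>X\<close>. The
  truncation loss and the mass set aside satisfy the same Rankin bound, whence \<open>S\<close>
  occurs twice.\<close>

lemma d_TV_le_rankin:
  fixes a :: int and x y L X :: real and B :: "nat \<Rightarrow> nat set" and Y D \<sigma> :: "nat \<Rightarrow> real" and J V :: nat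
  assumes a: "a \<noteq> 0" and ne: "large_primes a x \<noteq> {}"
    and disj: "disjoint_family_on B {..<J}" and un: "(\<Union>i<J. B i) = model_primes a y"
    and Y: "\<And>i q. i < J \<Longrightarrow> q \<in> B i \<Longrightarrow> real q \<le> Y i" "\<And>i. i < J \<Longrightarrow> 2 \<le> Y i"
    and D: "\<And>i. i < J \<Longrightarrow> 0 < D i" "(\<Prod>i<J. D i) \<le> X"
    and \<sigma>: "\<And>i. i < J \<Longrightarrow> 0 \<le> \<sigma> i \<and> \<sigma> i \<le> 1/2"
    and L: "\<And>i. i < J \<Longrightarrow> (\<Sum>q\<in>B i. 1 / (real q - 1)) \<le> L"
  defines "S \<equiv> (\<Sum>i<J. rankin_bound (D i) (Y i) (\<sigma> i) L)"
  shows "d_TV (W_vec a y) (U_vec a x y) \<le> S * exp S + S + real (card (model_primes a y)) / 2 ^ V +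
      (1 + real J) * (\<Sum>v | v \<in> vecs (model_primes a y) (Suc V) \<and> real (vec_prod (model_primes a y) v) \<le> X.
            (\<Prod>q\<in>model_primes a y. if v q = 0 then 1 else 2) * level_error a x y v)"
proof -
  let ?Q = "model_primes a y"
  let ?E = "\<lambda>i. rankin_bound (D i) (Y i) (\<sigma> i) L"
  define good where "good i n \<longleftrightarrow> real (vec_prod (B i) n) * Y i \<le> D i" for i n
  have BQ: "B i \<subseteq> ?Q" if "i < J" for i using un that by auto
  have fB: "finite (B i)" if "i < J" for i using finite_subset[OF BQ[OF that] finite_model_primes] .
  have pB: "prime q" if "i < J" "q \<in> B i" for i q using BQ that model_primesD by blast
  have "\<exists>b. even b \<and> (i < J \<and> good i n \<longrightarrow> real (vec_prod (B i) n) * Y i ^ (b + 1) \<le> D i \<and> D i < real (vec_prod (B i) n) * Y i ^ (b + 3))" for i n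
  proof (cases "i < J")
    case True
    have "real (vec_prod (B i) n) > 0" using vec_prod_pos[OF fB[OF True]] pB[OF True] by simp
    from exists_even_exponent[OF this Y(2)[OF True], of "D i"] show ?thesis unfolding good_def by blast
  qed auto
  then obtain b where b: "\<And>i n. even (b i n)"
    "\<And>i n. i < J \<Longrightarrow> good i n \<Longrightarrow> real (vec_prod (B i) n) * Y i ^ (b i n + 1) \<le> D i"
    "\<And>i n. i < J \<Longrightarrow> good i n \<Longrightarrow> D i < real (vec_prod (B i) n) * Y i ^ (b i n + 3)"
    by metis
  have g: "measure_pmf.prob (W_law a q) {v..} = inv_tot q v" if "q \<in> ?Q" for q v
    using prob_W_law_atLeast model_primesD[OF that] by blast
  have Y1: "1 \<le> Y i" if "i < J" for i using Y(2)[OF that] by simp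
  have main: "d_TV (W_vec a y) (U_vec a x y) \<le> (\<Sum>i<J. ?E i) * exp (\<Sum>i<J. ?E i) + (\<Sum>i<J. ?E i + real (card (B i)) / 2 ^ V) +
     (1 + real (card {..<J})) * (\<Sum>n\<in>vecs (\<Union>i<J. B i) V. \<Sum>d\<in>vecs (\<Union>i<J. B i) 1.
        of_bool (\<forall>i\<in>{..<J}. good i (restr n (B i)) \<and> sum d (B i) \<le> b i (restr n (B i)) + 1) *
        \<bar>measure_pmf.prob (U_vec a x y) {s. \<forall>q\<in>(\<Union>i<J. B i). n q + d q \<le> s q} - (\<Prod>q\<in>(\<Union>i<J. B i). measure_pmf.prob (W_law a q) {n q + d q..})\<bar>)"
  proof (rule d_TV_block_sieve[OF _ disj fB b(1)])
    fix n assume n: "n \<in> vecs (\<Union>i<J. B i) V"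
    show "pmf (W_vec a y) n = (\<Prod>q\<in>(\<Union>i<J. B i). measure_pmf.prob (W_law a q) {n q..} - measure_pmf.prob (W_law a q) {Suc (n q)..})"
      using pmf_W_vec[of n a y V] n g unfolding un by (simp cong: prod.cong)
  next
    fix s q assume "s \<in> set_pmf (U_vec a x y)" "q \<notin> (\<Union>i<J. B i)"
    then show "s q = 0" using U_vec_support[OF a ne] unfolding un by blast
  next
    fix i assume i: "i \<in> {..<J}"
    have "(\<Sum>n | n \<in> vecs (B i) V \<and> good i n. \<Sum>d\<in>vecs (B i) 1. sieve_r (B i) (b i n) d * (\<Prod>q\<in>B i. measure_pmf.prob (W_law a q) {n q + d q..}))
      = (\<Sum>n | n \<in> vecs (B i) V \<and> good i n. \<Sum>d\<in>vecs (B i) 1. sieve_r (B i) (b i n) d * (\<Prod>q\<in>B i. inv_tot q (n q + d q)))"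
      using g BQ i by (intro sum.cong refl arg_cong2[where f = "(*)"] prod.cong) auto
    also have "\<dots> \<le> ?E i"
      by (rule rankin_rho) (use i fB pB Y Y1 D \<sigma> L b in auto)
    finally show "(\<Sum>n | n \<in> vecs (B i) V \<and> good i n. \<Sum>d\<in>vecs (B i) 1. sieve_r (B i) (b i n) d * (\<Prod>q\<in>B i. measure_pmf.prob (W_law a q) {n q + d q..})) \<le> ?E i" .
  next
    fix i assume i: "i \<in> {..<J}"
    have "(\<Sum>n | n \<in> vecs (B i) V \<and> good i n. \<Prod>q\<in>B i. measure_pmf.prob (W_law a q) {n q..} - measure_pmf.prob (W_law a q) {Suc (n q)..})
      = (\<Sum>n | n \<in> vecs (B i) V \<and> good i n. \<Prod>q\<in>B i. inv_tot q (n q) - inv_tot q (Suc (n q)))"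
      using g[OF subsetD[OF BQ]] i by (intro sum.cong refl prod.cong) simp
    moreover have "1 - (\<Sum>n | n \<in> vecs (B i) V \<and> good i n. \<Prod>q\<in>B i. inv_tot q (n q) - inv_tot q (Suc (n q))) \<le> ?E i + real (card (B i)) / 2 ^ V"
      unfolding good_def by (rule rankin_tau) (use i fB pB Y Y1 D \<sigma> L in auto)
    ultimately show "1 - (\<Sum>n | n \<in> vecs (B i) V \<and> good i n. \<Prod>q\<in>B i. measure_pmf.prob (W_law a q) {n q..} - measure_pmf.prob (W_law a q) {Suc (n q)..}) \<le> ?E i + real (card (B i)) / 2 ^ V" by simp
  qed auto
  have card: "(\<Sum>i<J. ?E i + real (card (B i)) / 2 ^ V) = S + real (card ?Q) / 2 ^ V"
  proof -
    have "card ?Q = (\<Sum>i<J. card (B i))" unfolding un[symmetric]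
      using fB disj by (intro card_UN_disjoint) (auto simp: disjoint_family_on_def)
    then show ?thesis by (simp add: S_def sum.distrib sum_divide_distrib)
  qed
  have err: "(\<Sum>n\<in>vecs ?Q V. \<Sum>d\<in>vecs ?Q 1.
        of_bool (\<forall>i\<in>{..<J}. good i (restr n (B i)) \<and> sum d (B i) \<le> b i (restr n (B i)) + 1) * level_error a x y (\<lambda>q. n q + d q))
     \<le> (\<Sum>v | v \<in> vecs ?Q (Suc V) \<and> real (vec_prod ?Q v) \<le> X. (\<Prod>q\<in>?Q. if v q = 0 then 1 else 2) * level_error a x y v)"
  proof (rule sum_add_vecs_le[OF finite_model_primes])
    show "0 \<le> level_error a x y v" for v by (simp add: level_error_def)
    fix n d assume nd: "n \<in> vecs ?Q V" "d \<in> vecs ?Q 1" "\<forall>i\<in>{..<J}. good i (restr n (B i)) \<and> sum d (B i) \<le> b i (restr n (B i)) + 1"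
    have "real (vec_prod ?Q (\<lambda>q. n q + d q)) = (\<Prod>i<J. real (vec_prod (B i) (\<lambda>q. n q + d q)))"
    proof -
      have "vec_prod ?Q (\<lambda>q. n q + d q) = (\<Prod>i<J. vec_prod (B i) (\<lambda>q. n q + d q))"
        unfolding vec_prod_def un[symmetric]
        using fB disj by (intro prod.UNION_disjoint) (auto simp: disjoint_family_on_def)
      then show ?thesis by simp
    qed
    also have "\<dots> \<le> (\<Prod>i<J. D i)"
    proof (intro prod_mono conjI)
      fix i assume i: "i \<in> {..<J}"
      have "real (vec_prod (B i) (\<lambda>q. n q + d q)) = real (vec_prod (B i) n) * (\<Prod>q\<in>B i. real q ^ d q)"
        by (simp add: real_vec_prod power_add prod.distrib)
      also have "\<dots> \<le> real (vec_prod (B i) n) * (\<Prod>q\<in>B i. Y i ^ d q)"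
        using Y(1) i by (intro mult_left_mono prod_mono) (auto intro!: power_mono)
      also have "(\<Prod>q\<in>B i. Y i ^ d q) = Y i ^ sum d (B i)" by (simp add: power_sum)
      also have "real (vec_prod (B i) n) * \<dots> \<le> real (vec_prod (B i) n) * Y i ^ (b i (restr n (B i)) + 1)"
        using nd(3) i Y1[of i] by (intro mult_left_mono power_increasing) auto
      also have "\<dots> \<le> D i" using b(2)[of i "restr n (B i)"] nd(3) i by (simp add: vec_prod_restr)
      finally show "real (vec_prod (B i) (\<lambda>q. n q + d q)) \<le> D i" .
    qed auto
    also have "\<dots> \<le> X" by (rule D(2))
    finally show "real (vec_prod ?Q (\<lambda>q. n q + d q)) \<le> X" .
  qed
  have eqerr: "\<bar>measure_pmf.prob (U_vec a x y) {s. \<forall>q\<in>?Q. n q + d q \<le> s q} - (\<Prod>q\<in>?Q. measure_pmf.prob (W_law a q) {n q + d q..})\<bar> = level_error a x y (\<lambda>q. n q + d q)" for n d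
    unfolding level_error_def using g by (simp cong: prod.cong)
  have "d_TV (W_vec a y) (U_vec a x y) \<le> S * exp S + (S + real (card ?Q) / 2 ^ V) +
     (1 + real J) * (\<Sum>n\<in>vecs ?Q V. \<Sum>d\<in>vecs ?Q 1.
        of_bool (\<forall>i\<in>{..<J}. good i (restr n (B i)) \<and> sum d (B i) \<le> b i (restr n (B i)) + 1) * level_error a x y (\<lambda>q. n q + d q))"
    using main unfolding un eqerr card card_lessThan unfolding S_def[symmetric] .
  also have "\<dots> \<le> S * exp S + (S + real (card ?Q) / 2 ^ V) +
     (1 + real J) * (\<Sum>v | v \<in> vecs ?Q (Suc V) \<and> real (vec_prod ?Q v) \<le> X. (\<Prod>q\<in>?Q. if v q = 0 then 1 else 2) * level_error a x y v)"
    using err by (intro add_left_mono mult_left_mono) auto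
  finally show ?thesis by (simp only: add.assoc)
qed

section \<open>Choice of the Rankin exponent, the blocks and the powers of log x\<close>

lemma rankin_bound_optimised:
  fixes L \<eta> :: real
  assumes "L > 0" "0 < \<eta>" "\<eta> \<le> 1/4"
  obtains U0 where "\<And>U Y D. U \<ge> U0 \<Longrightarrow> Y \<ge> 2 \<Longrightarrow> D > 0 \<Longrightarrow> ln D = U * ln Y \<Longrightarrow>
     \<exists>\<sigma>. 0 \<le> \<sigma> \<and> \<sigma> \<le> 1/2 \<and> rankin_bound D Y \<sigma> L \<le> exp (- ((1 - \<eta>)\<^sup>2 * (U * ln U))) + exp (- ((1 - \<eta>) / 2 * ln D))"
proof -
  \<comment> \<open>Since c \<ge> 1/4 below, \<eta>/8 * U is at most \<eta>/2 * c * U. The threshold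
    4/\<eta> gives the same bound for 2c, and exp 1 ensures ln U \<ge> 1.\<close>
  have "eventually (\<lambda>U::real. 5 * L * U powr (1 - \<eta>) \<le> \<eta> / 8 * U) at_top"
    using assms by real_asymp
  moreover have "eventually (\<lambda>U::real. U \<ge> max (exp 1) (4 / \<eta>)) at_top" by (rule eventually_ge_at_top)
  ultimately have "eventually (\<lambda>U::real. 5 * L * U powr (1 - \<eta>) \<le> \<eta> / 8 * U \<and> U \<ge> max (exp 1) (4 / \<eta>)) at_top"
    by (rule eventually_conj)
  then obtain U0 where U0: "\<And>U. U \<ge> U0 \<Longrightarrow> 5 * L * U powr (1 - \<eta>) \<le> \<eta> / 8 * U \<and> U \<ge> max (exp 1) (4 / \<eta>)"
    by (auto simp: eventually_at_top_linorder)
  show ?thesis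
  proof (rule that[of U0])
    fix U Y D :: real assume U: "U \<ge> U0" and Y: "Y \<ge> 2" and D: "D > 0" "ln D = U * ln Y"
    have U1: "5 * L * U powr (1 - \<eta>) \<le> \<eta> / 8 * U" "U \<ge> exp 1" "U \<ge> 4 / \<eta>" using U0[OF U] by auto
    have Upos: "U > 0" using U1(2) exp_gt_zero[of "1::real"] by linarith
    have lnU: "ln U \<ge> 1" using U1(2) Upos by (simp add: ln_ge_iff)
    have lnY: "ln Y \<ge> 1/2"
    proof -
      have "ln 2 \<le> ln Y" using Y by simp
      then show ?thesis using ln2_ge_two_thirds by linarith
    qed
    \<comment> \<open>With c = \<sigma> ln Y the bound is exp (-cU + 2c + 5L exp c). The factor 1 -
      \<eta> keeps exp c \<le> U^(1-\<eta>), of smaller order than U; a second factor 1 - \<eta>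
      pays for the lower terms. The cap ln Y / 2 is \<sigma> \<le> 1/2. It takes effect when
      \<open>Y\<close> is small compared with \<open>U\<close>, and then the second exponential of
      the claim appears.\<close>
    define c where "c = min ((1 - \<eta>) * ln U) (ln Y / 2)"
    have c: "c \<ge> 1/4" "c \<le> (1 - \<eta>) * ln U" "c \<le> ln Y / 2"
    proof -
      have "(1 - \<eta>) * ln U \<ge> (3/4) * 1" using assms lnU by (intro mult_mono) auto
      then show "c \<ge> 1/4" using lnY by (auto simp: c_def)
    qed (auto simp: c_def)
    define \<sigma> where "\<sigma> = c / ln Y"
    have \<sigma>: "0 \<le> \<sigma>" "\<sigma> \<le> 1/2" "\<sigma> * ln Y = c" using c lnY by (auto simp: \<sigma>_def field_simps)
    have "rankin_bound D Y \<sigma> L = exp (- (\<sigma> * ln D)) * exp (2 * (\<sigma> * ln Y)) * exp (5 * L * exp (\<sigma> * ln Y))"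
      using D Y by (simp add: rankin_bound_def powr_def mult_ac)
    also have "\<dots> = exp (- (c * U) + 2 * c + 5 * L * exp c)"
      unfolding D(2) \<sigma>(3) using \<sigma>(3) by (simp add: exp_add[symmetric] mult_ac)
    also have "\<dots> \<le> exp (- ((1 - \<eta>) * (c * U)))"
    proof -
      have "exp c \<le> U powr (1 - \<eta>)" using c(2) Upos by (simp add: powr_def)
      then have "5 * L * exp c \<le> 5 * L * U powr (1 - \<eta>)" using assms by (intro mult_left_mono) auto
      also have "\<dots> \<le> \<eta> / 8 * U" by (rule U1)
      also have "\<dots> \<le> \<eta> / 2 * (c * U)"
      proof -
        have "1/4 * U \<le> c * U" using c(1) Upos by (intro mult_right_mono) auto
        then have "\<eta> / 2 * (1/4 * U) \<le> \<eta> / 2 * (c * U)" using assms by (intro mult_left_mono) auto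
        then show ?thesis by simp
      qed
      finally have 1: "5 * L * exp c \<le> \<eta> / 2 * (c * U)" .
      have "4 \<le> \<eta> * U" using U1(3) assms by (simp add: field_simps)
      then have "c * 4 \<le> c * (\<eta> * U)" using c(1) by (intro mult_left_mono) auto
      then have 2: "2 * c \<le> \<eta> / 2 * (c * U)" by (simp add: mult_ac)
      have "(1 - \<eta>) * (c * U) = c * U - \<eta> / 2 * (c * U) - \<eta> / 2 * (c * U)" by (simp add: algebra_simps)
      then show ?thesis unfolding exp_le_cancel_iff using 1 2 by linarith
    qed
    also have "\<dots> \<le> exp (- ((1 - \<eta>)\<^sup>2 * (U * ln U))) + exp (- ((1 - \<eta>) / 2 * ln D))"
    proof (cases "(1 - \<eta>) * ln U \<le> ln Y / 2")
      case True
      then have eq: "(1 - \<eta>) * (c * U) = (1 - \<eta>)\<^sup>2 * (U * ln U)" by (simp add: c_def power2_eq_square)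
      show ?thesis unfolding eq by (simp only: le_add_same_cancel1 exp_ge_zero)
    next
      case False
      then have eq: "(1 - \<eta>) * (c * U) = (1 - \<eta>) / 2 * ln D" by (simp add: c_def D(2))
      show ?thesis unfolding eq by (simp only: le_add_same_cancel2 exp_ge_zero)
    qed
    finally show "\<exists>\<sigma>. 0 \<le> \<sigma> \<and> \<sigma> \<le> 1/2 \<and> rankin_bound D Y \<sigma> L \<le> exp (- ((1 - \<eta>)\<^sup>2 * (U * ln U))) + exp (- ((1 - \<eta>) / 2 * ln D))"
      using \<sigma> by blast
  qed
qed

lemma card_large_primes_lower: "eventually (\<lambda>x. real (card (large_primes a x)) \<ge> x / (4 * ln x)) at_top"
proof -
  define K where "K = real_of_int \<bar>a\<bar> + 1"
  have "eventually (\<lambda>x::real. x / (2 * ln x) - K \<ge> x / (4 * ln x)) at_top" by real_asymp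
  with prime_count_lower show ?thesis
  proof eventually_elim
    case (elim x)
    have fin: "finite (large_primes a x)" by (rule finite_large_primes)
    have "prime_count x \<le> card (large_primes a x \<union> {1..nat (\<bar>a\<bar> + 1)})"
      unfolding prime_count_def using fin
      by (intro card_mono) (auto simp: large_primes_def Suc_le_eq prime_gt_0_nat)
    also have "\<dots> \<le> card (large_primes a x) + nat (\<bar>a\<bar> + 1)"
      using card_Un_le[of "large_primes a x" "{1..nat (\<bar>a\<bar> + 1)}"] by simp
    finally have "real (prime_count x) \<le> real (card (large_primes a x)) + real (nat (\<bar>a\<bar> + 1))" by linarith
    moreover have "real (nat (\<bar>a\<bar> + 1)) = K" by (simp add: K_def)
    ultimately show ?case using elim by linarith
  qed
qed

text \<open>\<open>J\<close> is the first index whose edge lies below 2, so no prime remains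
  uncovered. As r^(2j) \<le> 2^(-j), the number of blocks is only logarithmic in log y; the weaker
  bound linear in log y is enough, since it enters as a factor next to arbitrary powers of log
  x.\<close>

lemma prime_blocks:
  fixes r y :: real and a :: int
  assumes r: "0 < r" "r \<le> 1/2" and y: "y \<ge> 2"
  defines "Y \<equiv> (\<lambda>j. y powr (r ^ (2 * j)))"
  defines "B \<equiv> (\<lambda>j. {q \<in> model_primes a y. Y (Suc j) < real q \<and> real q \<le> Y j})"
  obtains J where "\<And>j. j < J \<Longrightarrow> 2 \<le> Y j" "disjoint_family_on B {..<J}" "(\<Union>j<J. B j) = model_primes a y"
     "real J \<le> 1 + 2 * ln y"
proof -
  have lny: "ln y > 0" using y by simp
  have anti: "Y j \<le> Y i" if "i \<le> j" for i j
    unfolding Y_def using y r that by (intro powr_mono power_decreasing) auto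
  have lnY: "ln (Y j) = r ^ (2 * j) * ln y" for j using y by (simp add: Y_def ln_powr)
  have r2: "r ^ (2 * j) \<le> (1/2) ^ j" for j
  proof -
    have "r ^ (2 * j) \<le> r ^ j" using r by (intro power_decreasing) auto
    also have "\<dots> \<le> (1/2) ^ j" using r by (intro power_mono) auto
    finally show ?thesis .
  qed
  have bound: "real j \<le> 2 * ln y" if "2 \<le> Y j" for j
  proof -
    have "ln 2 \<le> ln (Y j)" using that by simp
    then have "2/3 \<le> r ^ (2 * j) * ln y" unfolding lnY using ln2_ge_two_thirds by linarith
    also have "\<dots> \<le> (1/2) ^ j * ln y" using r2 lny by (intro mult_right_mono) auto
    finally have "2/3 * 2 ^ j \<le> ln y" by (simp add: power_one_over field_simps)
    moreover have "real j < 2 ^ j" by (rule of_nat_less_two_power)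
    ultimately show ?thesis by linarith
  qed
  have ex: "\<exists>j. Y j < 2"
  proof (rule ccontr)
    assume "\<nexists>j. Y j < 2"
    then have "real (nat \<lceil>2 * ln y\<rceil> + 1) \<le> 2 * ln y" by (intro bound) (simp add: not_less)
    then show False by linarith
  qed
  define J where "J = (LEAST j. Y j < 2)"
  have J: "Y J < 2" unfolding J_def using ex by (rule LeastI_ex)
  have less: "2 \<le> Y j" if "j < J" for j using not_less_Least[of j "\<lambda>j. Y j < 2"] that by (auto simp: J_def)
  have "disjoint_family_on B {..<J}"
  proof -
    have "B i \<inter> B j = {}" if "i < j" for i j
      using anti[of "Suc i" j] that by (auto simp: B_def)
    then have "B i \<inter> B j = {}" if "i \<noteq> j" for i j
      using that by (metis Int_commute linorder_neqE_nat)
    then show ?thesis by (auto simp: disjoint_family_on_def)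
  qed
  moreover have "(\<Union>j<J. B j) = model_primes a y"
  proof
    show "model_primes a y \<subseteq> (\<Union>j<J. B j)"
    proof
      fix q assume q: "q \<in> model_primes a y"
      then have q': "real q \<ge> 2" "real q \<le> Y 0"
        using model_primesD[OF q] prime_ge_2_nat[of q] y by (auto simp: Y_def)
      define k where "k = (LEAST k. Y k < real q)"
      have ex: "Y J < real q" using J q' by linarith
      then have k: "Y k < real q" unfolding k_def by (rule LeastI)
      have kJ: "k \<le> J" unfolding k_def using ex by (rule Least_le)
      obtain j where j: "k = Suc j" using k q' by (cases k) auto
      have "\<not> Y j < real q" using not_less_Least[of j "\<lambda>k. Y k < real q"] j by (auto simp: k_def)
      then show "q \<in> (\<Union>j<J. B j)" using k j kJ q by (auto simp: B_def)
    qed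
  qed (auto simp: B_def)
  moreover have "real J \<le> 1 + 2 * ln y"
  proof (cases J)
    case (Suc j)
    then show ?thesis using bound[OF less[of j]] by simp
  qed (use lny in simp)
  ultimately show ?thesis using that less by blast
qed

lemma sum_block_bounds_le:
  fixes w s :: real
  assumes "w \<ge> ln 2" "\<And>j. j < J \<Longrightarrow> E j \<le> exp (- (real j + 1) * w) + s"
  shows "(\<Sum>j<J. E j) \<le> 2 * exp (- w) + real J * s"
proof -
  have "(\<Sum>j<J. E j) \<le> (\<Sum>j<J. exp (- w) * (1/2) ^ j + s)"
  proof (intro sum_mono)
    fix j assume j: "j \<in> {..<J}"
    have "exp (- w) \<le> 1/2"
    proof -
      have "exp (- w) \<le> exp (- ln 2)" using assms(1) by simp
      then show ?thesis by (simp add: exp_minus)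
    qed
    then have "exp (- w) ^ j \<le> (1/2) ^ j" by (intro power_mono) auto
    moreover have "exp (- (real j + 1) * w) = exp (- w) * exp (- w) ^ j"
      by (simp add: exp_of_nat_mult[symmetric] exp_add[symmetric] algebra_simps)
    ultimately have "exp (- (real j + 1) * w) \<le> exp (- w) * (1/2) ^ j" by simp
    then show "E j \<le> exp (- w) * (1/2) ^ j + s" using assms(2)[of j] j by simp
  qed
  also have "\<dots> = exp (- w) * (\<Sum>j<J. (1/2) ^ j) + real J * s" by (simp add: sum.distrib sum_distrib_left)
  also have "(\<Sum>j<J. (1/2) ^ j) \<le> (2::real)"
    by (simp add: sum_gp_strict)
  finally show ?thesis by (simp add: mult.commute)
qed

text \<open>The exponentiated prime sum is a constant times (log x)^32, and two more logarithms come
  from the number of blocks and from 1/\<pi>(x). So T = A + 34 settles the term divided by (log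
  x)^T, and the exponent T + A + 2 compensates for the factor (log x)^T in the other one. The term
  x^\<beta> saves a power of x because \<beta> < 1.\<close>

lemma level_error_eventually:
  fixes \<beta> A C K :: real
  assumes "\<beta> < 1" "K \<ge> 0" "C \<ge> 0"
  defines "T \<equiv> A + 34"
  obtains M where "M \<ge> 0" "eventually (\<lambda>x. (2 + 2 * ln x) *
     ((ln x powr T * (C * (x / ln x powr (T + A + 2)) + K * x powr \<beta>) + 3 * x * exp (16 * (3 + 2 * ln (2 * ln x))) / ln x powr T) / (x / (4 * ln x)))
      \<le> M * (1 / ln x powr A)) at_top"
proof -
  define c :: real where "c = 3 * exp 48 * 2 ^ 32"
  have c0: "c \<ge> 0" by (simp add: c_def)
  have "eventually (\<lambda>x::real. 16 * ln x ^ 2 * (ln x powr T * K * x powr (\<beta> - 1)) \<le> ln x powr (- A)) at_top"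
    using assms(1) by real_asymp
  moreover have "eventually (\<lambda>x::real. x \<ge> exp 1) at_top" by (rule eventually_ge_at_top)
  ultimately have "eventually (\<lambda>x. (2 + 2 * ln x) *
     ((ln x powr T * (C * (x / ln x powr (T + A + 2)) + K * x powr \<beta>) + 3 * x * exp (16 * (3 + 2 * ln (2 * ln x))) / ln x powr T) / (x / (4 * ln x)))
      \<le> (16 * C + 16 * c + 1) * (1 / ln x powr A)) at_top"
  proof eventually_elim
    case (elim x)
    define l where "l = ln x"
    have x0: "x > 0" using elim(2) exp_gt_zero[of "1::real"] by linarith
    have l: "l \<ge> 1" using elim(2) x0 by (simp add: l_def ln_ge_iff)
    have xb: "x powr \<beta> = x * x powr (\<beta> - 1)" using x0 by (simp add: powr_diff)
    have e: "exp (16 * (3 + 2 * ln (2 * l))) = exp 48 * (2 ^ 32 * l powr 32)"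
    proof -
      have "exp (16 * (3 + 2 * ln (2 * l))) = exp 48 * exp (32 * ln (2 * l))" by (simp add: exp_add[symmetric])
      also have "exp (32 * ln (2 * l)) = (2 * l) powr 32" using l by (simp add: powr_def)
      also have "\<dots> = 2 ^ 32 * l powr 32" using l by (simp add: powr_mult)
      finally show ?thesis .
    qed
    have p1: "l powr T / l powr (T + A + 2) = l powr (- A) / l\<^sup>2"
    proof -
      have "l powr T / l powr (T + A + 2) = l powr (- A - 2)" using l by (simp add: powr_diff[symmetric])
      also have "\<dots> = l powr (- A) / l\<^sup>2" using l by (simp add: powr_diff)
      finally show ?thesis .
    qed
    have p2: "l powr 32 / l powr T = l powr (- A) / l\<^sup>2"
    proof -
      have "l powr 32 / l powr T = l powr (32 - T)" by (rule powr_diff[symmetric])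
      also have "32 - T = - A - 2" by (simp add: T_def)
      also have "l powr (- A - 2) = l powr (- A) / l\<^sup>2" using l by (simp add: powr_diff)
      finally show ?thesis .
    qed
    have eq: "(l powr T * (C * (x / l powr (T + A + 2)) + K * x powr \<beta>) + 3 * x * exp (16 * (3 + 2 * ln (2 * l))) / l powr T) / (x / (4 * l))
      = 4 * l * (C * (l powr T / l powr (T + A + 2)) + l powr T * K * x powr (\<beta> - 1) + c * (l powr 32 / l powr T))"
      unfolding e xb c_def using x0 l by (simp add: field_simps)
    have "(2 + 2 * l) * (4 * l * (C * (l powr T / l powr (T + A + 2)) + l powr T * K * x powr (\<beta> - 1) + c * (l powr 32 / l powr T)))
       \<le> (4 * l) * (4 * l * (C * (l powr T / l powr (T + A + 2)) + l powr T * K * x powr (\<beta> - 1) + c * (l powr 32 / l powr T)))"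
      using l c0 assms by (intro mult_right_mono mult_nonneg_nonneg add_nonneg_nonneg) auto
    also have "\<dots> = 16 * C * l powr (- A) + 16 * l ^ 2 * (l powr T * K * x powr (\<beta> - 1)) + 16 * c * l powr (- A)"
      unfolding p1 p2 using l by (simp add: power2_eq_square field_simps)
    also have "\<dots> \<le> (16 * C + 16 * c + 1) * l powr (- A)"
      using elim(1) unfolding l_def[symmetric] by (simp add: algebra_simps)
    also have "l powr (- A) = 1 / l powr A" by (simp add: powr_minus divide_inverse)
    finally show ?case unfolding eq[symmetric] unfolding l_def .
  qed
  moreover have "16 * C + 16 * c + 1 \<ge> 0" using c0 assms by simp
  ultimately show ?thesis using that by blast
qed

lemma d_TV_bound_fixed_level:
  fixes a :: int and A \<alpha> \<gamma> :: real
  assumes a: "a \<noteq> 0" and A: "A > 0" and \<alpha>: "0 < \<alpha>" "\<alpha> < \<gamma>" and Z: "hypothesis_Z \<gamma>"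
  obtains C u0 x0 where "C \<ge> 0" "u0 \<ge> 1" "x0 \<ge> 2" "\<And>x y. 2 \<le> y \<Longrightarrow> y \<le> x \<Longrightarrow> x \<ge> x0 \<Longrightarrow> ln x / ln y \<ge> u0 \<Longrightarrow>
     d_TV (W_vec a y) (U_vec a x y) \<le> C * (exp (- (\<alpha> * (ln x / ln y) * ln (ln x / ln y))) + 1 / ln x powr A)"
proof -
  have \<gamma>1: "\<gamma> \<le> 1" by (rule hypothesis_Z_imp_le_1[OF Z])
  define \<beta> where "\<beta> = (\<alpha> + \<gamma>) / 2"
  have \<beta>: "\<alpha> < \<beta>" "\<beta> < \<gamma>" "\<beta> > 0" using \<alpha> by (auto simp: \<beta>_def)
  \<comment> \<open>The second bound gives r \<gamma> < \<gamma> - \<beta>, that is, \<beta> / (1 -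
    r) < \<gamma>: the levels x^(\<beta> r^j) multiply to less than x^\<gamma>. The first one makes
    r^(-j) at least 2^j.\<close>
  define r where "r = min (1/2) ((\<gamma> - \<beta>) / (2 * \<gamma>))"
  have r: "0 < r" "r \<le> 1/2" "r \<le> (\<gamma> - \<beta>) / (2 * \<gamma>)" using \<beta> by (auto simp: r_def)
  define \<beta>1 where "\<beta>1 = \<beta> / (1 - r)"
  have \<beta>1: "\<beta>1 < \<gamma>" "\<beta>1 > 0"
  proof -
    have "r * (2 * \<gamma>) \<le> \<gamma> - \<beta>" using r(3) \<beta> by (simp add: field_simps)
    then have "\<beta> < \<gamma> * (1 - r)" using \<beta>(2) by (simp add: algebra_simps)
    then show "\<beta>1 < \<gamma>" "\<beta>1 > 0" using r \<beta> by (auto simp: \<beta>1_def divide_less_eq)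
  qed
  \<comment> \<open>This is \<open>sum_primes_block_le\<close> with \<kappa> = r^2, the ratio of the
    logarithms of consecutive block edges.\<close>
  define L where "L = 1 + 4 / r\<^sup>2"
  have L: "L > 0" unfolding L_def using r by (simp add: add_pos_nonneg)
  \<comment> \<open>Chosen so that (1 - 2\<eta>) \<beta> is the midpoint of \<alpha> and \<beta>;
    hence (1 - \<eta>)^2 \<beta> still exceeds \<alpha>.\<close>
  define \<eta> where "\<eta> = (\<beta> - \<alpha>) / (4 * \<beta>)"
  have \<eta>: "0 < \<eta>" "\<eta> \<le> 1/4" using \<beta> \<alpha> by (auto simp: \<eta>_def field_simps)
  define \<kappa> where "\<kappa> = (1 - \<eta>)\<^sup>2 * \<beta>"
  have \<kappa>: "\<alpha> < \<kappa>"
  proof -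
    have "\<alpha> < (1 - 2 * \<eta>) * \<beta>" using \<beta> by (simp add: \<eta>_def field_simps)
    also have "\<dots> \<le> \<kappa>" unfolding \<kappa>_def using \<beta> by (intro mult_right_mono) (auto simp: power2_eq_square algebra_simps)
    finally show ?thesis .
  qed
  obtain U0 where U0: "\<And>U Y D. U \<ge> U0 \<Longrightarrow> Y \<ge> 2 \<Longrightarrow> D > 0 \<Longrightarrow> ln D = U * ln Y \<Longrightarrow>
     \<exists>\<sigma>. 0 \<le> \<sigma> \<and> \<sigma> \<le> 1/2 \<and> rankin_bound D Y \<sigma> L \<le> exp (- ((1 - \<eta>)\<^sup>2 * (U * ln U))) + exp (- ((1 - \<eta>) / 2 * ln D))"
    using rankin_bound_optimised[OF L \<eta>] by blast
  define T where "T = A + 34"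
  define Bz where "Bz = T + A + 2"
  \<comment> \<open>Hypothesis Z is used with \<epsilon> = \<gamma> - \<beta>1, so that the moduli
    run exactly up to x^\<beta>1.\<close>
  obtain \<delta> where \<delta>: "\<delta> > 0" and "\<forall>B\<ge>1. \<forall>a::int. a \<noteq> 0 \<longrightarrow> (\<exists>C::real. \<forall>x\<ge>2.
         (\<Sum>m | 1 \<le> m \<and> real m \<le> x powr (\<gamma> - (\<gamma> - \<beta>1)) \<and>
                real (largest_prime_factor m) \<le> x powr \<delta> \<and> coprime (int m) a.
            \<bar>real (prime_count_cong x m (- a)) - real (prime_count x) / real (totient m)\<bar>)
         \<le> C * (x / ln x powr B))"
    using Z[unfolded hypothesis_Z_def, rule_format, of "\<gamma> - \<beta>1"] \<beta>1 by auto
  from this(2)[rule_format, of Bz a] obtain Cz where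
    Cz: "\<And>x. x \<ge> 2 \<Longrightarrow> (\<Sum>m | 1 \<le> m \<and> real m \<le> x powr \<beta>1 \<and>
                real (largest_prime_factor m) \<le> x powr \<delta> \<and> coprime (int m) a.
            \<bar>real (prime_count_cong x m (- a)) - real (prime_count x) / real (totient m)\<bar>)
         \<le> Cz * (x / ln x powr Bz)"
    using A a by (auto simp: Bz_def T_def)
  define K where "K = 2 * (real_of_int \<bar>a\<bar> + 1)"
  have K0: "K \<ge> 0" by (simp add: K_def)
  obtain M where M: "M \<ge> 0" "eventually (\<lambda>x. (2 + 2 * ln x) *
     ((ln x powr T * (\<bar>Cz\<bar> * (x / ln x powr Bz) + K * x powr \<beta>1) + 3 * x * exp (16 * (3 + 2 * ln (2 * ln x))) / ln x powr T) / (x / (4 * ln x)))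
      \<le> M * (1 / ln x powr A)) at_top"
    using level_error_eventually[of \<beta>1 K "\<bar>Cz\<bar>" A] \<beta>1 \<gamma>1 K0 unfolding T_def[symmetric] Bz_def[symmetric] by auto
  \<comment> \<open>The number of blocks times the loss in blocks where the cap on the Rankin
    exponent takes effect.\<close>
  have "eventually (\<lambda>x::real. (1 + 2 * ln x) * exp (- (\<beta> / 8 * sqrt (ln x))) \<le> 1 / ln x powr A) at_top"
    using \<beta>(3) A by real_asymp
  with M(2) card_large_primes_lower[of a] eventually_ge_at_top[of "exp 1 :: real"]
  have "eventually (\<lambda>x. (2 + 2 * ln x) *
     ((ln x powr T * (\<bar>Cz\<bar> * (x / ln x powr Bz) + K * x powr \<beta>1) + 3 * x * exp (16 * (3 + 2 * ln (2 * ln x))) / ln x powr T) / (x / (4 * ln x)))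
      \<le> M * (1 / ln x powr A) \<and> real (card (large_primes a x)) \<ge> x / (4 * ln x) \<and> x \<ge> exp 1 \<and>
      (1 + 2 * ln x) * exp (- (\<beta> / 8 * sqrt (ln x))) \<le> 1 / ln x powr A) at_top"
    by eventually_elim auto
  then obtain x1 where x1: "\<And>x. x \<ge> x1 \<Longrightarrow> (2 + 2 * ln x) *
     ((ln x powr T * (\<bar>Cz\<bar> * (x / ln x powr Bz) + K * x powr \<beta>1) + 3 * x * exp (16 * (3 + 2 * ln (2 * ln x))) / ln x powr T) / (x / (4 * ln x)))
      \<le> M * (1 / ln x powr A) \<and> real (card (large_primes a x)) \<ge> x / (4 * ln x) \<and> x \<ge> exp 1 \<and>
      (1 + 2 * ln x) * exp (- (\<beta> / 8 * sqrt (ln x))) \<le> 1 / ln x powr A"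
    by (auto simp: eventually_at_top_linorder)
  \<comment> \<open>The gap between \<kappa> and \<alpha> pays for replacing ln (\<beta> u) by ln u.
    The last conjunct makes the ratio of the geometric series over the blocks at most 1/2.\<close>
  have "eventually (\<lambda>u::real. \<kappa> * ln (\<beta> * u) \<ge> \<alpha> * ln u \<and> \<beta> * u \<ge> 1 \<and> \<alpha> * u * ln u \<ge> ln 2) at_top"
    using \<kappa> \<beta> \<alpha> by (intro eventually_conj; real_asymp)
  then obtain u1 where u1: "\<And>u. u \<ge> u1 \<Longrightarrow> \<kappa> * ln (\<beta> * u) \<ge> \<alpha> * ln u \<and> \<beta> * u \<ge> 1 \<and> \<alpha> * u * ln u \<ge> ln 2"
    by (auto simp: eventually_at_top_linorder)
  \<comment> \<open>1/\<delta> yields y \<le> x^\<delta>, and U0/\<beta> brings every block into the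
    range of the optimised Rankin bound.\<close>
  define u0 where "u0 = Max {1, u1, 1 / \<delta>, U0 / \<beta>}"
  have u0: "u0 \<ge> 1" "u0 \<ge> u1" "u0 \<ge> 1 / \<delta>" "u0 \<ge> U0 / \<beta>" by (auto simp: u0_def)
  define C where "C = 2 * exp 3 + 3 + M + (exp 3 + 1)"
  show ?thesis
  proof (rule that[of C u0 "max 2 x1"])
    show "C \<ge> 0" using M(1) by (simp add: C_def add_nonneg_nonneg)
    fix x y :: real assume xy: "2 \<le> y" "y \<le> x" and x: "max 2 x1 \<le> x" and u: "u0 \<le> ln x / ln y"
    define u where "u = ln x / ln y"
    define l where "l = ln x"
    define w where "w = \<alpha> * u * ln u"
    note X = x1[of x]
    have xe: "x \<ge> exp 1" using X x by simp
    have l1: "l \<ge> 1" using xe xy by (simp add: l_def ln_ge_iff)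
    have lny: "ln y > 0" "ln y \<le> l" using xy by (auto simp: l_def)
    have ul: "u * ln y = l" using lny by (simp add: u_def l_def)
    have uu: "u \<ge> 1" "u \<ge> u1" "u \<ge> 1 / \<delta>" "u \<ge> U0 / \<beta>" using u u0 unfolding u_def by linarith+
    note U = u1[OF uu(2)]
    have w: "w \<ge> ln 2" "w \<ge> 0" using U ln2_ge_two_thirds unfolding w_def by linarith+
    define Y where "Y j = y powr (r ^ (2 * j))" for j :: nat
    define D where "D j = x powr (\<beta> * r ^ j)" for j :: nat
    define B where "B j = {q \<in> model_primes a y. Y (Suc j) < real q \<and> real q \<le> Y j}" for j
    obtain J where J: "\<And>j. j < J \<Longrightarrow> 2 \<le> Y j" "disjoint_family_on B {..<J}" "(\<Union>j<J. B j) = model_primes a y"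
       "real J \<le> 1 + 2 * ln y"
      using prime_blocks[OF r(1,2) xy(1), of a] unfolding Y_def[symmetric] B_def[symmetric] by blast
    have lnY: "ln (Y j) = r ^ (2 * j) * ln y" for j using xy by (simp add: Y_def ln_powr)
    have lnD: "ln (D j) = \<beta> * r ^ j * l" for j using xy by (simp add: D_def ln_powr l_def)
    have D0: "D j > 0" for j using xy by (simp add: D_def)
    have block: "\<exists>\<sigma>. 0 \<le> \<sigma> \<and> \<sigma> \<le> 1/2 \<and> rankin_bound (D j) (Y j) \<sigma> L \<le> exp (- (real j + 1) * w) + exp (- (\<beta> / 8 * sqrt l))"
      if j: "j < J" for j
    proof -
      \<comment> \<open>The quotient ln (D j) / ln (Y j). It is at least 2^j \<beta> u, and 2^j
        \<ge> j + 1 produces the geometric decay in j.\<close>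
      define Uj where "Uj = \<beta> * u / r ^ j"
      have rj: "r ^ j > 0" "r ^ j \<le> (1/2) ^ j" using r by (auto intro: power_mono)
      have "2 ^ j * r ^ j \<le> 2 ^ j * (1/2) ^ j" using rj by (intro mult_left_mono) auto
      then have "2 ^ j * r ^ j \<le> 1" by (simp add: power_one_over)
      then have inv: "1 / r ^ j \<ge> 2 ^ j" using rj by (simp add: field_simps)
      have Uj2: "Uj \<ge> 2 ^ j * (\<beta> * u)"
        using mult_left_mono[OF inv, of "\<beta> * u"] \<beta> uu(1) by (simp add: Uj_def mult.commute)
      have "(1::real) * (\<beta> * u) \<le> 2 ^ j * (\<beta> * u)" using \<beta> uu(1) by (intro mult_right_mono) auto
      then have Uj1: "Uj \<ge> \<beta> * u" using Uj2 by linarith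
      have "Uj \<ge> U0" using Uj1 uu(4) \<beta> by (simp add: field_simps)
      moreover have "ln (D j) = Uj * ln (Y j)"
      proof -
        have "Uj * ln (Y j) = \<beta> * (u * ln y) * (r ^ (2 * j) / r ^ j)" by (simp add: lnY Uj_def)
        also have "r ^ (2 * j) / r ^ j = r ^ j" using rj by (simp add: mult_2 power_add)
        finally show ?thesis by (simp add: lnD ul mult_ac)
      qed
      ultimately obtain \<sigma> where \<sigma>: "0 \<le> \<sigma>" "\<sigma> \<le> 1/2" "rankin_bound (D j) (Y j) \<sigma> L \<le> exp (- ((1 - \<eta>)\<^sup>2 * (Uj * ln Uj))) + exp (- ((1 - \<eta>) / 2 * ln (D j)))"
        using U0[OF _ J(1)[OF j] D0] by blast
      have "(real j + 1) * w \<le> (1 - \<eta>)\<^sup>2 * (Uj * ln Uj)"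
      proof -
        have bu: "0 \<le> ln (\<beta> * u)" using U by simp
        have "ln (\<beta> * u) \<le> ln Uj" using Uj1 U by (intro ln_mono) auto
        then have "(2 ^ j * (\<beta> * u)) * ln (\<beta> * u) \<le> Uj * ln Uj"
          using Uj2 bu \<beta> uu(1) by (intro mult_mono) (auto intro: order.trans[OF _ Uj2])
        then have "(1 - \<eta>)\<^sup>2 * ((2 ^ j * (\<beta> * u)) * ln (\<beta> * u)) \<le> (1 - \<eta>)\<^sup>2 * (Uj * ln Uj)"
          by (intro mult_left_mono) auto
        moreover have "(1 - \<eta>)\<^sup>2 * ((2 ^ j * (\<beta> * u)) * ln (\<beta> * u)) = 2 ^ j * u * (\<kappa> * ln (\<beta> * u))"
          by (simp add: \<kappa>_def mult_ac)
        moreover have "2 ^ j * u * (\<alpha> * ln u) \<le> 2 ^ j * u * (\<kappa> * ln (\<beta> * u))"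
          using U uu(1) by (intro mult_left_mono) auto
        moreover have "2 ^ j * u * (\<alpha> * ln u) = 2 ^ j * w" by (simp add: w_def mult_ac)
        moreover have "(real j + 1) * w \<le> 2 ^ j * w"
        proof (intro mult_right_mono w)
          have "real (j + 1) \<le> real (2 ^ j)" unfolding of_nat_le_iff using less_exp[of j] by linarith
          then show "real j + 1 \<le> 2 ^ j" by simp
        qed
        ultimately show ?thesis by linarith
      qed
      then have 1: "exp (- ((1 - \<eta>)\<^sup>2 * (Uj * ln Uj))) \<le> exp (- (real j + 1) * w)"
        by (simp only: exp_le_cancel_iff minus_mult_left[symmetric] neg_le_iff_le)
      \<comment> \<open>A block that is in use has Y j \<ge> 2, which bounds r^(2j) ln y from below.
        Hence r^j is at least of order 1 / sqrt (ln x), and even the last level is at least exp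
        (\<beta>/2 * sqrt (ln x)).\<close>
      have "sqrt l / 2 \<le> r ^ j * l"
      proof -
        have "ln 2 \<le> ln (Y j)" using J(1)[OF j] by simp
        then have "1/4 \<le> r ^ (2 * j) * ln y" unfolding lnY using ln2_ge_two_thirds by linarith
        also have "\<dots> \<le> r ^ (2 * j) * l" using lny r by (intro mult_left_mono) auto
        finally have "1/4 * l \<le> r ^ (2 * j) * l * l" using l1 by (intro mult_right_mono) auto
        moreover have "r ^ (2 * j) * l * l = (r ^ j * l)\<^sup>2"
          by (simp add: power_mult_distrib power2_eq_square mult_2 power_add)
        ultimately have "l / 4 \<le> (r ^ j * l)\<^sup>2" by simp
        then have "sqrt (l / 4) \<le> r ^ j * l" using rj l1 by (intro real_le_lsqrt) auto
        then show ?thesis by (simp add: real_sqrt_divide)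
      qed
      then have "\<beta> * (sqrt l / 2) \<le> \<beta> * (r ^ j * l)" using \<beta> by (intro mult_left_mono) auto
      then have "3/8 * (\<beta> * (sqrt l / 2)) \<le> (1 - \<eta>) / 2 * (\<beta> * (r ^ j * l))"
        using \<eta> \<beta> l1 by (intro mult_mono) auto
      moreover have "\<beta> / 8 * sqrt l \<le> 3/8 * (\<beta> * (sqrt l / 2))" using \<beta> l1 by simp
      ultimately have "\<beta> / 8 * sqrt l \<le> (1 - \<eta>) / 2 * ln (D j)" unfolding lnD by (simp add: mult.assoc)
      then have 2: "exp (- ((1 - \<eta>) / 2 * ln (D j))) \<le> exp (- (\<beta> / 8 * sqrt l))" by simp
      show ?thesis using order.trans[OF \<sigma>(3) add_mono[OF 1 2]] \<sigma>(1,2) by blast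
    qed
    then obtain \<sigma> where \<sigma>: "\<And>j. j < J \<Longrightarrow> 0 \<le> \<sigma> j \<and> \<sigma> j \<le> 1/2"
       "\<And>j. j < J \<Longrightarrow> rankin_bound (D j) (Y j) (\<sigma> j) L \<le> exp (- (real j + 1) * w) + exp (- (\<beta> / 8 * sqrt l))"
      by metis
    define S where "S = (\<Sum>j<J. rankin_bound (D j) (Y j) (\<sigma> j) L)"
    have "S \<le> 2 * exp (- w) + real J * exp (- (\<beta> / 8 * sqrt l))"
      unfolding S_def by (rule sum_block_bounds_le[OF w(1) \<sigma>(2)])
    also have "real J * exp (- (\<beta> / 8 * sqrt l)) \<le> (1 + 2 * l) * exp (- (\<beta> / 8 * sqrt l))"
      using J(4) lny by (intro mult_right_mono) auto
    also have "\<dots> \<le> 1 / l powr A" using X x by (simp add: l_def)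
    finally have S: "S \<le> 2 * exp (- w) + 1 / l powr A" by simp
    have S0: "S \<ge> 0" unfolding S_def by (intro sum_nonneg) (simp add: rankin_bound_def)
    have "exp (- w) \<le> 1" "1 / l powr A \<le> 1" using w l1 A by (auto simp: ge_one_powr_ge_zero)
    then have S3: "S \<le> 3" using S by linarith
    have xpos: "x / (4 * l) > 0" using xy l1 by simp
    have N: "real (card (large_primes a x)) \<ge> x / (4 * l)" using X x by (simp add: l_def)
    have ne: "large_primes a x \<noteq> {}" using N xpos by auto
    \<comment> \<open>\<open>V\<close> may depend on \<open>x\<close> and \<open>y\<close>, since no
      other estimate involves its size.\<close>
    obtain V where V: "real (card (model_primes a y)) / 2 ^ V \<le> 1 / l powr A"
    proof -
      obtain V where "real (card (model_primes a y)) * l powr A < 2 ^ V" using real_arch_pow[of 2] by auto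
      then have "real (card (model_primes a y)) / 2 ^ V \<le> 1 / l powr A" using l1 by (simp add: field_simps)
      then show ?thesis using that by blast
    qed
    define Er where "Er = (\<Sum>v | v \<in> vecs (model_primes a y) (Suc V) \<and> real (vec_prod (model_primes a y) v) \<le> x powr \<beta>1.
            (\<Prod>q\<in>model_primes a y. if v q = 0 then 1 else 2) * level_error a x y v)"
    have "d_TV (W_vec a y) (U_vec a x y) \<le> S * exp S + S + real (card (model_primes a y)) / 2 ^ V + (1 + real J) * Er"
      unfolding S_def Er_def
    proof (rule d_TV_le_rankin[OF a ne J(2,3)])
      show "real q \<le> Y i" if "q \<in> B i" for i q using that by (simp add: B_def)
      show "(\<Sum>q\<in>B i. 1 / (real q - 1)) \<le> L" if "i < J" for i unfolding L_def
      proof (rule sum_primes_block_le[OF J(1)[OF that]])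
        fix q assume q: "q \<in> B i"
        have "Y i powr r\<^sup>2 = Y (Suc i)" unfolding Y_def powr_powr by (simp add: power_add[symmetric] del: power_Suc)
        then show "prime q \<and> Y i powr r\<^sup>2 < real q \<and> real q \<le> Y i" using q model_primesD by (auto simp: B_def)
      qed (use r in auto)
      have "(\<Prod>i<J. D i) = x powr (\<Sum>i<J. \<beta> * r ^ i)"
        unfolding D_def using xy by (subst powr_sum) auto
      also have "\<dots> \<le> x powr \<beta>1"
      proof (intro powr_mono)
        have "(\<Sum>i<J. \<beta> * r ^ i) = \<beta> * ((1 - r ^ J) / (1 - r))"
          using r by (simp add: sum_distrib_left[symmetric] sum_gp_strict)
        also have "\<dots> \<le> \<beta> * (1 / (1 - r))" using r \<beta> by (intro mult_left_mono divide_right_mono) auto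
        finally show "(\<Sum>i<J. \<beta> * r ^ i) \<le> \<beta>1" by (simp add: \<beta>1_def)
      qed (use xy in auto)
      finally show "(\<Prod>i<J. D i) \<le> x powr \<beta>1" .
    qed (use J(1) D0 \<sigma>(1) in auto)
    moreover have "(1 + real J) * Er \<le> M * (1 / l powr A)"
    proof -
      let ?N = "real (card (large_primes a x))"
      let ?num = "l powr T * (\<bar>Cz\<bar> * (x / l powr Bz) + K * x powr \<beta>1) + 3 * x * exp (16 * (3 + 2 * ln (2 * l))) / l powr T"
      have num0: "0 \<le> ?num" using xy K0 by (intro add_nonneg_nonneg mult_nonneg_nonneg divide_nonneg_nonneg) auto
      have "Er \<le> ?num / ?N" unfolding Er_def K_def
      proof (rule sum_level_error_le[OF a ne xy])
        show "x powr \<beta>1 \<le> x" using powr_mono[of \<beta>1 1 x] \<beta>1 \<gamma>1 xy by simp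
        show "0 < l powr T" using l1 by simp
        show "y \<le> x powr \<delta>"
        proof -
          have "1 \<le> u * \<delta>" using uu(3) \<delta> by (simp add: field_simps)
          then have "ln y * 1 \<le> ln y * (u * \<delta>)" using lny by (intro mult_left_mono) auto
          also have "\<dots> = \<delta> * l" using ul by (simp add: mult_ac)
          finally have "exp (ln y) \<le> exp (\<delta> * l)" by simp
          then show ?thesis using xy by (simp add: powr_def l_def)
        qed
        show "(\<Sum>m | 1 \<le> m \<and> real m \<le> x powr \<beta>1 \<and> real (largest_prime_factor m) \<le> x powr \<delta> \<and> coprime (int m) a.
            \<bar>real (prime_count_cong x m (- a)) - real (prime_count x) / real (totient m)\<bar>) \<le> \<bar>Cz\<bar> * (x / l powr Bz)"
        proof (rule order.trans[OF Cz])
          show "Cz * (x / ln x powr Bz) \<le> \<bar>Cz\<bar> * (x / l powr Bz)"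
            unfolding l_def using xy by (intro mult_right_mono) auto
        qed (use xy in auto)
        show "(\<Sum>q\<in>model_primes a y. 1 / (real q - 1)) \<le> 3 + 2 * ln (2 * l)"
          unfolding l_def using xy model_primesD by (intro sum_primes_le) force+
      qed auto
      also have "\<dots> \<le> ?num / (x / (4 * l))" using num0 N xpos by (intro divide_left_mono mult_pos_pos) linarith+
      finally have Er: "Er \<le> ?num / (x / (4 * l))" .
      have "(1 + real J) * Er \<le> (2 + 2 * l) * (?num / (x / (4 * l)))"
        using J(4) lny l1 Er num0 xpos
        by (intro mult_mono Er divide_nonneg_nonneg) (auto simp: Er_def intro!: sum_nonneg mult_nonneg_nonneg prod_nonneg simp: level_error_def)
      also have "\<dots> \<le> M * (1 / l powr A)" using X x by (simp add: l_def)
      finally show ?thesis .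
    qed
    moreover have "S * exp S \<le> S * exp 3" using S0 S3 by (intro mult_left_mono) auto
    ultimately have "d_TV (W_vec a y) (U_vec a x y) \<le> S * exp 3 + S + 1 / l powr A + M * (1 / l powr A)"
      using V by linarith
    also have "\<dots> = (exp 3 + 1) * S + (1 + M) * (1 / l powr A)"
    proof -
      have "S * exp 3 + S + p + M * p = (exp 3 + 1) * S + (1 + M) * p" for p by (simp add: algebra_simps)
      then show ?thesis .
    qed
    also have "\<dots> \<le> (exp 3 + 1) * (2 * exp (- w) + 1 / l powr A) + (1 + M) * (1 / l powr A)"
      using S by (intro add_right_mono mult_left_mono) (auto simp: add_nonneg_nonneg)
    also have "\<dots> = (2 * exp 3 + 2) * exp (- w) + (exp 3 + 2 + M) * (1 / l powr A)"
    proof -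
      have "(exp 3 + 1) * (2 * v + p) + (1 + M) * p = (2 * exp 3 + 2) * v + (exp 3 + 2 + M) * p" for v p
        by (simp add: algebra_simps)
      then show ?thesis .
    qed
    also have "\<dots> \<le> C * exp (- w) + C * (1 / l powr A)"
      using M(1) l1 by (intro add_mono mult_right_mono) (auto simp: C_def)
    also have "\<dots> = C * (exp (- (\<alpha> * (ln x / ln y) * ln (ln x / ln y))) + 1 / ln x powr A)"
      by (simp add: w_def u_def l_def distrib_left)
    finally show "d_TV (W_vec a y) (U_vec a x y) \<le> C * (exp (- (\<alpha> * (ln x / ln y) * ln (ln x / ln y))) + 1 / ln x powr A)" .
  qed (use u0 in auto)
qed

lemma d_TV_bound:
  fixes a :: int and A \<alpha> \<gamma> :: real
  assumes a: "a \<noteq> 0" and A: "A > 0" and \<alpha>: "0 < \<alpha>" "\<alpha> < \<gamma>" and Z: "hypothesis_Z \<gamma>"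
  shows "\<exists>C. \<forall>x y. 2 \<le> y \<longrightarrow> y \<le> x \<longrightarrow>
     d_TV (W_vec a y) (U_vec a x y) \<le> C * (exp (- \<alpha> * (ln x / ln y) * ln (ln x / ln y)) + 1 / ln x powr A)"
proof -
  obtain C u0 x0 where C: "C \<ge> 0" "u0 \<ge> 1" "x0 \<ge> 2" "\<And>x y. 2 \<le> y \<Longrightarrow> y \<le> x \<Longrightarrow> x \<ge> x0 \<Longrightarrow> ln x / ln y \<ge> u0 \<Longrightarrow>
     d_TV (W_vec a y) (U_vec a x y) \<le> C * (exp (- (\<alpha> * (ln x / ln y) * ln (ln x / ln y))) + 1 / ln x powr A)"
    using d_TV_bound_fixed_level[OF assms] by metis
  \<comment> \<open>As u ln u increases for u \<ge> 1, the first error term is at least 1/C1 when u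
    < u0; likewise the second is at least 1/C2 when x < x0. A total variation distance is at most 1,
    so both ranges are settled.\<close>
  define C1 where "C1 = exp (\<alpha> * u0 * ln u0)"
  define C2 where "C2 = ln x0 powr A"
  have pos: "C1 > 0" "C2 > 0" using C(3) by (auto simp: C1_def C2_def)
  show ?thesis
  proof (intro exI[of _ "C + C1 + C2"] allI impI)
    fix x y :: real assume xy: "2 \<le> y" "y \<le> x"
    define u where "u = ln x / ln y"
    define e1 where "e1 = exp (- \<alpha> * u * ln u)"
    define e2 where "e2 = 1 / ln x powr A"
    have e: "e1 \<ge> 0" "e2 \<ge> 0" by (auto simp: e1_def e2_def)
    have lny: "ln y > 0" "ln y \<le> ln x" using xy by auto
    have u1: "u \<ge> 1" using lny by (simp add: u_def)
    have prods: "C * e1 \<ge> 0" "C * e2 \<ge> 0" "C1 * e1 \<ge> 0" "C1 * e2 \<ge> 0" "C2 * e1 \<ge> 0" "C2 * e2 \<ge> 0"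
      using e pos C(1) by auto
    consider "x \<ge> x0 \<and> u \<ge> u0" | "x < x0" | "u < u0" by linarith
    then have "d_TV (W_vec a y) (U_vec a x y) \<le> (C + C1 + C2) * (e1 + e2)"
    proof cases
      case 1
      then have "d_TV (W_vec a y) (U_vec a x y) \<le> C * (e1 + e2)"
        using C(4)[OF xy] by (simp add: u_def e1_def e2_def)
      then show ?thesis using prods by (simp add: algebra_simps)
    next
      case 2
      have "ln x powr A \<le> C2" unfolding C2_def using 2 xy lny A by (intro powr_mono2) auto
      moreover have "ln x powr A > 0" using lny by simp
      ultimately have "1 \<le> C2 * e2" by (simp add: e2_def field_simps)
      then show ?thesis using prods d_TV_le_1[of "W_vec a y" "U_vec a x y"] by (simp add: algebra_simps)
    next
      case 3
      have "u * ln u \<le> u0 * ln u0" using 3 u1 by (intro mult_mono) auto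
      then have "\<alpha> * (u * ln u) \<le> \<alpha> * (u0 * ln u0)" using \<alpha> by (intro mult_left_mono) auto
      then have "1 \<le> C1 * e1" by (simp add: C1_def e1_def exp_add[symmetric] mult.assoc)
      then show ?thesis using prods d_TV_le_1[of "W_vec a y" "U_vec a x y"] by (simp add: algebra_simps)
    qed
    then show "d_TV (W_vec a y) (U_vec a x y) \<le> (C + C1 + C2) * (exp (- \<alpha> * (ln x / ln y) * ln (ln x / ln y)) + 1 / ln x powr A)"
      by (simp add: e1_def e2_def u_def)
  qed
qed

theorem theorem1:
  fixes a :: int and A \<alpha> :: real
  assumes "a \<noteq> 0" and "A > 0" and "0 < \<alpha>"
  shows "\<exists>C::real. \<forall>\<gamma>::real. \<gamma> > 0 \<longrightarrow> hypothesis_Z \<gamma> \<longrightarrow> \<alpha> < \<gamma> \<longrightarrow>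
           (\<forall>x y::real. 2 \<le> y \<longrightarrow> y \<le> x \<longrightarrow>
             (let u = ln x / ln y in
              d_TV (W_vec a y) (U_vec a x y)
                \<le> C * (exp (- \<alpha> * u * ln u) + 1 / ln x powr A)))"
proof (cases "\<exists>\<gamma>. hypothesis_Z \<gamma> \<and> \<alpha> < \<gamma>")
  \<comment> \<open>The estimate itself does not mention \<gamma>, so the constant obtained for one
    admissible \<gamma> serves them all; this is how \<open>C\<close> can be chosen before
    \<gamma>.\<close>
  case True
  then show ?thesis using d_TV_bound[OF assms] unfolding Let_def by blast
qed blast

end
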